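(* Let $0<\beta<1$, $1<p<n/\beta$, $1/s=1/p-\beta/n$, $0<\kappa<p/s$ and let $w$ be a weight on $\mathbb R^n$ with $w^{s/p}\in A_1$. Let $T$ be a Calderón–Zygmund singular integral operator on $\mathbb R^n$. Suppose that $b\in Lip_\beta(w)$ and $r_w>\frac{1-\kappa}{p/s-\kappa}$, where $r_w$ denotes the critical index of $w$ for the reverse Hölder condition. Then the commutator $[b,T]f(x)=b(x)Tf(x)-T(bf)(x)$ is bounded from $L^{p,\kappa}(w)$ to $L^{s,\kappa s/p}(w^{1-s},w)$.
   Context: A weight is a locally integrable function on $\mathbb R^n$ with values in $(0,\infty)$ a.e. Cubes $Q$ have sides parallel to the axes; $|Q|$ is Lebesgue measure and $w(Q)=\int_Q w\,dx$. $v\in A_1$ means there is $C$ with $\frac1{|Q|}\int_Q v\,dx\le C\,\mathrm{ess\,inf}_{x\in Q}v(x)$ for all cubes $Q$. For $r>1$, $w\in RH_r$ means there is $C>0$ with $\left(\frac1{|Q|}\int_Q w^r\,dx\right)^{1/r}\le C\,\frac1{|Q|}\int_Q w\,dx$ for all cubes $Q$; $r_w=\sup\{r>1:w\in RH_r\}$. $T$ is a Calderón–Zygmund singular integral operator if there is a kernel function $K$ such that: (a) $Tf(x)=\mathrm{P.V.}\int_{\mathbb R^n}K(x-y)f(y)\,dy$ (principal value); (b) $|K(x)|\le C|x|^{-n}$ for $x\ne0$; (c) $|K(x-y)-K(x)|\le C|y|/|x|^{n+1}$ for $|x|\ge2|y|>0$. $b\in Lip_\beta(w)$ means $b$ is locally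 integrable and $\|b\|_{Lip_\beta(w)}=\sup_Q\frac1{w(Q)^{\beta/n}}\cdot\frac1{w(Q)}\int_Q|b(x)-b_Q|\,dx<\infty$, where $b_Q=\frac1{|Q|}\int_Q b(y)\,dy$ and the supremum is over all cubes. Weighted Morrey spaces: for $1\le p<\infty$, $0<\kappa<1$ and weights $u,v$, $L^{p,\kappa}(u,v)$ is the set of $f\in L^p_{loc}(u)$ with $\|f\|_{L^{p,\kappa}(u,v)}=\sup_Q\left(\frac1{v(Q)^\kappa}\int_Q|f(x)|^pu(x)\,dx\right)^{1/p}<\infty$ (supremum over all cubes); $L^{p,\kappa}(w)=L^{p,\kappa}(w,w)$. *)

theory Defs
  imports "HOL-Analysis.Analysis" "HOL-Probability.Essential_Supremum"
begin

definition cubes :: "(real^'n) set set" where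
  "cubes = {cbox a (a + l *\<^sub>R One) | a l. 0 < l}"

definition average :: "(real^'n) set \<Rightarrow> (real^'n \<Rightarrow> 'b::{banach, second_countable_topology}) \<Rightarrow> 'b" where
  "average Q f = (1 / measure lebesgue Q) *\<^sub>R (LINT x:Q|lebesgue. f x)"

definition locally_integrable :: "(real^'n \<Rightarrow> 'b::{banach, second_countable_topology}) \<Rightarrow> bool" where
  "locally_integrable f \<longleftrightarrow> (\<forall>S. compact S \<longrightarrow> set_integrable lebesgue S f)"

definition weight :: "(real^'n \<Rightarrow> real) \<Rightarrow> bool" where
  "weight w \<longleftrightarrow> locally_integrable w \<and> (AE x in lebesgue. 0 < w x)"

definition wmeas :: "(real^'n \<Rightarrow> real) \<Rightarrow> (real^'n) set \<Rightarrow> real" where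
  "wmeas w Q = (LINT x:Q|lebesgue. w x)"

definition ess_inf :: "(real^'n) set \<Rightarrow> (real^'n \<Rightarrow> real) \<Rightarrow> ereal" where
  "ess_inf Q v = - esssup (restrict_space lebesgue Q) (\<lambda>x. - ereal (v x))"

definition A1 :: "(real^'n \<Rightarrow> real) set" where
  "A1 = {v. weight v \<and>
     (\<exists>C>0. \<forall>Q\<in>cubes. ereal (average Q v) \<le> ereal C * ess_inf Q v)}"

text \<open>The integrability clause says that the left-hand side is finite; without it a divergent
  Bochner integral would count as 0.\<close>

definition RH :: "real \<Rightarrow> (real^'n \<Rightarrow> real) set" where
  "RH r = {w. weight w \<and>
     (\<exists>C>0. \<forall>Q\<in>cubes. set_integrable lebesgue Q (\<lambda>x. w x powr r) \<and>
        (average Q (\<lambda>x. w x powr r)) powr (1 / r) \<le> C * average Q w)}"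

definition critical_index :: "(real^'n \<Rightarrow> real) \<Rightarrow> ereal" where
  "critical_index w = (SUP r\<in>{r. 1 < r \<and> w \<in> RH r}. ereal r)"

text \<open>The functions for which all truncated integrals
  \<open>\<integral>\<^bsub>|x - y| > \<epsilon>\<^esub> K (x - y) f y dy\<close> make sense, i.e. those for which a principal value
  can be considered.\<close>

definition pv_domain ::
  "(real^'n \<Rightarrow> 'b) \<Rightarrow> (real^'n \<Rightarrow> 'b::{real_normed_field, banach, second_countable_topology}) set" where
  "pv_domain K = {f. locally_integrable f \<and>
     (AE x in lebesgue. \<forall>\<epsilon>>0.
        set_integrable lebesgue {y. \<epsilon> < norm (x - y)} (\<lambda>y. K (x - y) * f y))}"

definition has_pv ::
  "(real^'n \<Rightarrow> 'b) \<Rightarrow> (real^'n \<Rightarrow> 'b::{real_normed_field, banach, second_countable_topology})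
    \<Rightarrow> real^'n \<Rightarrow> 'b \<Rightarrow> bool" where
  "has_pv K f x L \<longleftrightarrow>
     ((\<lambda>\<epsilon>. LINT y:{y. \<epsilon> < norm (x - y)}|lebesgue. K (x - y) * f y) \<longlongrightarrow> L) (at_right 0)"

text \<open>The scalar type covers both real- and complex-valued functions.\<close>

definition calderon_zygmund ::
  "((real^'n \<Rightarrow> 'b::{real_normed_field, banach, second_countable_topology}) \<Rightarrow> real^'n \<Rightarrow> 'b) \<Rightarrow> bool" where
  "calderon_zygmund T \<longleftrightarrow> (\<exists>K.
     (\<forall>f\<in>pv_domain K. AE x in lebesgue. has_pv K f x (T f x)) \<and>
     (\<exists>C. \<forall>x. x \<noteq> 0 \<longrightarrow> norm (K x) \<le> C / norm x ^ CARD('n)) \<and>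
     (\<exists>C. \<forall>x y. 0 < norm y \<and> 2 * norm y \<le> norm x \<longrightarrow>
        norm (K (x - y) - K x) \<le> C * norm y / norm x ^ (CARD('n) + 1)))"

definition commutator ::
  "(real^'n \<Rightarrow> 'b::real_normed_field) \<Rightarrow> ((real^'n \<Rightarrow> 'b) \<Rightarrow> real^'n \<Rightarrow> 'b)
    \<Rightarrow> (real^'n \<Rightarrow> 'b) \<Rightarrow> real^'n \<Rightarrow> 'b" where
  "commutator b T f = (\<lambda>x. b x * T f x - T (\<lambda>y. b y * f y) x)"

definition lip_norm ::
  "real \<Rightarrow> (real^'n \<Rightarrow> real) \<Rightarrow> (real^'n \<Rightarrow> 'b::{banach, second_countable_topology}) \<Rightarrow> ereal" where
  "lip_norm \<beta> w b = (SUP Q\<in>cubes. ereal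
     (1 / wmeas w Q powr (\<beta> / CARD('n)) *
      (1 / wmeas w Q * (LINT x:Q|lebesgue. norm (b x - average Q b)))))"

definition Lip ::
  "real \<Rightarrow> (real^'n \<Rightarrow> real) \<Rightarrow> (real^'n \<Rightarrow> 'b::{banach, second_countable_topology}) set" where
  "Lip \<beta> w = {b. locally_integrable b \<and> lip_norm \<beta> w b < \<infinity>}"

definition Lp_loc ::
  "real \<Rightarrow> (real^'n \<Rightarrow> real) \<Rightarrow> (real^'n \<Rightarrow> 'b::{banach, second_countable_topology}) set" where
  "Lp_loc p u = {f \<in> borel_measurable lebesgue. locally_integrable (\<lambda>x. norm (f x) powr p * u x)}"

definition morrey_norm ::
  "real \<Rightarrow> real \<Rightarrow> (real^'n \<Rightarrow> real) \<Rightarrow> (real^'n \<Rightarrow> real)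
    \<Rightarrow> (real^'n \<Rightarrow> 'b::{banach, second_countable_topology}) \<Rightarrow> ereal" where
  "morrey_norm p \<kappa> u v f = (SUP Q\<in>cubes. ereal
     ((1 / wmeas v Q powr \<kappa> * (LINT x:Q|lebesgue. norm (f x) powr p * u x)) powr (1 / p)))"

definition morrey ::
  "real \<Rightarrow> real \<Rightarrow> (real^'n \<Rightarrow> real) \<Rightarrow> (real^'n \<Rightarrow> real)
    \<Rightarrow> (real^'n \<Rightarrow> 'b::{banach, second_countable_topology}) set" where
  "morrey p \<kappa> u v = {f \<in> Lp_loc p u. morrey_norm p \<kappa> u v f < \<infinity>}"

definition morrey_bounded ::
  "real \<Rightarrow> real \<Rightarrow> (real^'n \<Rightarrow> real) \<Rightarrow> (real^'n \<Rightarrow> real) \<Rightarrow>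
   real \<Rightarrow> real \<Rightarrow> (real^'n \<Rightarrow> real) \<Rightarrow> (real^'n \<Rightarrow> real) \<Rightarrow>
   ((real^'n \<Rightarrow> 'b::{banach, second_countable_topology}) \<Rightarrow> real^'n \<Rightarrow> 'b) \<Rightarrow> bool" where
  "morrey_bounded p \<kappa> u v q \<mu> u' v' S \<longleftrightarrow>
     (\<exists>C::real. \<forall>f\<in>morrey p \<kappa> u v. S f \<in> morrey q \<mu> u' v' \<and>
        morrey_norm q \<mu> u' v' (S f) \<le> ereal C * morrey_norm p \<kappa> u v f)"

end

theory Submission
  imports Defs
begin

text \<open>
The commutator is dominated pointwise by a positive operator, a fractional integral for the measure
\<open>\<mu> = w dx\<close>, and the theorem becomes a statement about fractional integrals on a doubling
measure space.

Since \<open>s / p > 1\<close>, the weight \<open>w\<close> itself satisfies the \<open>A\<^sub>1\<close> condition, which can be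
read pointwise: outside one null set, \<open>\<mu> B \<le> A r\<^sup>n w y\<close> for every ball \<open>B\<close> of radius \<open>r\<close>
that contains \<open>y\<close> (\<open>A1_pointwise_cballs\<close>). Integrating this over subsets of a ball shows that
\<open>\<mu>\<close> is doubling and reverse doubling, so that the measures of concentric dyadic balls grow like a
geometric sequence in both directions. Together with the oscillation bound that defines
\<open>Lip\<close> it also shows that the means of \<open>b\<close> over shrinking balls at a point converge geometrically,
which gives, for almost all \<open>x\<close> and \<open>y\<close> and for \<open>B\<close> the ball about \<open>x\<close> through \<open>y\<close>,
\<open>|b x - b y| \<le> C (w x + w y) \<mu>(B) powr (\<beta> / n)\<close> (\<open>pointwise_lipschitz\<close>).

Multiply this by the size bound \<open>|K (x - y)| \<le> C |x - y| powr (- n)\<close> and replace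
\<open>|x - y| powr (- n)\<close> by a multiple of \<open>w x / \<mu> B\<close> in the summand with \<open>w y\<close> and of
\<open>w y / \<mu> B\<close> in the summand with \<open>w x\<close>. The kernel of the commutator is then at most
\<open>C w x \<mu>(B) powr (\<beta> / n - 1) w y\<close> (\<open>kernel_bounds\<close>). Hence \<open>|[b, T] f x| \<le> C w x \<cdot> I |f| x\<close>
almost everywhere, where \<open>I\<close> is the fractional integral of order \<open>\<beta> / n\<close> for \<open>\<mu>\<close>
(\<open>commutator_pointwise\<close>); finiteness of \<open>I |f|\<close> also yields that \<open>f\<close> and \<open>b f\<close> belong to the domain
of the principal value (\<open>truncated_integrable\<close>, \<open>locally_integrable_products\<close>).

Because \<open>w powr s \<cdot> w powr (1 - s) = w\<close>, what remains is the boundedness of \<open>I\<close> between Morrey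
spaces over the single measure \<open>\<mu>\<close> (\<open>fractional_morrey\<close>). Near a given ball it follows from Hedberg's
inequality, which bounds \<open>I g\<close> by a product of powers of the maximal function and of the
\<open>L\<^sup>p\<close> norm, and from the maximal theorem for doubling measures. Far from the ball the Morrey
condition makes the dyadic pieces of \<open>I g\<close> a geometric series, convergent because
\<open>\<kappa> / p < 1 / s\<close>.
\<close>

section \<open>Geometric sums over the integers\<close>

text \<open>Every finite set of integers lies in some symmetric interval, so the partial sums over those
  intervals control the whole sum.\<close>

lemma nn_integral_count_space_int_le:
  fixes h :: "int \<Rightarrow> ennreal"
  assumes "\<And>m. (\<Sum>k\<in>{-m..m}. h k) \<le> c"
  shows "(\<integral>\<^sup>+k. h k \<partial>count_space UNIV) \<le> c"
proof -
  have "(\<integral>\<^sup>+k. h k \<partial>count_space UNIV) = (\<integral>\<^sup>+i. h (int_decode i) \<partial>count_space UNIV)"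
    by (rule nn_integral_bij_count_space[symmetric]) (rule bij_int_decode)
  also have "\<dots> = (\<Sum>i. h (int_decode i))" by (rule nn_integral_count_space_nat)
  also have "\<dots> \<le> c"
  proof (rule suminf_le_const)
    show "summable (\<lambda>i. h (int_decode i))" by simp
    fix N
    let ?F = "int_decode ` {..<N}"
    define m where "m = Max (insert 0 (abs ` ?F))"
    have "\<bar>k\<bar> \<le> m" if "k \<in> ?F" for k
      unfolding m_def by (rule Max_ge) (use that in auto)
    then have sub: "?F \<subseteq> {-m..m}" by force
    have "(\<Sum>i<N. h (int_decode i)) = (\<Sum>k\<in>?F. h k)"
      by (rule sum.reindex_cong[symmetric]) (auto intro: inj_on_subset[OF inj_int_decode])
    also have "\<dots> \<le> (\<Sum>k\<in>{-m..m}. h k)" by (rule sum_mono2) (use sub in auto)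
    also have "\<dots> \<le> c" by (rule assms)
    finally show "(\<Sum>i<N. h (int_decode i)) \<le> c" .
  qed
  finally show ?thesis .
qed

lemma borel_measurable_nn_integral_count_space_int:
  fixes f :: "int \<Rightarrow> 'a \<Rightarrow> ennreal"
  assumes [measurable]: "\<And>k. f k \<in> borel_measurable M"
  shows "(\<lambda>x. \<integral>\<^sup>+k. f k x \<partial>count_space UNIV) \<in> borel_measurable M"
proof -
  have "(\<integral>\<^sup>+k. f k x \<partial>count_space UNIV) = (\<Sum>i. f (int_decode i) x)" for x
    using nn_integral_bij_count_space[OF bij_int_decode, of "\<lambda>k. f k x"] nn_integral_count_space_nat by metis
  then show ?thesis by simp
qed

lemma sum_int_telescope:
  fixes u :: "int \<Rightarrow> real"
  assumes "a \<le> b"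
  shows "(\<Sum>k\<in>{a..b}. u k - u (k - 1)) = u b - u (a - 1)"
  using assms
proof (induction b rule: int_ge_induct)
  case base then show ?case by simp
next
  case (step i)
  have "{a..i+1} = insert (i+1) {a..i}" using step by auto
  then show ?case using step by simp
qed

text \<open>Telescoping: for \<open>u k = min (\<phi> k) t powr a\<close> the growth of \<open>\<phi>\<close> makes the increment
  \<open>u k - u (k - 1)\<close> at least \<open>(1 - \<theta> powr a)\<close> times the \<open>k\<close>-th term, and \<open>u\<close> never exceeds
  \<open>t powr a\<close>.\<close>

lemma geometric_sum_below:
  fixes \<phi> :: "int \<Rightarrow> real"
  assumes pos: "\<And>k. 0 < \<phi> k" and grow: "\<And>k. \<phi> k \<le> \<theta> * \<phi> (k + 1)"
    and \<theta>: "0 < \<theta>" "\<theta> < 1" and "0 < a" and "0 < t"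
  shows "(\<integral>\<^sup>+k. ennreal (if \<phi> k \<le> t then \<phi> k powr a else 0) \<partial>count_space UNIV)
     \<le> ennreal (t powr a / (1 - \<theta> powr a))"
proof (rule nn_integral_count_space_int_le)
  fix m :: int
  have \<theta>a: "\<theta> powr a < 1" using powr_less_mono2[of a \<theta> 1] \<theta> \<open>0 < a\<close> by simp
  define u where "u k = min (\<phi> k) t powr a" for k
  have u0: "0 \<le> u k" for k by (simp add: u_def)
  have step: "(1 - \<theta> powr a) * (if \<phi> k \<le> t then \<phi> k powr a else 0) \<le> u k - u (k - 1)" for k
  proof -
    have p: "\<phi> (k - 1) \<le> \<theta> * \<phi> k" using grow[of "k - 1"] by simp
    have "\<theta> * \<phi> k \<le> 1 * \<phi> k" using \<theta> pos[of k] by (intro mult_right_mono) auto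
    then have q: "\<phi> (k - 1) \<le> \<phi> k" using p by simp
    show ?thesis
    proof (cases "\<phi> k \<le> t")
      case True
      then have "u (k - 1) = \<phi> (k - 1) powr a" using q by (simp add: u_def)
      also have "\<dots> \<le> (\<theta> * \<phi> k) powr a" using p pos[of "k-1"] \<open>0 < a\<close> by (intro powr_mono2) auto
      also have "\<dots> = \<theta> powr a * \<phi> k powr a" using \<theta> pos[of k] by (simp add: powr_mult)
      finally show ?thesis using True by (simp add: u_def algebra_simps)
    next
      case False
      have "u (k - 1) \<le> u k" unfolding u_def using q pos[of "k-1"] \<open>0 < t\<close> \<open>0 < a\<close>
        by (intro powr_mono2) auto
      then show ?thesis using False by simp
    qed
  qed
  show "(\<Sum>k\<in>{-m..m}. ennreal (if \<phi> k \<le> t then \<phi> k powr a else 0)) \<le> ennreal (t powr a / (1 - \<theta> powr a))"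
  proof (cases "0 \<le> m")
    case True
    have "(1 - \<theta> powr a) * (\<Sum>k\<in>{-m..m}. if \<phi> k \<le> t then \<phi> k powr a else 0) \<le> (\<Sum>k\<in>{-m..m}. u k - u (k - 1))"
      unfolding sum_distrib_left by (rule sum_mono) (rule step)
    also have "\<dots> = u m - u (- m - 1)" using True by (intro sum_int_telescope) auto
    also have "\<dots> \<le> u m" using u0 by simp
    also have "\<dots> \<le> t powr a" unfolding u_def using pos[of m] \<open>0 < t\<close> \<open>0 < a\<close> by (intro powr_mono2) auto
    finally have "(\<Sum>k\<in>{-m..m}. if \<phi> k \<le> t then \<phi> k powr a else 0) \<le> t powr a / (1 - \<theta> powr a)"
      using \<theta>a by (simp add: pos_le_divide_eq mult.commute)
    moreover have "(\<Sum>k\<in>{-m..m}. ennreal (if \<phi> k \<le> t then \<phi> k powr a else 0))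
       = ennreal (\<Sum>k\<in>{-m..m}. if \<phi> k \<le> t then \<phi> k powr a else 0)"
      by (rule sum_ennreal) auto
    ultimately show ?thesis by (simp add: ennreal_leI)
  qed auto
qed

text \<open>The sequence \<open>1 / \<phi> (- k)\<close> grows in the same way as \<open>\<phi>\<close>, so this is the previous bound read
  backwards.\<close>

lemma geometric_sum_above:
  fixes \<phi> :: "int \<Rightarrow> real"
  assumes pos: "\<And>k. 0 < \<phi> k" and grow: "\<And>k. \<phi> k \<le> \<theta> * \<phi> (k + 1)"
    and \<theta>: "0 < \<theta>" "\<theta> < 1" and "0 < a" and "0 < t"
  shows "(\<integral>\<^sup>+k. ennreal (if t \<le> \<phi> k then \<phi> k powr (- a) else 0) \<partial>count_space UNIV)
     \<le> ennreal (t powr (- a) / (1 - \<theta> powr a))"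
proof -
  define \<psi> where "\<psi> k = 1 / \<phi> (- k)" for k
  have "bij (uminus :: int \<Rightarrow> int)" by (rule bijI) (auto intro: surjI)
  then have "(\<integral>\<^sup>+k. ennreal (if t \<le> \<phi> k then \<phi> k powr (- a) else 0) \<partial>count_space UNIV) =
     (\<integral>\<^sup>+k. ennreal (if t \<le> \<phi> (-k) then \<phi> (-k) powr (- a) else 0) \<partial>count_space UNIV)"
    by (rule nn_integral_bij_count_space[symmetric])
  also have "\<dots> = (\<integral>\<^sup>+k. ennreal (if \<psi> k \<le> 1 / t then \<psi> k powr a else 0) \<partial>count_space UNIV)"
  proof (intro nn_integral_cong arg_cong[where f = ennreal] if_cong)
    fix k
    have "0 < \<phi> (-k)" by (rule pos)
    then show "(t \<le> \<phi> (-k)) = (\<psi> k \<le> 1 / t)" using \<open>0 < t\<close>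
      by (simp add: \<psi>_def divide_simps)
    show "\<phi> (-k) powr (-a) = \<psi> k powr a" using \<open>0 < \<phi> (-k)\<close>
      by (simp add: \<psi>_def powr_minus powr_divide divide_simps)
  qed simp
  also have "\<dots> \<le> ennreal ((1 / t) powr a / (1 - \<theta> powr a))"
  proof (rule geometric_sum_below)
    show "\<psi> k \<le> \<theta> * \<psi> (k + 1)" for k
    proof -
      have e: "- (k + 1) = - k - 1" by simp
      show ?thesis
        using grow[of "- k - 1"] pos[of "- k - 1"] pos[of "- k"] unfolding \<psi>_def e
        by (simp add: divide_simps)
    qed
  qed (use assms in \<open>auto simp: \<psi>_def\<close>)
  also have "(1 / t) powr a = t powr (- a)" using \<open>0 < t\<close> by (simp add: powr_minus powr_divide divide_simps)
  finally show ?thesis .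
qed

lemma dyadic_radius:
  fixes r :: real assumes "0 < r"
  obtains k :: int where "r \<le> 2 powi k" "2 powi k < 2 * r"
proof -
  define k where "k = \<lceil>log 2 r\<rceil>"
  have e: "(2::real) powi k = 2 powr real_of_int k" by (simp add: powr_real_of_int')
  have "r = 2 powr (log 2 r)" using assms by simp
  also have "\<dots> \<le> 2 powr real_of_int k" unfolding k_def by (intro powr_mono) (auto simp: le_of_int_ceiling)
  finally have 1: "r \<le> 2 powi k" using e by simp
  have "2 powr real_of_int k < (2::real) powr (log 2 r + 1)" unfolding k_def by (intro powr_less_mono) (auto, linarith)
  also have "\<dots> = 2 * r" using assms by (simp add: powr_add)
  finally have "2 powi k < 2 * r" using e by simp
  with 1 show ?thesis using that by blast
qed

text \<open>This inequality takes the place of those of Hoelder and Jensen: integrated over a set, with \<open>\<tau>\<close>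
  the \<open>p\<close>-th mean of \<open>g\<close> there, it bounds the mean of \<open>g\<close> by twice the \<open>p\<close>-th mean; with \<open>\<tau>\<close> the
  value of a weight \<open>g\<close> at a given point, it transfers the \<open>A\<^sub>1\<close> condition from a power of a weight to the weight.\<close>

lemma le_split_powr:
  fixes g :: real
  assumes "0 \<le> g" "0 < \<tau>" "1 < p"
  shows "g \<le> \<tau> powr (1 - p) * g powr p + \<tau>"
proof (cases "g \<le> \<tau>")
  case True then show ?thesis by (simp add: add_increasing)
next
  case False
  then have g: "0 < g" using assms by linarith
  have "1 = \<tau> powr (1 - p) * \<tau> powr (p - 1)" using assms by (simp flip: powr_add)
  also have "\<dots> \<le> \<tau> powr (1 - p) * g powr (p - 1)" using False assms by (intro mult_left_mono powr_mono2) auto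
  finally have "1 * g \<le> \<tau> powr (1 - p) * g powr (p - 1) * g" using g by (intro mult_right_mono) auto
  also have "\<dots> = \<tau> powr (1 - p) * g powr p" using g by (simp add: powr_diff)
  finally show ?thesis using assms by simp
qed

section \<open>Doubling measures and the weak-type maximal inequality\<close>

text \<open>Reverse doubling makes sums of powers of the measures of concentric dyadic balls geometric
  in both directions. The measurable sets are the Lebesgue sets, so that densities of merely Lebesgue
  measurable weights are instances.\<close>

locale doubling_measure =
  fixes \<nu> :: "'a::euclidean_space measure" and D \<theta> :: real
  assumes sets_\<nu>: "sets \<nu> = sets lebesgue"
    and emeasure_cball_finite: "emeasure \<nu> (cball x r) < \<infinity>"
    and measure_cball_pos: "0 < r \<Longrightarrow> 0 < measure \<nu> (cball x r)"
    and doubling: "0 < r \<Longrightarrow> measure \<nu> (cball x (2 * r)) \<le> D * measure \<nu> (cball x r)"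
    and reverse_doubling: "0 < r \<Longrightarrow> measure \<nu> (cball x r) \<le> \<theta> * measure \<nu> (cball x (2 * r))"
    and theta: "0 < \<theta>" "\<theta> < 1"
begin

abbreviation "V x r \<equiv> measure \<nu> (cball x r)"

lemma space_\<nu>: "space \<nu> = UNIV"
  using sets_eq_imp_space_eq[OF sets_\<nu>] by simp

lemma measurable_borel_\<nu>: "f \<in> borel_measurable borel \<Longrightarrow> f \<in> borel_measurable \<nu>"
  unfolding measurable_cong_sets[OF sets_\<nu> refl] by (rule measurable_completion) simp

lemma cball_sets[measurable]: "cball x r \<in> sets \<nu>"
  by (simp add: sets_\<nu>)

lemma emeasure_cball: "emeasure \<nu> (cball x r) = ennreal (V x r)"
  using emeasure_cball_finite[of x r] by (simp add: emeasure_eq_ennreal_measure)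

lemma V_mono: "cball x r \<subseteq> cball y t \<Longrightarrow> V x r \<le> V y t"
  by (rule measure_mono_fmeasurable) (use emeasure_cball_finite in \<open>auto simp: fmeasurable_def\<close>)

lemma D_ge_1: "1 \<le> D"
proof -
  have "1 * V 0 1 \<le> D * V 0 1"
    using doubling[of 1 0] V_mono[of 0 1 0 2] subset_cball[of 1 2 "0::'a"] by simp
  then show ?thesis using measure_cball_pos[of 1 0] by (simp add: mult_le_cancel_right)
qed

lemma D3: "0 \<le> D^3" using D_ge_1 by simp

sublocale sigma_finite_measure \<nu>
proof
  show "\<exists>A. countable A \<and> A \<subseteq> sets \<nu> \<and> \<Union> A = space \<nu> \<and> (\<forall>a\<in>A. emeasure \<nu> a \<noteq> \<infinity>)"
  proof (intro exI[of _ "range (\<lambda>n::nat. cball 0 (real n))"] conjI ballI)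
    show "\<Union> (range (\<lambda>n::nat. cball (0::'a) (real n))) = space \<nu>"
      by (auto simp: space_\<nu> intro: real_arch_simple)
    show "emeasure \<nu> a \<noteq> \<infinity>" if "a \<in> range (\<lambda>n::nat. cball 0 (real n))" for a
      using that emeasure_cball_finite by (auto simp: less_top)
  qed auto
qed

lemma measurable_id_\<nu>[measurable]: "(\<lambda>x. x) \<in> borel_measurable \<nu>"
  by (rule measurable_borel_\<nu>) simp

lemma measurable_indicator_cball[measurable]:
  "(\<lambda>(x, y). indicator (cball x r) y :: ennreal) \<in> borel_measurable (\<nu> \<Otimes>\<^sub>M \<nu>)"
proof -
  have [measurable]: "fst \<in> borel_measurable (\<nu> \<Otimes>\<^sub>M \<nu>)" "snd \<in> borel_measurable (\<nu> \<Otimes>\<^sub>M \<nu>)"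
    using measurable_compose[OF measurable_fst measurable_id_\<nu>, of \<nu>]
      measurable_compose[OF measurable_snd measurable_id_\<nu>, of \<nu>] by simp_all
  have "(\<lambda>z. if dist (fst z) (snd z) \<le> r then 1 else (0::ennreal)) \<in> borel_measurable (\<nu> \<Otimes>\<^sub>M \<nu>)"
    by measurable
  then show ?thesis
    by (rule measurable_cong[THEN iffD1, rotated]) (auto simp: indicator_def)
qed

lemma measurable_integral_cball[measurable]:
  assumes [measurable]: "h \<in> borel_measurable \<nu>"
  shows "(\<lambda>x. \<integral>\<^sup>+y. h y * indicator (cball x r) y \<partial>\<nu>) \<in> borel_measurable \<nu>"
proof -
  have "(\<lambda>z. h (snd z) * (case z of (x, y) \<Rightarrow> indicator (cball x r) y)) \<in> borel_measurable (\<nu> \<Otimes>\<^sub>M \<nu>)"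
    by measurable
  then show ?thesis
    by (intro borel_measurable_nn_integral) (simp add: case_prod_beta')
qed

lemma measurable_V[measurable]: "(\<lambda>x. V x r) \<in> borel_measurable \<nu>"
proof -
  have "(\<lambda>x. enn2real (\<integral>\<^sup>+y. 1 * indicator (cball x r) y \<partial>\<nu>)) \<in> borel_measurable \<nu>"
    by measurable
  then show ?thesis by (simp add: emeasure_cball)
qed

lemma V_dyadic_grow: "V x (2 powi k) \<le> \<theta> * V x (2 powi (k + 1))"
  using reverse_doubling[of "2 powi k" x] by (simp add: power_int_add mult.commute)

lemma V_dyadic_doubling: "V x (2 powi (k + 1)) \<le> D * V x (2 powi k)"
  using doubling[of "2 powi k" x] by (simp add: power_int_add mult.commute)

lemma V_dyadic_pos: "0 < V x (2 powi k)"
  by (rule measure_cball_pos) simp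

text \<open>The centred Hardy--Littlewood maximal function over dyadic radii. As a supremum of countably many
  measurable functions it is measurable.\<close>

definition maximal :: "('a \<Rightarrow> ennreal) \<Rightarrow> 'a \<Rightarrow> ennreal" where
  "maximal h x = (SUP k::int. ennreal (1 / V x (2 powi k)) *
     (\<integral>\<^sup>+y. h y * indicator (cball x (2 powi k)) y \<partial>\<nu>))"

lemma measurable_maximal[measurable]:
  "h \<in> borel_measurable \<nu> \<Longrightarrow> maximal h \<in> borel_measurable \<nu>"
  unfolding maximal_def[abs_def] by measurable

lemma integral_cball_le_maximal:
  "(\<integral>\<^sup>+y. h y * indicator (cball x (2 powi k)) y \<partial>\<nu>) \<le> ennreal (V x (2 powi k)) * maximal h x"
proof -
  let ?I = "\<integral>\<^sup>+y. h y * indicator (cball x (2 powi k)) y \<partial>\<nu>"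
  have "ennreal (1 / V x (2 powi k)) * ?I \<le> maximal h x"
    unfolding maximal_def by (rule SUP_upper) simp
  then have "ennreal (V x (2 powi k)) * (ennreal (1 / V x (2 powi k)) * ?I) \<le> ennreal (V x (2 powi k)) * maximal h x"
    by (rule mult_left_mono) simp
  also have "ennreal (V x (2 powi k)) * (ennreal (1 / V x (2 powi k)) * ?I) = ?I"
    using V_dyadic_pos[of x k] by (simp add: mult.assoc[symmetric] ennreal_mult'[symmetric])
  finally show ?thesis .
qed

text \<open>By Vitali's lemma the balls on which the mean of \<open>h\<close> is at least \<open>l\<close> contain a disjoint family
  whose fivefold enlargements still cover \<open>E\<close>. Three doublings pay for the enlargement, and the integrals
  of \<open>h\<close> over disjoint balls add up to at most the whole integral. The covering lemma needs bounded
  radii, hence the bound on \<open>k\<close>.\<close>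

lemma weak_type_bounded_radii:
  assumes [measurable]: "h \<in> borel_measurable \<nu>"
    and ex: "\<And>x. x \<in> E \<Longrightarrow> \<exists>k\<le>m. ennreal l * ennreal (V x (2 powi k)) \<le>
            (\<integral>\<^sup>+y. h y * indicator (cball x (2 powi k)) y \<partial>\<nu>)"
    and E: "E \<in> sets \<nu>"
  shows "ennreal l * emeasure \<nu> E \<le> ennreal (D^3) * (\<integral>\<^sup>+y. h y \<partial>\<nu>)"
proof -
  define r where "r i = (2::real) powi (snd i)" for i :: "'a \<times> int"
  define K where "K = {(x, k). k \<le> m \<and> ennreal l * ennreal (V x (2 powi k)) \<le>
            (\<integral>\<^sup>+y. h y * indicator (cball x (2 powi k)) y \<partial>\<nu>)}"
  have cover: "E \<subseteq> (\<Union>i\<in>K. cball (fst i) (r i))"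
  proof
    fix x assume "x \<in> E"
    from ex[OF this] obtain k where "(x, k) \<in> K" unfolding K_def by auto
    then show "x \<in> (\<Union>i\<in>K. cball (fst i) (r i))"
      by (intro UN_I[of "(x, k)"]) (auto simp: r_def)
  qed
  have radii: "0 < r i \<and> r i \<le> 2 powi m" if "i \<in> K" for i
    using that by (auto simp: K_def r_def intro: power_int_increasing)
  obtain C where C: "countable C" "C \<subseteq> K"
      and dis: "pairwise (\<lambda>i j. disjnt (cball (fst i) (r i)) (cball (fst j) (r j))) C"
      and cov: "E \<subseteq> (\<Union>i\<in>C. cball (fst i) (5 * r i))"
    by (rule Vitali_covering_lemma_cballs[OF cover radii]) (auto intro: that)
  have r0: "0 < r i" for i by (simp add: r_def)
  \<comment> \<open>three doublings reach radius \<open>8 * t\<close>\<close>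
  have big: "emeasure \<nu> (cball a (5 * t)) \<le> ennreal (D^3) * ennreal (V a t)" if "0 < t" for a t
  proof -
    have "V a (5 * t) \<le> V a (2 * (2 * (2 * t)))" using that by (intro V_mono subset_cball) auto
    also have "\<dots> \<le> D * V a (2 * (2 * t))" using that by (intro doubling) auto
    also have "\<dots> \<le> D * (D * V a (2 * t))" using that D_ge_1 by (intro mult_left_mono doubling) auto
    also have "\<dots> \<le> D * (D * (D * V a t))" using that D_ge_1 by (intro mult_left_mono doubling) auto
    finally have "V a (5 * t) \<le> D^3 * V a t" by (simp add: power3_eq_cube mult.assoc)
    then show ?thesis using D3 by (simp add: emeasure_cball ennreal_mult[symmetric] ennreal_leI)
  qed
  have "emeasure \<nu> E = (\<integral>\<^sup>+x. indicator E x \<partial>\<nu>)" using E by simp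
  also have "\<dots> \<le> (\<integral>\<^sup>+x. \<integral>\<^sup>+i. indicator (cball (fst i) (5 * r i)) x \<partial>count_space C \<partial>\<nu>)"
  proof (intro nn_integral_mono)
    fix x
    show "indicator E x \<le> (\<integral>\<^sup>+i. indicator (cball (fst i) (5 * r i)) x \<partial>count_space C :: ennreal)"
    proof (cases "x \<in> E")
      case True
      then obtain i where i: "i \<in> C" "x \<in> cball (fst i) (5 * r i)" using cov by auto
      then show ?thesis
        using nn_integral_ge_point[OF i(1), of "\<lambda>i. indicator (cball (fst i) (5 * r i)) x :: ennreal"] True
        by (simp add: indicator_def)
    qed simp
  qed
  also have "\<dots> = (\<integral>\<^sup>+i. \<integral>\<^sup>+x. indicator (cball (fst i) (5 * r i)) x \<partial>\<nu> \<partial>count_space C)"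
    using C(1) by (intro nn_integral_count_space_nn_integral) auto
  also have "\<dots> \<le> (\<integral>\<^sup>+i. ennreal (D^3) * ennreal (V (fst i) (r i)) \<partial>count_space C)"
    using big r0 by (intro nn_integral_mono) simp
  finally have "ennreal l * emeasure \<nu> E \<le> ennreal l * (\<integral>\<^sup>+i. ennreal (D^3) * ennreal (V (fst i) (r i)) \<partial>count_space C)"
    by (rule mult_left_mono) simp
  also have "\<dots> = (\<integral>\<^sup>+i. ennreal (D^3) * (ennreal l * ennreal (V (fst i) (r i))) \<partial>count_space C)"
    by (subst nn_integral_cmult[symmetric]) (auto simp: mult_ac)
  also have "\<dots> \<le> (\<integral>\<^sup>+i. ennreal (D^3) * emeasure (density \<nu> h) (cball (fst i) (r i)) \<partial>count_space C)"
  proof (intro nn_integral_mono mult_left_mono)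
    fix i assume "i \<in> space (count_space C)"
    then have "i \<in> K" using C(2) by auto
    then show "ennreal l * ennreal (V (fst i) (r i)) \<le> emeasure (density \<nu> h) (cball (fst i) (r i))"
      by (auto simp: K_def r_def emeasure_density)
  qed simp
  also have "\<dots> = ennreal (D^3) * (\<integral>\<^sup>+i. emeasure (density \<nu> h) (cball (fst i) (r i)) \<partial>count_space C)"
    by (rule nn_integral_cmult) simp
  also have "(\<integral>\<^sup>+i. emeasure (density \<nu> h) (cball (fst i) (r i)) \<partial>count_space C)
      = emeasure (density \<nu> h) (\<Union>i\<in>C. cball (fst i) (r i))"
    using C(1) dis
    by (intro emeasure_UN_countable[symmetric])
      (auto simp: disjoint_family_on_def pairwise_def disjnt_def)
  also have "\<dots> \<le> emeasure (density \<nu> h) (space (density \<nu> h))" by (rule emeasure_space)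
  also have "\<dots> = (\<integral>\<^sup>+y. h y \<partial>\<nu>)"
  proof -
    have "UNIV \<in> sets \<nu>" using sets.top[of \<nu>] space_\<nu> by simp
    then show ?thesis by (simp add: emeasure_density space_\<nu>)
  qed
  finally show ?thesis by (simp add: mult_left_mono)
qed

text \<open>The level set is the increasing union of the sets on which a radius of at most \<open>2 powi m\<close>
  already witnesses the level.\<close>

lemma maximal_weak_type:
  assumes h[measurable]: "h \<in> borel_measurable \<nu>" and "0 \<le> l"
  shows "ennreal l * emeasure \<nu> {x. ennreal l < maximal h x} \<le> ennreal (D^3) * (\<integral>\<^sup>+y. h y \<partial>\<nu>)"
proof -
  define P where "P x k \<longleftrightarrow> ennreal l < ennreal (1 / V x (2 powi k)) *
     (\<integral>\<^sup>+y. h y * indicator (cball x (2 powi k)) y \<partial>\<nu>)" for x and k :: int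
  define E where "E m = {x \<in> space \<nu>. \<exists>k. k \<le> int m \<and> P x k}" for m :: nat
  have [measurable]: "{x \<in> space \<nu>. P x k} \<in> sets \<nu>" for k
    unfolding P_def by measurable
  have E[measurable]: "E m \<in> sets \<nu>" for m
  proof -
    have "E m = (\<Union>k\<in>{..int m}. {x \<in> space \<nu>. P x k})" by (auto simp: E_def)
    also have "\<dots> \<in> sets \<nu>" by (intro sets.countable_UN') auto
    finally show ?thesis .
  qed
  have EU: "{x. ennreal l < maximal h x} = (\<Union>m. E m)"
  proof -
    have "ennreal l < maximal h x \<longleftrightarrow> (\<exists>k. P x k)" for x
      unfolding maximal_def P_def less_SUP_iff by simp
    moreover have "(\<exists>k. P x k) \<longleftrightarrow> (\<exists>m. x \<in> E m)" for x
    proof safe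
      fix k assume "P x k"
      then have "x \<in> E (nat k)" by (auto simp: E_def space_\<nu> intro!: exI[of _ k])
      then show "\<exists>m. x \<in> E m" ..
    qed (auto simp: E_def)
    ultimately show ?thesis by auto
  qed
  have "incseq E" by (rule incseq_SucI) (auto simp: E_def, metis add.commute zle_add1_eq_le zless_add1_eq le_less)
  then have "emeasure \<nu> (\<Union>m. E m) = (SUP m. emeasure \<nu> (E m))"
    using E by (intro SUP_emeasure_incseq[symmetric]) auto
  moreover have "ennreal l * emeasure \<nu> (E m) \<le> ennreal (D^3) * (\<integral>\<^sup>+y. h y \<partial>\<nu>)" for m
  proof (rule weak_type_bounded_radii[OF h _ E, of _ "int m"])
    fix x assume "x \<in> E m"
    then obtain k where k: "k \<le> int m" "P x k" by (auto simp: E_def)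
    let ?I = "\<integral>\<^sup>+y. h y * indicator (cball x (2 powi k)) y \<partial>\<nu>"
    have "ennreal (V x (2 powi k)) * ennreal l \<le> ennreal (V x (2 powi k)) * (ennreal (1 / V x (2 powi k)) * ?I)"
      using k(2) unfolding P_def by (intro mult_left_mono) auto
    also have "\<dots> = ?I"
      using V_dyadic_pos[of x k] by (simp add: mult.assoc[symmetric] ennreal_mult'[symmetric])
    finally show "\<exists>k\<le>int m. ennreal l * ennreal (V x (2 powi k)) \<le> (\<integral>\<^sup>+y. h y * indicator (cball x (2 powi k)) y \<partial>\<nu>)"
      using k(1) by (auto simp: mult.commute)
  qed
  ultimately show ?thesis
    unfolding EU by (simp add: SUP_mult_left_ennreal SUP_least)
qed

end

section \<open>The maximal inequality in Lebesgue spaces\<close>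

context doubling_measure begin

text \<open>The values of \<open>g\<close> below \<open>2 powi (k - 1)\<close> contribute at most that amount to the maximal function, so
  at height \<open>2 powi k\<close> the weak-type bound may be applied to the larger values alone.\<close>

lemma maximal_dyadic_level:
  fixes k :: int
  assumes g[measurable]: "g \<in> borel_measurable \<nu>" and g0: "\<And>x. 0 \<le> g x"
  shows "ennreal (2 powi (k - 1)) * emeasure \<nu> {x. ennreal (2 powi k) < maximal (\<lambda>x. ennreal (g x)) x}
    \<le> ennreal (D^3) * (\<integral>\<^sup>+y. ennreal (if 2 powi (k - 1) < g y then g y else 0) \<partial>\<nu>)"
proof -
  define h where "h y = (if 2 powi (k - 1) < g y then g y else 0)" for y
  have [measurable]: "h \<in> borel_measurable \<nu>" unfolding h_def[abs_def] by measurable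
  have h0: "0 \<le> h y" for y using g0 by (simp add: h_def)
  have le: "maximal (\<lambda>x. ennreal (g x)) x \<le> maximal (\<lambda>x. ennreal (h x)) x + ennreal (2 powi (k - 1))" for x
    unfolding maximal_def
  proof (rule SUP_least)
    fix j :: int
    let ?B = "cball x (2 powi j)" and ?c = "ennreal (1 / V x (2 powi j))"
    have "(\<integral>\<^sup>+y. ennreal (g y) * indicator ?B y \<partial>\<nu>)
        \<le> (\<integral>\<^sup>+y. ennreal (h y) * indicator ?B y + ennreal (2 powi (k - 1)) * indicator ?B y \<partial>\<nu>)"
    proof (intro nn_integral_mono)
      fix y
      have "g y \<le> h y + 2 powi (k - 1)" using g0[of y] by (auto simp: h_def)
      then have "ennreal (g y) \<le> ennreal (h y) + ennreal (2 powi (k - 1))"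
        using h0[of y] by (simp add: ennreal_plus[symmetric] ennreal_leI del: ennreal_plus)
      then show "ennreal (g y) * indicator ?B y \<le> ennreal (h y) * indicator ?B y + ennreal (2 powi (k - 1)) * indicator ?B y"
        by (simp add: indicator_def)
    qed
    also have "\<dots> = (\<integral>\<^sup>+y. ennreal (h y) * indicator ?B y \<partial>\<nu>) + ennreal (2 powi (k - 1)) * ennreal (V x (2 powi j))"
      by (subst nn_integral_add) (auto simp: nn_integral_cmult_indicator emeasure_cball)
    finally have "?c * (\<integral>\<^sup>+y. ennreal (g y) * indicator ?B y \<partial>\<nu>) \<le>
       ?c * ((\<integral>\<^sup>+y. ennreal (h y) * indicator ?B y \<partial>\<nu>) + ennreal (2 powi (k - 1)) * ennreal (V x (2 powi j)))"
      by (rule mult_left_mono) simp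
    also have "\<dots> = ?c * (\<integral>\<^sup>+y. ennreal (h y) * indicator ?B y \<partial>\<nu>) + ennreal (2 powi (k - 1))"
      using V_dyadic_pos[of x j] by (simp add: distrib_left ennreal_mult[symmetric])
    also have "\<dots> \<le> (SUP j::int. ennreal (1 / V x (2 powi j)) * (\<integral>\<^sup>+y. ennreal (h y) * indicator (cball x (2 powi j)) y \<partial>\<nu>))
        + ennreal (2 powi (k - 1))"
      by (intro add_right_mono SUP_upper) simp
    finally show "?c * (\<integral>\<^sup>+y. ennreal (g y) * indicator ?B y \<partial>\<nu>) \<le> \<dots>" .
  qed
  have "{x. ennreal (2 powi k) < maximal (\<lambda>x. ennreal (g x)) x} \<subseteq> {x. ennreal (2 powi (k - 1)) < maximal (\<lambda>x. ennreal (h x)) x}"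
  proof safe
    fix x assume a: "ennreal (2 powi k) < maximal (\<lambda>x. ennreal (g x)) x"
    show "ennreal (2 powi (k - 1)) < maximal (\<lambda>x. ennreal (h x)) x"
    proof (rule ccontr)
      assume "\<not> ?thesis"
      then have "maximal (\<lambda>x. ennreal (g x)) x \<le> ennreal (2 powi (k - 1)) + ennreal (2 powi (k - 1))"
        using le[of x] by (meson add_right_mono not_less order_trans)
      also have "\<dots> = ennreal (2 powi (k - 1) + 2 powi (k - 1))" by (rule ennreal_plus[symmetric]) auto
      also have "2 powi (k - 1) + 2 powi (k - 1) = (2::real) powi k"
        using power_int_add[of "2::real" "k - 1" 1] by simp
      finally show False using a by simp
    qed
  qed
  moreover have "{x. ennreal (2 powi (k - 1)) < maximal (\<lambda>x. ennreal (h x)) x} \<in> sets \<nu>"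
  proof -
    have "{x \<in> space \<nu>. ennreal (2 powi (k - 1)) < maximal (\<lambda>x. ennreal (h x)) x} \<in> sets \<nu>" by measurable
    then show ?thesis by (simp add: space_\<nu>)
  qed
  ultimately have "emeasure \<nu> {x. ennreal (2 powi k) < maximal (\<lambda>x. ennreal (g x)) x} \<le> emeasure \<nu> {x. ennreal (2 powi (k - 1)) < maximal (\<lambda>x. ennreal (h x)) x}"
    by (rule emeasure_mono)
  then have "ennreal (2 powi (k - 1)) * emeasure \<nu> {x. ennreal (2 powi k) < maximal (\<lambda>x. ennreal (g x)) x} \<le>
     ennreal (2 powi (k - 1)) * emeasure \<nu> {x. ennreal (2 powi (k - 1)) < maximal (\<lambda>x. ennreal (h x)) x}"
    by (rule mult_left_mono) simp
  also have "\<dots> \<le> ennreal (D^3) * (\<integral>\<^sup>+y. ennreal (h y) \<partial>\<nu>)"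
    by (rule maximal_weak_type) auto
  finally show ?thesis by (simp add: h_def)
qed

text \<open>Marcinkiewicz interpolation, discretely: after inserting the bound for each dyadic level and
  exchanging sum and integral, the sum over the levels below \<open>2 * g x\<close> is geometric with ratio
  \<open>2 powr (p - 1)\<close> and costs a multiple of \<open>g x powr (p - 1)\<close>.\<close>

lemma maximal_strong_type_dyadic:
  assumes g[measurable]: "g \<in> borel_measurable \<nu>" and g0: "\<And>x. 0 \<le> g x" and p: "1 < p"
  shows "(\<integral>\<^sup>+x. (\<integral>\<^sup>+k. ennreal ((2 powi k) powr p) *
      indicator {x. ennreal (2 powi k) < maximal (\<lambda>x. ennreal (g x)) x} x \<partial>count_space (UNIV::int set)) \<partial>\<nu>)
    \<le> ennreal (2 powr p * D^3 / (1 - (1/2) powr (p - 1))) * (\<integral>\<^sup>+x. ennreal (g x powr p) \<partial>\<nu>)"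
proof -
  let ?L = "\<lambda>k::int. {x. ennreal (2 powi k) < maximal (\<lambda>x. ennreal (g x)) x}"
  define q where "q k = (2::real) powi k" for k :: int
  have q0: "0 < q k" for k by (simp add: q_def)
  have qs: "q k = 2 * q (k - 1)" for k using power_int_add[of "2::real" "k - 1" 1] by (simp add: q_def)
  have L[measurable]: "?L k \<in> sets \<nu>" for k
  proof -
    have "{x \<in> space \<nu>. ennreal (2 powi k) < maximal (\<lambda>x. ennreal (g x)) x} \<in> sets \<nu>" by measurable
    then show ?thesis by (simp add: space_\<nu>)
  qed
  have half: "(1/2::real) powr (p - 1) < 1" using powr_less_mono2[of "p - 1" "1/2" 1] p by simp
  have "(\<integral>\<^sup>+x. (\<integral>\<^sup>+k. ennreal ((2 powi k) powr p) * indicator (?L k) x \<partial>count_space (UNIV::int set)) \<partial>\<nu>)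
     = (\<integral>\<^sup>+k. (\<integral>\<^sup>+x. ennreal ((2 powi k) powr p) * indicator (?L k) x \<partial>\<nu>) \<partial>count_space (UNIV::int set))"
    by (rule nn_integral_count_space_nn_integral) auto
  also have "\<dots> = (\<integral>\<^sup>+k. ennreal ((2 powi k) powr p) * emeasure \<nu> (?L k) \<partial>count_space (UNIV::int set))"
    by (simp add: nn_integral_cmult_indicator)
  also have "\<dots> \<le> (\<integral>\<^sup>+k. (\<integral>\<^sup>+x. ennreal (2 * D^3 * g x) * ennreal (if q k \<le> 2 * g x then q k powr (p - 1) else 0) \<partial>\<nu>) \<partial>count_space (UNIV::int set))"
  proof (intro nn_integral_mono)
    fix k :: int
    have "(2 powi k) powr p = (2 * q k powr (p - 1)) * q (k - 1)"
      using q0[of k] qs[of k] by (simp add: q_def powr_diff)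
    then have "ennreal ((2 powi k) powr p) = ennreal (2 * q k powr (p - 1)) * ennreal (q (k - 1))"
      by (simp only: ennreal_mult''[OF less_imp_le[OF q0]])
    then have "ennreal ((2 powi k) powr p) * emeasure \<nu> (?L k)
       = ennreal (2 * q k powr (p - 1)) * (ennreal (q (k - 1)) * emeasure \<nu> (?L k))"
      by (simp only: mult.assoc)
    also have "\<dots> \<le> ennreal (2 * q k powr (p - 1)) * (ennreal (D^3) * (\<integral>\<^sup>+y. ennreal (if q (k - 1) < g y then g y else 0) \<partial>\<nu>))"
      unfolding q_def using maximal_dyadic_level[OF g g0, of k] by (intro mult_left_mono) auto
    also have "\<dots> = (\<integral>\<^sup>+y. ennreal (2 * q k powr (p - 1)) * (ennreal (D^3) * ennreal (if q (k - 1) < g y then g y else 0)) \<partial>\<nu>)"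
      by (simp add: nn_integral_cmult)
    also have "\<dots> \<le> (\<integral>\<^sup>+x. ennreal (2 * D^3 * g x) * ennreal (if q k \<le> 2 * g x then q k powr (p - 1) else 0) \<partial>\<nu>)"
    proof (intro nn_integral_mono)
      fix y
      show "ennreal (2 * q k powr (p - 1)) * (ennreal (D^3) * ennreal (if q (k - 1) < g y then g y else 0))
         \<le> ennreal (2 * D^3 * g y) * ennreal (if q k \<le> 2 * g y then q k powr (p - 1) else 0)"
      proof (cases "q (k - 1) < g y")
        case True
        have "ennreal (2 * q k powr (p - 1)) * (ennreal (D^3) * ennreal (g y)) = ennreal (2 * q k powr (p - 1) * (D^3 * g y))"
          using g0[of y] D3 by (simp only: ennreal_mult'' mult_nonneg_nonneg)
        also have "2 * q k powr (p - 1) * (D^3 * g y) = (2 * D^3 * g y) * (q k powr (p - 1))" by simp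
        also have "ennreal \<dots> = ennreal (2 * D^3 * g y) * ennreal (q k powr (p - 1))"
          using g0[of y] D3 by (intro ennreal_mult) auto
        finally show ?thesis using True qs[of k] by simp
      qed simp
    qed
    finally show "ennreal ((2 powi k) powr p) * emeasure \<nu> (?L k) \<le> \<dots>" .
  qed
  also have "\<dots> = (\<integral>\<^sup>+x. (\<integral>\<^sup>+k. ennreal (2 * D^3 * g x) * ennreal (if q k \<le> 2 * g x then q k powr (p - 1) else 0) \<partial>count_space (UNIV::int set)) \<partial>\<nu>)"
    by (rule nn_integral_count_space_nn_integral[symmetric]) auto
  also have "\<dots> \<le> (\<integral>\<^sup>+x. ennreal (2 powr p * D^3 / (1 - (1/2) powr (p - 1))) * ennreal (g x powr p) \<partial>\<nu>)"
  proof (intro nn_integral_mono)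
    fix x
    show "(\<integral>\<^sup>+k. ennreal (2 * D^3 * g x) * ennreal (if q k \<le> 2 * g x then q k powr (p - 1) else 0) \<partial>count_space (UNIV::int set))
      \<le> ennreal (2 powr p * D^3 / (1 - (1/2) powr (p - 1))) * ennreal (g x powr p)"
    proof (cases "g x = 0")
      case False
      then have g: "0 < g x" using g0[of x] by simp
      have "(\<integral>\<^sup>+k. ennreal (if q k \<le> 2 * g x then q k powr (p - 1) else 0) \<partial>count_space (UNIV::int set))
         \<le> ennreal ((2 * g x) powr (p - 1) / (1 - (1/2) powr (p - 1)))"
        using q0 qs[of "_ + 1"] g p by (intro geometric_sum_below) auto
      then have "(\<integral>\<^sup>+k. ennreal (2 * D^3 * g x) * ennreal (if q k \<le> 2 * g x then q k powr (p - 1) else 0) \<partial>count_space (UNIV::int set))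
        \<le> ennreal (2 * D^3 * g x) * ennreal ((2 * g x) powr (p - 1) / (1 - (1/2) powr (p - 1)))"
        by (subst nn_integral_cmult) (auto intro: mult_left_mono)
      also have "\<dots> = ennreal (2 * D^3 * g x * ((2 * g x) powr (p - 1) / (1 - (1/2) powr (p - 1))))"
        using g D3 half by (intro ennreal_mult[symmetric]) auto
      also have "2 * D^3 * g x * ((2 * g x) powr (p - 1) / (1 - (1/2) powr (p - 1)))
         = 2 powr p * D^3 / (1 - (1/2) powr (p - 1)) * (g x powr p)"
        using g by (simp add: powr_mult powr_diff)
      also have "ennreal \<dots> = ennreal (2 powr p * D^3 / (1 - (1/2) powr (p - 1))) * ennreal (g x powr p)"
        using D3 half by (intro ennreal_mult) auto
      finally show ?thesis .
    qed simp
  qed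
  also have "\<dots> = ennreal (2 powr p * D^3 / (1 - (1/2) powr (p - 1))) * (\<integral>\<^sup>+x. ennreal (g x powr p) \<partial>\<nu>)"
    by (rule nn_integral_cmult) auto
  finally show ?thesis .
qed

text \<open>The sum over dyadic levels is at least \<open>2 powr (- p)\<close> times the \<open>p\<close>-th power of the maximal
  function, and it is infinite wherever the maximal function is.\<close>

lemma maximal_strong_type:
  assumes p: "1 < p"
  obtains C where "0 \<le> C"
    "\<And>g. g \<in> borel_measurable \<nu> \<Longrightarrow> (\<And>x. 0 \<le> g x) \<Longrightarrow> (\<integral>\<^sup>+x. ennreal (g x powr p) \<partial>\<nu>) < \<infinity> \<Longrightarrow>
       (AE x in \<nu>. maximal (\<lambda>x. ennreal (g x)) x < \<infinity>) \<and>
       (\<integral>\<^sup>+x. ennreal (enn2real (maximal (\<lambda>x. ennreal (g x)) x) powr p) \<partial>\<nu>)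
         \<le> ennreal C * (\<integral>\<^sup>+x. ennreal (g x powr p) \<partial>\<nu>)"
proof -
  define C where "C = 2 powr p * D^3 / (1 - (1/2) powr (p - 1))"
  have "(1/2::real) powr (p - 1) < 1" using powr_less_mono2[of "p - 1" "1/2" 1] p by simp
  then have C0: "0 \<le> C" using D3 by (auto simp: C_def)
  show ?thesis
  proof (rule that[of "2 powr p * C"])
    show "0 \<le> 2 powr p * C" using C0 by simp
    fix g :: "'a \<Rightarrow> real"
    assume g[measurable]: "g \<in> borel_measurable \<nu>" and g0: "\<And>x. 0 \<le> g x"
      and fin: "(\<integral>\<^sup>+x. ennreal (g x powr p) \<partial>\<nu>) < \<infinity>"
    let ?M = "maximal (\<lambda>x. ennreal (g x))"
    define S where "S x = (\<integral>\<^sup>+k. ennreal ((2 powi k) powr p) * indicator {x. ennreal (2 powi k) < ?M x} x \<partial>count_space (UNIV::int set))" for x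
    have M[measurable]: "?M \<in> borel_measurable \<nu>" by measurable
    have S: "(\<integral>\<^sup>+x. S x \<partial>\<nu>) \<le> ennreal C * (\<integral>\<^sup>+x. ennreal (g x powr p) \<partial>\<nu>)"
      unfolding S_def C_def by (rule maximal_strong_type_dyadic[OF g g0 p])
    have pt: "ennreal ((2 powi k) powr p) \<le> S x" if "ennreal (2 powi k) < ?M x" for k x
      using nn_integral_ge_point[of k UNIV "\<lambda>k. ennreal ((2 powi k) powr p) * indicator {x. ennreal (2 powi k) < ?M x} x"] that
      unfolding S_def by simp
    have [measurable]: "S \<in> borel_measurable \<nu>"
      unfolding S_def[abs_def]
      by (rule borel_measurable_nn_integral_count_space_int) measurable
    have "(\<integral>\<^sup>+x. S x \<partial>\<nu>) < \<infinity>" using fin by (intro le_less_trans[OF S]) (simp add: ennreal_mult_less_top)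
    then have "AE x in \<nu>. S x < \<infinity>" using nn_integral_noteq_infinite[of S \<nu>] by (simp add: less_top)
    then have AEM: "AE x in \<nu>. ?M x < \<infinity>"
    proof (rule AE_mp, intro AE_I2 impI)
      fix x assume "S x < \<infinity>"
      show "?M x < \<infinity>"
      proof (rule ccontr)
        assume "\<not> ?M x < \<infinity>"
        then have "?M x = \<infinity>" by (simp add: less_top[symmetric])
        then have *: "ennreal ((2 powi k) powr p) \<le> S x" for k by (intro pt) simp
        obtain s where s: "S x = ennreal s" "0 \<le> s" using \<open>S x < \<infinity>\<close> by (cases "S x") auto
        obtain k where k: "(s + 1) powr (1 / p) \<le> 2 powi k"
          using dyadic_radius[of "(s + 1) powr (1 / p)"] s(2) by auto
        have "s + 1 = ((s + 1) powr (1 / p)) powr p" using s(2) p by (simp add: powr_powr)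
        also have "\<dots> \<le> (2 powi k) powr p" using k p by (intro powr_mono2) auto
        also have "\<dots> \<le> s" using *[of k] s by simp
        finally show False by simp
      qed
    qed
    have "(\<integral>\<^sup>+x. ennreal (enn2real (?M x) powr p) \<partial>\<nu>) \<le> (\<integral>\<^sup>+x. ennreal (2 powr p) * S x \<partial>\<nu>)"
    proof (rule nn_integral_mono_AE, rule AE_mp[OF AEM], intro AE_I2 impI)
      fix x assume "?M x < \<infinity>"
      then obtain m where m: "?M x = ennreal m" "0 \<le> m" by (cases "?M x") auto
      show "ennreal (enn2real (?M x) powr p) \<le> ennreal (2 powr p) * S x"
      proof (cases "m = 0")
        case False
        then obtain k where k: "m \<le> 2 powi k" "2 powi k < 2 * m" using dyadic_radius[of m] m by auto
        have e: "2 powi k = 2 * (2::real) powi (k - 1)" using power_int_add[of "2::real" "k - 1" 1] by simp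
        have "m powr p \<le> (2 * 2 powi (k - 1)) powr p" using k(1) m p e by (intro powr_mono2) auto
        also have "\<dots> = 2 powr p * (2 powi (k - 1)) powr p" by (rule powr_mult)
        finally have "ennreal (m powr p) \<le> ennreal (2 powr p) * ennreal ((2 powi (k - 1)) powr p)"
          by (simp add: ennreal_mult[symmetric] ennreal_leI)
        also have "\<dots> \<le> ennreal (2 powr p) * S x"
          using k(2) e m by (intro mult_left_mono pt) (auto simp: ennreal_less_iff)
        finally show ?thesis using m by simp
      qed (use m in simp)
    qed
    also have "\<dots> = ennreal (2 powr p) * (\<integral>\<^sup>+x. S x \<partial>\<nu>)" by (rule nn_integral_cmult) simp
    also have "\<dots> \<le> ennreal (2 powr p) * (ennreal C * (\<integral>\<^sup>+x. ennreal (g x powr p) \<partial>\<nu>))"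
      by (rule mult_left_mono[OF S]) simp
    also have "\<dots> = ennreal (2 powr p * C) * (\<integral>\<^sup>+x. ennreal (g x powr p) \<partial>\<nu>)"
      using C0 by (simp add: ennreal_mult mult.assoc)
    finally show "(AE x in \<nu>. ?M x < \<infinity>) \<and> (\<integral>\<^sup>+x. ennreal (enn2real (?M x) powr p) \<partial>\<nu>)
         \<le> ennreal (2 powr p * C) * (\<integral>\<^sup>+x. ennreal (g x powr p) \<partial>\<nu>)" using AEM by simp
  qed
qed

end

section \<open>Fractional integrals: Hedberg's inequality and the tail\<close>

lemma powr_add_le:
  fixes a b s :: real
  assumes "0 \<le> a" "0 \<le> b" "0 < s"
  shows "(a + b) powr s \<le> 2 powr s * (a powr s + b powr s)"
proof -
  have "(a + b) powr s \<le> (2 * max a b) powr s" using assms by (intro powr_mono2) auto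
  also have "\<dots> = 2 powr s * max a b powr s" by (rule powr_mult)
  also have "\<dots> \<le> 2 powr s * (a powr s + b powr s)" by (intro mult_left_mono) (auto simp: max_def)
  finally show ?thesis .
qed

lemma ennreal_mult_add_mult:
  assumes "0 \<le> a" "0 \<le> b" "0 \<le> c" "0 \<le> d"
  shows "ennreal a * ennreal b + ennreal c * ennreal d = ennreal (a * b + c * d)"
  using assms by (simp add: ennreal_mult)

context doubling_measure begin

text \<open>This is \<open>le_split_powr\<close> integrated over the ball, with the \<open>\<tau>\<close> for which both terms are
  equal; hence the factor 2.\<close>

lemma hoelder_cball:
  assumes g[measurable]: "g \<in> borel_measurable \<nu>" and g0: "\<And>x. 0 \<le> g x" and p: "1 < p"
    and r: "0 < r" and X: "0 < X"
    and le: "(\<integral>\<^sup>+y. ennreal (g y powr p) * indicator (cball x r) y \<partial>\<nu>) \<le> ennreal (X powr p)"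
  shows "(\<integral>\<^sup>+y. ennreal (g y) * indicator (cball x r) y \<partial>\<nu>) \<le> ennreal (2 * X * V x r powr (1 - 1/p))"
proof -
  note V0 = measure_cball_pos[OF r, of x]
  \<comment> \<open>the \<open>p\<close>-th mean of \<open>g\<close> over the ball, with \<open>X\<close> in place of its norm\<close>
  define \<tau> where "\<tau> = X * V x r powr (- (1/p))"
  have \<tau>: "0 < \<tau>" using V0 X by (simp add: \<tau>_def)
  have "(\<integral>\<^sup>+y. ennreal (g y) * indicator (cball x r) y \<partial>\<nu>)
    \<le> (\<integral>\<^sup>+y. ennreal (\<tau> powr (1 - p)) * (ennreal (g y powr p) * indicator (cball x r) y) + ennreal \<tau> * indicator (cball x r) y \<partial>\<nu>)"
  proof (intro nn_integral_mono)
    fix y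
    have "ennreal (g y) \<le> ennreal (\<tau> powr (1 - p) * g y powr p + \<tau>)"
      by (rule ennreal_leI, rule le_split_powr) (use g0 \<tau> p in auto)
    also have "\<dots> = ennreal (\<tau> powr (1 - p)) * ennreal (g y powr p) + ennreal \<tau>"
      using \<tau> by (subst ennreal_plus) (auto simp: ennreal_mult)
    finally show "ennreal (g y) * indicator (cball x r) y \<le> ennreal (\<tau> powr (1 - p)) * (ennreal (g y powr p) * indicator (cball x r) y) + ennreal \<tau> * indicator (cball x r) y"
      by (simp add: indicator_def)
  qed
  also have "\<dots> = ennreal (\<tau> powr (1 - p)) * (\<integral>\<^sup>+y. ennreal (g y powr p) * indicator (cball x r) y \<partial>\<nu>) + ennreal \<tau> * ennreal (V x r)"
    by (subst nn_integral_add) (auto simp: nn_integral_cmult emeasure_cball)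
  also have "\<dots> \<le> ennreal (\<tau> powr (1 - p)) * ennreal (X powr p) + ennreal \<tau> * ennreal (V x r)"
    by (intro add_right_mono mult_left_mono le) auto
  also have "\<dots> = ennreal (\<tau> powr (1 - p) * X powr p + \<tau> * V x r)"
    using \<tau> V0 by (simp add: ennreal_mult)
  also have "\<tau> powr (1 - p) * X powr p + \<tau> * V x r = 2 * X * V x r powr (1 - 1/p)"
  proof -
    have "\<tau> powr (1 - p) = X powr (1 - p) * V x r powr (- (1/p) * (1 - p))"
      unfolding \<tau>_def using X V0 by (subst powr_mult) (auto simp: powr_powr)
    also have "- (1/p) * (1 - p) = 1 - 1/p" using p by (simp add: field_simps)
    finally have "\<tau> powr (1 - p) * X powr p = (X powr (1 - p) * X powr p) * V x r powr (1 - 1/p)" by simp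
    also have "X powr (1 - p) * X powr p = X" using X by (simp flip: powr_add)
    finally have 1: "\<tau> powr (1 - p) * X powr p = X * V x r powr (1 - 1/p)" .
    have "\<tau> * V x r = X * (V x r powr (- (1/p)) * V x r powr 1)" using V0 by (simp add: \<tau>_def)
    also have "V x r powr (- (1/p)) * V x r powr 1 = V x r powr (1 - 1/p)" by (subst powr_add[symmetric]) simp
    finally show ?thesis using 1 by simp
  qed
  finally show ?thesis .
qed

text \<open>A dyadic version of the fractional integral with kernel \<open>V x (dist x y) powr (\<alpha> - 1)\<close>, \<open>\<alpha> < 1\<close>: for
  \<open>dist x y\<close> close to \<open>2 powi k\<close> the terms of index \<open>k\<close> and above see \<open>y\<close>, and their coefficients form a
  decreasing geometric sequence.\<close>

definition fractional :: "real \<Rightarrow> ('a \<Rightarrow> real) \<Rightarrow> 'a \<Rightarrow> ennreal" where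
  "fractional \<alpha> g x = (\<integral>\<^sup>+k. ennreal (V x (2 powi k) powr (\<alpha> - 1)) *
     (\<integral>\<^sup>+y. ennreal (g y) * indicator (cball x (2 powi k)) y \<partial>\<nu>) \<partial>count_space (UNIV::int set))"

lemma measurable_fractional[measurable]:
  "g \<in> borel_measurable \<nu> \<Longrightarrow> fractional \<alpha> g \<in> borel_measurable \<nu>"
  unfolding fractional_def[abs_def]
  by (rule borel_measurable_nn_integral_count_space_int) measurable

lemma sum_V_above:
  assumes "0 < a" "0 < t"
  shows "(\<integral>\<^sup>+k. ennreal (if t \<le> V x (2 powi k) then V x (2 powi k) powr (- a) else 0) \<partial>count_space (UNIV::int set))
     \<le> ennreal (t powr (- a) / (1 - \<theta> powr a))"
  using V_dyadic_pos V_dyadic_grow theta assms by (rule geometric_sum_above)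

lemma sum_V_below:
  assumes "0 < a" "0 < t"
  shows "(\<integral>\<^sup>+k. ennreal (if V x (2 powi k) \<le> t then V x (2 powi k) powr a else 0) \<partial>count_space (UNIV::int set))
     \<le> ennreal (t powr a / (1 - \<theta> powr a))"
  using V_dyadic_pos V_dyadic_grow theta assms by (rule geometric_sum_below)

lemma theta_powr: "0 < a \<Longrightarrow> \<theta> powr a < 1"
  using powr_less_mono2[of a \<theta> 1] theta by simp

text \<open>The \<open>k\<close>-th term of the fractional integral has two bounds: \<open>V powr \<alpha> * m\<close> by the maximal
  function and \<open>2 * B * V powr (\<alpha> - 1/p)\<close> by Hoelder. The first increases and the second decreases
  with \<open>V\<close>; each is summed on its own side of the measure \<open>t = (B / m) powr p\<close> at which they are
  comparable.\<close>

lemma hedberg: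
  assumes g[measurable]: "g \<in> borel_measurable \<nu>" and g0: "\<And>x. 0 \<le> g x" and p: "1 < p"
    and \<alpha>: "0 < \<alpha>" "\<alpha> < 1/p" and B: "0 < B"
    and norm: "(\<integral>\<^sup>+y. ennreal (g y powr p) \<partial>\<nu>) \<le> ennreal (B powr p)"
    and M: "maximal (\<lambda>x. ennreal (g x)) x \<le> ennreal m" and m: "0 \<le> m"
  shows "fractional \<alpha> g x \<le> ennreal ((1 / (1 - \<theta> powr \<alpha>) + 2 / (1 - \<theta> powr (1/p - \<alpha>))) *
     (m powr (1 - \<alpha> * p) * B powr (\<alpha> * p)))"
proof -
  define \<gamma> where "\<gamma> = 1/p - \<alpha>"
  have \<gamma>: "0 < \<gamma>" using \<alpha> by (simp add: \<gamma>_def)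
  let ?v = "\<lambda>k. V x (2 powi k)"
  let ?I = "\<lambda>k. \<integral>\<^sup>+y. ennreal (g y) * indicator (cball x (2 powi k)) y \<partial>\<nu>"
  have I1: "?I k \<le> ennreal (?v k * m)" for k
  proof -
    have "?I k \<le> ennreal (?v k) * maximal (\<lambda>x. ennreal (g x)) x" by (rule integral_cball_le_maximal)
    also have "\<dots> \<le> ennreal (?v k) * ennreal m" by (rule mult_left_mono[OF M]) simp
    finally show ?thesis using m by (simp add: ennreal_mult)
  qed
  have I2: "?I k \<le> ennreal (2 * B * ?v k powr (1 - 1/p))" for k
  proof (rule hoelder_cball[OF g g0 p _ B])
    show "(\<integral>\<^sup>+y. ennreal (g y powr p) * indicator (cball x (2 powi k)) y \<partial>\<nu>) \<le> ennreal (B powr p)"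
      by (rule order_trans[OF nn_integral_mono norm]) (auto simp: indicator_def)
  qed simp
  show ?thesis
  proof (cases "m = 0")
    case True
    then have "?I k = 0" for k using I1[of k] by simp
    then show ?thesis by (simp add: fractional_def)
  next
    case False
    then have m: "0 < m" using m by simp
    \<comment> \<open>the measure at which the two bounds for a term agree up to the factor 2\<close>
    define t where "t = (B / m) powr p"
    have t: "0 < t" using B m by (simp add: t_def)
    have "fractional \<alpha> g x \<le> (\<integral>\<^sup>+k. ennreal m * ennreal (if ?v k \<le> t then ?v k powr \<alpha> else 0) +
         ennreal (2 * B) * ennreal (if t \<le> ?v k then ?v k powr (- \<gamma>) else 0) \<partial>count_space (UNIV::int set))"
      unfolding fractional_def
    proof (intro nn_integral_mono)
      fix k :: int
      note v = V_dyadic_pos[of x k]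
      show "ennreal (?v k powr (\<alpha> - 1)) * ?I k \<le> ennreal m * ennreal (if ?v k \<le> t then ?v k powr \<alpha> else 0) +
         ennreal (2 * B) * ennreal (if t \<le> ?v k then ?v k powr (- \<gamma>) else 0)"
      proof (cases "?v k \<le> t")
        case True
        have "ennreal (?v k powr (\<alpha> - 1)) * ?I k \<le> ennreal (?v k powr (\<alpha> - 1)) * ennreal (?v k * m)"
          by (rule mult_left_mono[OF I1]) simp
        also have "\<dots> = ennreal (?v k powr (\<alpha> - 1) * (?v k * m))" by (rule ennreal_mult'[symmetric]) simp
        also have "?v k powr (\<alpha> - 1) * (?v k * m) = m * ?v k powr \<alpha>" using v by (simp add: powr_diff)
        also have "ennreal \<dots> = ennreal m * ennreal (?v k powr \<alpha>)" using m by (intro ennreal_mult') simp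
        finally show ?thesis using True by (simp add: add_increasing2)
      next
        case False
        have "ennreal (?v k powr (\<alpha> - 1)) * ?I k \<le> ennreal (?v k powr (\<alpha> - 1)) * ennreal (2 * B * ?v k powr (1 - 1/p))"
          by (rule mult_left_mono[OF I2]) simp
        also have "\<dots> = ennreal (?v k powr (\<alpha> - 1) * (2 * B * ?v k powr (1 - 1/p)))" by (rule ennreal_mult'[symmetric]) simp
        also have "?v k powr (\<alpha> - 1) * (2 * B * ?v k powr (1 - 1/p)) = 2 * B * (?v k powr (\<alpha> - 1) * ?v k powr (1 - 1/p))" by simp
        also have "?v k powr (\<alpha> - 1) * ?v k powr (1 - 1/p) = ?v k powr (- \<gamma>)"
          by (simp add: \<gamma>_def flip: powr_add)
        also have "ennreal (2 * B * ?v k powr (- \<gamma>)) = ennreal (2 * B) * ennreal (?v k powr (- \<gamma>))"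
          using B by (intro ennreal_mult') simp
        finally show ?thesis using False by simp
      qed
    qed
    also have "\<dots> = ennreal m * (\<integral>\<^sup>+k. ennreal (if ?v k \<le> t then ?v k powr \<alpha> else 0) \<partial>count_space (UNIV::int set)) +
         ennreal (2 * B) * (\<integral>\<^sup>+k. ennreal (if t \<le> ?v k then ?v k powr (- \<gamma>) else 0) \<partial>count_space (UNIV::int set))"
      by (simp add: nn_integral_add nn_integral_cmult)
    also have "\<dots> \<le> ennreal m * ennreal (t powr \<alpha> / (1 - \<theta> powr \<alpha>)) + ennreal (2 * B) * ennreal (t powr (- \<gamma>) / (1 - \<theta> powr \<gamma>))"
      using \<alpha>(1) \<gamma> t by (intro add_mono mult_left_mono sum_V_below sum_V_above) auto
    also have "\<dots> = ennreal (m * (t powr \<alpha> / (1 - \<theta> powr \<alpha>)) + 2 * B * (t powr (- \<gamma>) / (1 - \<theta> powr \<gamma>)))"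
      using m B theta_powr[OF \<alpha>(1)] theta_powr[OF \<gamma>] by (intro ennreal_mult_add_mult) auto
    also have "m * (t powr \<alpha> / (1 - \<theta> powr \<alpha>)) + 2 * B * (t powr (- \<gamma>) / (1 - \<theta> powr \<gamma>))
       = (1 / (1 - \<theta> powr \<alpha>) + 2 / (1 - \<theta> powr \<gamma>)) * (m powr (1 - \<alpha> * p) * B powr (\<alpha> * p))"
    proof -
      have "t powr \<alpha> = B powr (\<alpha> * p) / m powr (\<alpha> * p)"
        using B m by (simp add: t_def powr_powr powr_divide mult.commute)
      then have 1: "m * t powr \<alpha> = m powr (1 - \<alpha> * p) * B powr (\<alpha> * p)"
        using m by (simp add: powr_diff)
      have e: "p * - \<gamma> = \<alpha> * p - 1" using p by (simp add: \<gamma>_def field_simps)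
      have "t powr (- \<gamma>) = B powr (\<alpha> * p - 1) / m powr (\<alpha> * p - 1)"
        unfolding t_def powr_powr e using B m by (simp add: powr_divide)
      then have 2: "B * t powr (- \<gamma>) = m powr (1 - \<alpha> * p) * B powr (\<alpha> * p)"
        using m B by (simp add: powr_diff)
      show ?thesis using 1 2 by (simp add: distrib_right)
    qed
    finally show ?thesis by (simp add: \<gamma>_def)
  qed
qed

text \<open>For \<open>x\<close> in the given ball, balls of radius up to \<open>2 powi m\<close> about \<open>x\<close> stay inside the ball of twice the
  radius. For larger balls Hoelder and the Morrey condition bound the \<open>k\<close>-th term by a multiple of
  \<open>V x (2 powi k) powr (- \<gamma>)\<close>, and these sum to a multiple of the first of them.\<close>

lemma fractional_split:
  assumes g[measurable]: "g \<in> borel_measurable \<nu>" and g0: "\<And>x. 0 \<le> g x" and p: "1 < p" and N: "0 < N"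
    and morrey: "\<And>x k. (\<integral>\<^sup>+y. ennreal (g y powr p) * indicator (cball x (2 powi k)) y \<partial>\<nu>)
        \<le> ennreal (N powr p * V x (2 powi k) powr \<kappa>)"
    and \<gamma>: "\<gamma> = 1/p - \<alpha> - \<kappa>/p" "0 < \<gamma>"
    and x: "x \<in> cball x0 (2 powi m)"
  shows "fractional \<alpha> g x \<le> fractional \<alpha> (\<lambda>y. g y * indicator (cball x0 (2 powi (m + 1))) y) x
     + ennreal (2 * D powr \<gamma> / (1 - \<theta> powr \<gamma>) * N * V x0 (2 powi m) powr (- \<gamma>))"
proof -
  let ?v = "\<lambda>k. V x (2 powi k)"
  let ?I = "\<lambda>k. \<integral>\<^sup>+y. ennreal (g y) * indicator (cball x (2 powi k)) y \<partial>\<nu>"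
  let ?I1 = "\<lambda>k. \<integral>\<^sup>+y. ennreal (g y * indicator (cball x0 (2 powi (m + 1))) y) * indicator (cball x (2 powi k)) y \<partial>\<nu>"
  have vm: "0 < ?v m" by (rule V_dyadic_pos)
  have "fractional \<alpha> g x \<le> (\<integral>\<^sup>+k. ennreal (?v k powr (\<alpha> - 1)) * ?I1 k +
     ennreal (2 * N) * ennreal (if ?v m \<le> ?v k then ?v k powr (- \<gamma>) else 0) \<partial>count_space (UNIV::int set))"
    unfolding fractional_def
  proof (intro nn_integral_mono)
    fix k :: int
    note v = V_dyadic_pos[of x k]
    show "ennreal (?v k powr (\<alpha> - 1)) * ?I k \<le> ennreal (?v k powr (\<alpha> - 1)) * ?I1 k +
       ennreal (2 * N) * ennreal (if ?v m \<le> ?v k then ?v k powr (- \<gamma>) else 0)"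
    proof (cases "k \<le> m")
      case True
      have sub: "cball x (2 powi k) \<subseteq> cball x0 (2 powi (m + 1))"
      proof
        fix y assume "y \<in> cball x (2 powi k)"
        then have "dist x y \<le> 2 powi m" using power_int_increasing[OF True, of "2::real"] by simp
        then show "y \<in> cball x0 (2 powi (m + 1))"
          using x dist_triangle[of x0 y x] by (simp add: power_int_add)
      qed
      have "?I k = ?I1 k"
        by (intro nn_integral_cong) (use sub in \<open>auto simp: indicator_def\<close>)
      then show ?thesis by (simp add: add_increasing2)
    next
      case False
      then have "?v m \<le> ?v k" by (intro V_mono subset_cball power_int_increasing) auto
      have "(\<integral>\<^sup>+y. ennreal (g y) * indicator (cball x (2 powi k)) y \<partial>\<nu>) \<le> ennreal (2 * (N * ?v k powr (\<kappa>/p)) * ?v k powr (1 - 1/p))"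
      proof (rule hoelder_cball[OF g g0 p])
        show "(\<integral>\<^sup>+y. ennreal (g y powr p) * indicator (cball x (2 powi k)) y \<partial>\<nu>) \<le> ennreal ((N * ?v k powr (\<kappa>/p)) powr p)"
          using morrey[of x k] N p by (simp add: powr_mult powr_powr)
      qed (use N v in auto)
      then have "ennreal (?v k powr (\<alpha> - 1)) * ?I k \<le> ennreal (?v k powr (\<alpha> - 1)) * ennreal (2 * (N * ?v k powr (\<kappa>/p)) * ?v k powr (1 - 1/p))"
        by (rule mult_left_mono) simp
      also have "\<dots> = ennreal (?v k powr (\<alpha> - 1) * (2 * (N * ?v k powr (\<kappa>/p)) * ?v k powr (1 - 1/p)))" by (rule ennreal_mult'[symmetric]) simp
      also have "?v k powr (\<alpha> - 1) * (2 * (N * ?v k powr (\<kappa>/p)) * ?v k powr (1 - 1/p)) = 2 * N * (?v k powr (\<alpha> - 1) * ?v k powr (\<kappa>/p) * ?v k powr (1 - 1/p))" by simp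
      also have "?v k powr (\<alpha> - 1) * ?v k powr (\<kappa>/p) * ?v k powr (1 - 1/p) = ?v k powr (- \<gamma>)"
        by (simp add: \<gamma> algebra_simps flip: powr_add)
      also have "ennreal (2 * N * ?v k powr (- \<gamma>)) = ennreal (2 * N) * ennreal (?v k powr (- \<gamma>))"
        using N by (intro ennreal_mult') simp
      finally show ?thesis using \<open>?v m \<le> ?v k\<close> by (simp add: add_increasing)
    qed
  qed
  also have "\<dots> = fractional \<alpha> (\<lambda>y. g y * indicator (cball x0 (2 powi (m + 1))) y) x +
      ennreal (2 * N) * (\<integral>\<^sup>+k. ennreal (if ?v m \<le> ?v k then ?v k powr (- \<gamma>) else 0) \<partial>count_space (UNIV::int set))"
    by (simp add: nn_integral_add nn_integral_cmult fractional_def)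
  also have "ennreal (2 * N) * (\<integral>\<^sup>+k. ennreal (if ?v m \<le> ?v k then ?v k powr (- \<gamma>) else 0) \<partial>count_space (UNIV::int set))
     \<le> ennreal (2 * N) * ennreal (?v m powr (- \<gamma>) / (1 - \<theta> powr \<gamma>))"
    by (intro mult_left_mono sum_V_above \<gamma>(2) vm) auto
  also have "\<dots> = ennreal (2 * N * (?v m powr (- \<gamma>) / (1 - \<theta> powr \<gamma>)))" using N by (intro ennreal_mult'[symmetric]) simp
  also have "\<dots> \<le> ennreal (2 * D powr \<gamma> / (1 - \<theta> powr \<gamma>) * N * V x0 (2 powi m) powr (- \<gamma>))"
  proof (rule ennreal_leI)
    have v0: "0 < V x0 (2 powi m)" by (rule V_dyadic_pos)
    have "cball x0 (2 powi m) \<subseteq> cball x (2 powi (m + 1))"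
    proof
      fix y assume "y \<in> cball x0 (2 powi m)"
      then show "y \<in> cball x (2 powi (m + 1))"
        using x dist_triangle[of x y x0] by (simp add: power_int_add dist_commute)
    qed
    then have "V x0 (2 powi m) \<le> D * ?v m" using V_mono V_dyadic_doubling order_trans by blast
    then have "V x0 (2 powi m) / D \<le> ?v m" using D_ge_1 by (simp add: pos_divide_le_eq mult.commute)
    then have "?v m powr (- \<gamma>) \<le> (V x0 (2 powi m) / D) powr (- \<gamma>)"
      using v0 D_ge_1 \<gamma>(2) by (intro powr_mono2') auto
    also have "\<dots> = D powr \<gamma> * V x0 (2 powi m) powr (- \<gamma>)"
      using v0 D_ge_1 by (simp add: powr_divide powr_minus divide_simps)
    finally have "2 * N / (1 - \<theta> powr \<gamma>) * ?v m powr (- \<gamma>) \<le> 2 * N / (1 - \<theta> powr \<gamma>) * (D powr \<gamma> * V x0 (2 powi m) powr (- \<gamma>))"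
      using N theta_powr[OF \<gamma>(2)] by (intro mult_left_mono) auto
    then show "2 * N * (?v m powr (- \<gamma>) / (1 - \<theta> powr \<gamma>)) \<le> 2 * D powr \<gamma> / (1 - \<theta> powr \<gamma>) * N * V x0 (2 powi m) powr (- \<gamma>)"
      by (simp add: mult_ac)
  qed
  finally show ?thesis by (simp add: add_left_mono)
qed

end

section \<open>Fractional integrals on Morrey spaces\<close>

context doubling_measure begin

text \<open>Write \<open>v\<close> for the measure of the given ball. The part of \<open>g\<close> in the doubled ball has \<open>L\<^sup>p\<close> norm at
  most \<open>b\<close>, which is itself at most a multiple of \<open>N * v powr (\<kappa> / p)\<close>. As \<open>s * (1 - \<alpha> * p) = p\<close>, the \<open>s\<close>-th power of
  Hedberg's bound for it is a multiple of \<open>M powr p * b powr (s - p)\<close>, whose integral is at most a multiple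
  of \<open>b powr s\<close> by the maximal theorem. The tail is a constant, and its \<open>s\<close>-th power integrates to
  a multiple of \<open>v powr (1 - s * \<gamma>)\<close> with \<open>1 - s * \<gamma> = \<kappa> * s / p\<close>. The bound is stated through a
  real majorant \<open>G\<close> because the fractional integral has extended values, for which real powers are not
  defined.\<close>

lemma fractional_morrey:
  assumes p: "1 < p" and \<alpha>: "0 < \<alpha>" and s: "0 < s" "1/s = 1/p - \<alpha>" and \<kappa>: "0 < \<kappa>" "\<kappa> < p/s"
  obtains C where "0 \<le> C"
    "\<And>g N x0 m. g \<in> borel_measurable \<nu> \<Longrightarrow> (\<And>x. 0 \<le> g x) \<Longrightarrow> 0 < N \<Longrightarrow>
       (\<And>x k. (\<integral>\<^sup>+y. ennreal (g y powr p) * indicator (cball x (2 powi k)) y \<partial>\<nu>)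
          \<le> ennreal (N powr p * V x (2 powi k) powr \<kappa>)) \<Longrightarrow>
       \<exists>G. G \<in> borel_measurable \<nu> \<and> (\<forall>x. 0 \<le> G x) \<and>
         (AE x in \<nu>. x \<in> cball x0 (2 powi m) \<longrightarrow> fractional \<alpha> g x \<le> ennreal (G x)) \<and>
         (\<integral>\<^sup>+x. ennreal (G x powr s) * indicator (cball x0 (2 powi m)) x \<partial>\<nu>)
           \<le> ennreal (C * N powr s * V x0 (2 powi m) powr (\<kappa> * s / p))"
proof -
  define \<gamma> where "\<gamma> = 1/p - \<alpha> - \<kappa>/p"
  have \<gamma>: "0 < \<gamma>"
  proof -
    have "\<kappa> / p < (p / s) / p" using \<kappa>(2) p by (intro divide_strict_right_mono) auto
    also have "(p / s) / p = 1 / s" using p by simp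
    finally show ?thesis using s(2) by (simp add: \<gamma>_def)
  qed
  have \<alpha>p: "\<alpha> < 1/p"
  proof -
    have "0 < 1 / s" using s(1) by simp
    then show ?thesis using s(2) by simp
  qed
  have sp: "s * (1 - \<alpha> * p) = p"
  proof -
    have "1 - \<alpha> * p = p * (1/p - \<alpha>)" using p by (simp add: field_simps)
    also have "\<dots> = p / s" by (simp add: s(2)[symmetric])
    finally show ?thesis using s(1) by simp
  qed
  have s\<gamma>: "1 - s * \<gamma> = \<kappa> * s / p"
  proof -
    have "s * \<gamma> = s * (1/s - \<kappa>/p)" unfolding \<gamma>_def s(2) ..
    also have "\<dots> = 1 - \<kappa> * s / p" using s(1) by (simp add: right_diff_distrib mult.commute)
    finally show ?thesis by simp
  qed
  obtain C3 where C3: "0 \<le> C3" and strong: "\<And>g. g \<in> borel_measurable \<nu> \<Longrightarrow> (\<And>x. 0 \<le> g x) \<Longrightarrow> (\<integral>\<^sup>+x. ennreal (g x powr p) \<partial>\<nu>) < \<infinity> \<Longrightarrow>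
       (AE x in \<nu>. maximal (\<lambda>x. ennreal (g x)) x < \<infinity>) \<and>
       (\<integral>\<^sup>+x. ennreal (enn2real (maximal (\<lambda>x. ennreal (g x)) x) powr p) \<partial>\<nu>)
         \<le> ennreal C3 * (\<integral>\<^sup>+x. ennreal (g x powr p) \<partial>\<nu>)"
    using maximal_strong_type[OF p] by metis
  define C1 where "C1 = 1 / (1 - \<theta> powr \<alpha>) + 2 / (1 - \<theta> powr (1/p - \<alpha>))"
  define C2 where "C2 = 2 * D powr \<gamma> / (1 - \<theta> powr \<gamma>)"
  have C1: "0 \<le> C1" using theta_powr[of \<alpha>] theta_powr[of "1/p - \<alpha>"] \<alpha> \<alpha>p by (simp add: C1_def)
  have C2: "0 \<le> C2" using theta_powr[OF \<gamma>] by (simp add: C2_def)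
  define C where "C = 2 powr s * (C1 powr s * C3 * D powr (\<kappa> * s / p) + C2 powr s)"
  have C: "0 \<le> C" using C3 by (simp add: C_def)
  show ?thesis
  proof (rule that[OF C])
    fix g :: "'a \<Rightarrow> real" and N :: real and x0 :: 'a and m :: int
    assume g[measurable]: "g \<in> borel_measurable \<nu>" and g0: "\<And>x. 0 \<le> g x" and N: "0 < N"
      and morrey: "\<And>x k. (\<integral>\<^sup>+y. ennreal (g y powr p) * indicator (cball x (2 powi k)) y \<partial>\<nu>)
          \<le> ennreal (N powr p * V x (2 powi k) powr \<kappa>)"
    let ?B = "cball x0 (2 powi m)"
    define g1 where "g1 y = g y * indicator (cball x0 (2 powi (m + 1))) y" for y
    have g1[measurable]: "g1 \<in> borel_measurable \<nu>" unfolding g1_def[abs_def] by measurable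
    have g10: "0 \<le> g1 x" for x using g0 by (simp add: g1_def)
    define v where "v = V x0 (2 powi m)"
    define v' where "v' = V x0 (2 powi (m + 1))"
    have v: "0 < v" "0 < v'" "v' \<le> D * v" unfolding v_def v'_def by (auto simp: V_dyadic_pos V_dyadic_doubling)
    \<comment> \<open>by the Morrey condition, a bound for the norm of \<open>g1\<close>\<close>
    define b where "b = N * v' powr (\<kappa> / p)"
    have b: "0 < b" using N v by (simp add: b_def)
    have norm1: "(\<integral>\<^sup>+y. ennreal (g1 y powr p) \<partial>\<nu>) \<le> ennreal (b powr p)"
    proof -
      have "(\<integral>\<^sup>+y. ennreal (g1 y powr p) \<partial>\<nu>) = (\<integral>\<^sup>+y. ennreal (g y powr p) * indicator (cball x0 (2 powi (m + 1))) y \<partial>\<nu>)"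
        by (intro nn_integral_cong) (auto simp: g1_def indicator_def)
      also have "\<dots> \<le> ennreal (N powr p * v' powr \<kappa>)" unfolding v'_def by (rule morrey)
      also have "N powr p * v' powr \<kappa> = b powr p" using p by (simp add: b_def powr_mult powr_powr)
      finally show ?thesis .
    qed
    let ?M = "maximal (\<lambda>x. ennreal (g1 x))"
    define M where "M x = enn2real (?M x)" for x
    have [measurable]: "M \<in> borel_measurable \<nu>" unfolding M_def[abs_def] by measurable
    have fin: "(\<integral>\<^sup>+y. ennreal (g1 y powr p) \<partial>\<nu>) < \<infinity>" by (rule le_less_trans[OF norm1]) simp
    have AEM: "AE x in \<nu>. ?M x < \<infinity>" using strong[OF g1 g10 fin] by blast
    have "(\<integral>\<^sup>+x. ennreal (M x powr p) \<partial>\<nu>) \<le> ennreal C3 * (\<integral>\<^sup>+x. ennreal (g1 x powr p) \<partial>\<nu>)"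
      unfolding M_def using strong[OF g1 g10 fin] by blast
    also have "\<dots> \<le> ennreal C3 * ennreal (b powr p)" by (rule mult_left_mono[OF norm1]) simp
    also have "\<dots> = ennreal (C3 * b powr p)" using C3 by (intro ennreal_mult'[symmetric])
    finally have IM: "(\<integral>\<^sup>+x. ennreal (M x powr p) \<partial>\<nu>) \<le> ennreal (C3 * b powr p)" .
    define G where "G x = C1 * (M x powr (1 - \<alpha> * p) * b powr (\<alpha> * p)) + C2 * N * v powr (- \<gamma>)" for x
    have M0: "0 \<le> M x" for x by (simp add: M_def)
    have G0: "0 \<le> G x" for x using C1 C2 N by (simp add: G_def)
    have [measurable]: "G \<in> borel_measurable \<nu>" unfolding G_def[abs_def] by measurable
    have AEG: "AE x in \<nu>. x \<in> ?B \<longrightarrow> fractional \<alpha> g x \<le> ennreal (G x)"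
      using AEM
    proof (rule AE_mp, intro AE_I2 impI)
      fix x assume fin: "?M x < \<infinity>" and x: "x \<in> ?B"
      have "?M x = ennreal (M x)" unfolding M_def using fin by (simp add: less_top)
      then have "fractional \<alpha> g1 x \<le> ennreal (C1 * (M x powr (1 - \<alpha> * p) * b powr (\<alpha> * p)))"
        unfolding C1_def by (intro hedberg[OF g1 g10 p \<alpha> \<alpha>p b norm1]) (auto simp: M_def)
      then have "fractional \<alpha> g1 x + ennreal (C2 * N * v powr (- \<gamma>)) \<le> ennreal (C1 * (M x powr (1 - \<alpha> * p) * b powr (\<alpha> * p))) + ennreal (C2 * N * v powr (- \<gamma>))"
        by (rule add_right_mono)
      also have "\<dots> = ennreal (G x)"
        unfolding G_def using C1 C2 N by (intro ennreal_plus[symmetric]) auto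
      finally show "fractional \<alpha> g x \<le> ennreal (G x)"
        using fractional_split[OF g g0 p N morrey \<gamma>_def \<gamma> x] unfolding g1_def[abs_def] C2_def v_def
        by (rule order_trans[rotated])
    qed
    have "(\<integral>\<^sup>+x. ennreal (G x powr s) * indicator ?B x \<partial>\<nu>)
       \<le> (\<integral>\<^sup>+x. ennreal (2 powr s * C1 powr s * b powr (s * (\<alpha> * p))) * ennreal (M x powr p)
          + ennreal (2 powr s * C2 powr s * N powr s * v powr (- (s * \<gamma>))) * indicator ?B x \<partial>\<nu>)"
    proof (intro nn_integral_mono)
      fix x
      have "G x powr s \<le> 2 powr s * ((C1 * (M x powr (1 - \<alpha> * p) * b powr (\<alpha> * p))) powr s + (C2 * N * v powr (- \<gamma>)) powr s)"
        unfolding G_def using C1 C2 N s by (intro powr_add_le) auto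
      also have "(C1 * (M x powr (1 - \<alpha> * p) * b powr (\<alpha> * p))) powr s = C1 powr s * (M x powr p * b powr (s * (\<alpha> * p)))"
        using sp by (simp add: powr_mult powr_powr mult.commute)
      also have "(C2 * N * v powr (- \<gamma>)) powr s = C2 powr s * N powr s * v powr (- (s * \<gamma>))"
        by (simp add: powr_mult powr_powr mult.commute)
      finally have "G x powr s \<le> 2 powr s * C1 powr s * b powr (s * (\<alpha> * p)) * M x powr p + 2 powr s * C2 powr s * N powr s * v powr (- (s * \<gamma>))"
        by (simp add: algebra_simps)
      then have "ennreal (G x powr s) \<le> ennreal (2 powr s * C1 powr s * b powr (s * (\<alpha> * p))) * ennreal (M x powr p) + ennreal (2 powr s * C2 powr s * N powr s * v powr (- (s * \<gamma>))) * ennreal 1"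
        by (subst ennreal_mult_add_mult) (auto intro!: ennreal_leI simp del: ennreal_plus)
      then show "ennreal (G x powr s) * indicator ?B x \<le> ennreal (2 powr s * C1 powr s * b powr (s * (\<alpha> * p))) * ennreal (M x powr p)
          + ennreal (2 powr s * C2 powr s * N powr s * v powr (- (s * \<gamma>))) * indicator ?B x"
        by (simp add: indicator_def)
    qed
    also have "\<dots> = ennreal (2 powr s * C1 powr s * b powr (s * (\<alpha> * p))) * (\<integral>\<^sup>+x. ennreal (M x powr p) \<partial>\<nu>)
          + ennreal (2 powr s * C2 powr s * N powr s * v powr (- (s * \<gamma>))) * ennreal v"
      by (subst nn_integral_add) (auto simp: nn_integral_cmult emeasure_cball v_def)
    also have "\<dots> \<le> ennreal (2 powr s * C1 powr s * b powr (s * (\<alpha> * p))) * ennreal (C3 * b powr p)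
          + ennreal (2 powr s * C2 powr s * N powr s * v powr (- (s * \<gamma>))) * ennreal v"
      by (intro add_right_mono mult_left_mono IM) simp
    also have "\<dots> = ennreal (2 powr s * C1 powr s * b powr (s * (\<alpha> * p)) * (C3 * b powr p)
          + 2 powr s * C2 powr s * N powr s * v powr (- (s * \<gamma>)) * v)"
      using C3 v by (intro ennreal_mult_add_mult) auto
    also have "\<dots> \<le> ennreal (C * N powr s * v powr (\<kappa> * s / p))"
    proof (rule ennreal_leI)
      have "b powr (s * (\<alpha> * p)) * b powr p = b powr (s * (\<alpha> * p) + p)" by (simp add: powr_add)
      also have "s * (\<alpha> * p) + p = s" using sp by (simp add: algebra_simps)
      also have "b powr s = N powr s * v' powr (\<kappa> * s / p)"
        by (simp add: b_def powr_mult powr_powr)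
      also have "\<dots> \<le> N powr s * (D * v) powr (\<kappa> * s / p)"
        using v \<kappa> s p by (intro mult_left_mono powr_mono2) auto
      also have "\<dots> = D powr (\<kappa> * s / p) * (N powr s * v powr (\<kappa> * s / p))" by (simp add: powr_mult)
      finally have 1: "b powr (s * (\<alpha> * p)) * b powr p \<le> D powr (\<kappa> * s / p) * (N powr s * v powr (\<kappa> * s / p))" .
      have "v powr (- (s * \<gamma>)) * v = v powr (- (s * \<gamma>)) * v powr 1" using v by simp
      also have "\<dots> = v powr (1 - s * \<gamma>)" by (subst powr_add[symmetric]) simp
      finally have 2: "v powr (- (s * \<gamma>)) * v = v powr (\<kappa> * s / p)" using s\<gamma> by simp
      have "2 powr s * C1 powr s * b powr (s * (\<alpha> * p)) * (C3 * b powr p) = 2 powr s * C1 powr s * C3 * (b powr (s * (\<alpha> * p)) * b powr p)" by simp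
      also have "\<dots> \<le> 2 powr s * C1 powr s * C3 * (D powr (\<kappa> * s / p) * (N powr s * v powr (\<kappa> * s / p)))"
        using C3 by (intro mult_left_mono[OF 1]) auto
      finally have "2 powr s * C1 powr s * b powr (s * (\<alpha> * p)) * (C3 * b powr p)
          + 2 powr s * C2 powr s * N powr s * v powr (- (s * \<gamma>)) * v
         \<le> 2 powr s * C1 powr s * C3 * (D powr (\<kappa> * s / p) * (N powr s * v powr (\<kappa> * s / p)))
           + 2 powr s * C2 powr s * N powr s * v powr (\<kappa> * s / p)"
        using 2 by (simp add: mult.assoc)
      also have "\<dots> = C * N powr s * v powr (\<kappa> * s / p)" by (simp add: C_def algebra_simps)
      finally show "2 powr s * C1 powr s * b powr (s * (\<alpha> * p)) * (C3 * b powr p)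
          + 2 powr s * C2 powr s * N powr s * v powr (- (s * \<gamma>)) * v \<le> C * N powr s * v powr (\<kappa> * s / p)" .
    qed
    finally have "(\<integral>\<^sup>+x. ennreal (G x powr s) * indicator ?B x \<partial>\<nu>) \<le> ennreal (C * N powr s * V x0 (2 powi m) powr (\<kappa> * s / p))"
      by (simp add: v_def)
    then show "\<exists>G. G \<in> borel_measurable \<nu> \<and> (\<forall>x. 0 \<le> G x) \<and>
         (AE x in \<nu>. x \<in> cball x0 (2 powi m) \<longrightarrow> fractional \<alpha> g x \<le> ennreal (G x)) \<and>
         (\<integral>\<^sup>+x. ennreal (G x powr s) * indicator (cball x0 (2 powi m)) x \<partial>\<nu>)
           \<le> ennreal (C * N powr s * V x0 (2 powi m) powr (\<kappa> * s / p))"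
      using G0 AEG \<open>G \<in> borel_measurable \<nu>\<close> by blast
  qed
qed

end

section \<open>From the Muckenhoupt condition on cubes to a pointwise condition on balls\<close>

lemma measurable_if_measurable_on_cballs:
  fixes f :: "'a::euclidean_space \<Rightarrow> 'b::{banach, second_countable_topology}"
  assumes "\<And>n::nat. (\<lambda>x. indicator (cball 0 n) x *\<^sub>R f x) \<in> borel_measurable lebesgue"
  shows "f \<in> borel_measurable lebesgue"
proof (rule borel_measurable_LIMSEQ_metric[OF assms])
  fix x :: 'a
  obtain N :: nat where N: "norm x \<le> N" using real_arch_simple by blast
  have "\<forall>\<^sub>F n in sequentially. indicator (cball 0 (real n)) x *\<^sub>R f x = f x"
    using eventually_ge_at_top[of N]
  proof eventually_elim
    case (elim n)
    then have "x \<in> cball 0 (real n)" using N by simp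
    then show ?case by simp
  qed
  then show "(\<lambda>n. indicator (cball 0 (real n)) x *\<^sub>R f x) \<longlonglongrightarrow> f x" by (rule tendsto_eventually)
qed

lemma locally_integrable_measurable:
  "locally_integrable f \<Longrightarrow> f \<in> borel_measurable lebesgue"
  by (rule measurable_if_measurable_on_cballs)
    (auto simp: locally_integrable_def set_integrable_def intro!: borel_measurable_integrable)

lemma nn_integral_set_integral:
  assumes "set_integrable M S f" "AE x in M. 0 \<le> f x"
  shows "(\<integral>\<^sup>+x. ennreal (f x) * indicator S x \<partial>M) = ennreal (LINT x:S|M. f x)"
proof -
  have "(\<integral>\<^sup>+x. ennreal (f x) * indicator S x \<partial>M) = (\<integral>\<^sup>+x. ennreal (indicator S x *\<^sub>R f x) \<partial>M)"
    by (intro nn_integral_cong) (simp add: indicator_def)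
  also have "\<dots> = ennreal (LINT x:S|M. f x)"
    unfolding set_lebesgue_integral_def
    using assms by (intro nn_integral_eq_integral) (auto simp: set_integrable_def indicator_def)
  finally show ?thesis .
qed

lemma sum_Basis_nth: "(\<Sum>x\<in>(Basis :: (real^'n) set). x $ i) = 1"
proof -
  have "(One :: real^'n) $ i = 1" unfolding cart_eq_inner_axis by simp
  then show ?thesis by simp
qed

lemma mem_cube: "x \<in> cbox a (a + l *\<^sub>R One) \<longleftrightarrow> (\<forall>i. a $ i \<le> x $ i \<and> x $ i \<le> a $ i + l)"
  for a x :: "real^'n"
  by (simp add: mem_box_cart sum_Basis_nth)

lemma cube_subset_cball:
  "cbox (x - r *\<^sub>R One) (x - r *\<^sub>R One + (2 * r) *\<^sub>R One) \<subseteq> cball x (real CARD('n) * r)"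
  for x :: "real^'n"
proof
  fix y assume "y \<in> cbox (x - r *\<^sub>R One) (x - r *\<^sub>R One + (2 * r) *\<^sub>R One)"
  then have "(x - r *\<^sub>R One) $ i \<le> y $ i \<and> y $ i \<le> (x - r *\<^sub>R One) $ i + 2 * r" for i
    unfolding mem_cube by blast
  then have b: "\<bar>(x - y) $ i\<bar> \<le> r" for i by (simp add: sum_Basis_nth abs_le_iff algebra_simps)
  have "norm (x - y) \<le> (\<Sum>i\<in>UNIV. \<bar>(x - y) $ i\<bar>)" by (rule norm_le_l1_cart)
  also have "\<dots> \<le> real CARD('n) * r" using sum_bounded_above[of UNIV "\<lambda>i. \<bar>(x - y) $ i\<bar>" r] b by simp
  finally show "y \<in> cball x (real CARD('n) * r)" by (simp add: dist_norm)
qed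

lemma cball_subset_cube:
  "cball x r \<subseteq> cbox (x - r *\<^sub>R One) (x - r *\<^sub>R One + (2 * r) *\<^sub>R One)" for x :: "real^'n"
proof
  fix y assume "y \<in> cball x r"
  then have "\<bar>(x - y) $ i\<bar> \<le> r" for i using component_le_norm_cart[of "x - y" i] by (simp add: dist_norm)
  then have "x $ i - r \<le> y $ i \<and> y $ i \<le> x $ i - r + 2 * r" for i by (simp add: abs_le_iff algebra_simps)
  then show "y \<in> cbox (x - r *\<^sub>R One) (x - r *\<^sub>R One + (2 * r) *\<^sub>R One)"
    unfolding mem_cube by (simp add: sum_Basis_nth)
qed

lemma measure_cube: "0 \<le> l \<Longrightarrow> measure lebesgue (cbox a (a + l *\<^sub>R One)) = l ^ CARD('n)" for a :: "real^'n"
  using content_cbox_cart[of a "a + l *\<^sub>R One"] mem_cube[of a a l] by (fastforce simp: sum_Basis_nth)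

lemma cube_mem_cubes: "0 < l \<Longrightarrow> cbox a (a + l *\<^sub>R One) \<in> cubes"
  by (auto simp: cubes_def)

lemma measure_lebesgue_cball:
  "0 \<le> r \<Longrightarrow> measure lebesgue (cball x r) = unit_ball_vol (real CARD('n)) * r ^ CARD('n)" for x :: "real^'n"
  using content_cball[of r x] by simp

text \<open>The measure \<open>w dx\<close>; the negative part of \<open>w\<close>, if any, counts as zero.\<close>

definition wm :: "(real^'n \<Rightarrow> real) \<Rightarrow> (real^'n) measure" where
  "wm w = density lebesgue (\<lambda>x. ennreal (w x))"

lemma sets_wm[simp]: "sets (wm w) = sets lebesgue" by (simp add: wm_def)

lemma measurable_wm[simp]: "borel_measurable (wm w) = borel_measurable lebesgue"
  by (rule measurable_cong_sets) auto

lemma nn_integral_wm: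
  "w \<in> borel_measurable lebesgue \<Longrightarrow> f \<in> borel_measurable lebesgue \<Longrightarrow>
    (\<integral>\<^sup>+x. f x \<partial>wm w) = (\<integral>\<^sup>+x. ennreal (w x) * f x \<partial>lebesgue)"
  unfolding wm_def by (rule nn_integral_density) auto

lemma weight_measurable: "weight w \<Longrightarrow> w \<in> borel_measurable lebesgue"
  by (simp add: weight_def locally_integrable_measurable)

lemma AE_wm: "w \<in> borel_measurable lebesgue \<Longrightarrow> AE x in lebesgue. P x \<Longrightarrow> AE x in wm w. P x"
  unfolding wm_def by (subst AE_density) auto

lemma AE_wm_iff: "weight w \<Longrightarrow> (AE x in wm w. P x) \<longleftrightarrow> (AE x in lebesgue. P x)"
proof
  assume w: "weight w" and "AE x in wm w. P x"
  then have "AE x in lebesgue. 0 < ennreal (w x) \<longrightarrow> P x"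
    unfolding wm_def using weight_measurable[OF w] by (subst (asm) AE_density) auto
  moreover have "AE x in lebesgue. 0 < w x" using w by (simp add: weight_def)
  ultimately show "AE x in lebesgue. P x" by eventually_elim auto
qed (auto intro: AE_wm weight_measurable)

lemma emeasure_wm:
  assumes "weight w" "compact S"
  shows "emeasure (wm w) S = ennreal (wmeas w S)"
proof -
  have "S \<in> sets lebesgue" using assms(2) by (simp add: borel_compact)
  then have "emeasure (wm w) S = (\<integral>\<^sup>+x. ennreal (w x) * indicator S x \<partial>lebesgue)"
    unfolding wm_def using weight_measurable[OF assms(1)] by (intro emeasure_density) auto
  also have "\<dots> = ennreal (wmeas w S)" unfolding wmeas_def
    using assms by (intro nn_integral_set_integral) (auto simp: weight_def locally_integrable_def)
  finally show ?thesis .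
qed

lemma wmeas_nonneg: "weight w \<Longrightarrow> 0 \<le> wmeas w S"
  unfolding wmeas_def set_lebesgue_integral_def weight_def
  by (intro integral_nonneg_AE) auto

lemma measure_wm: "weight w \<Longrightarrow> compact S \<Longrightarrow> measure (wm w) S = wmeas w S"
  unfolding measure_def by (simp add: emeasure_wm wmeas_nonneg)

lemma compact_cube: "Q \<in> cubes \<Longrightarrow> compact Q" by (auto simp: cubes_def)

text \<open>The step from \<open>w powr q\<close> to \<open>w\<close>: \<open>le_split_powr\<close> with \<open>\<tau> = w y\<close> bounds the mean of \<open>w\<close> by
  \<open>w y\<close> plus \<open>w y powr (1 - q)\<close> times the mean of \<open>w powr q\<close>, and by assumption the latter mean is at most
  \<open>C * w y powr q\<close>.\<close>

lemma A1_average_le: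
  fixes w :: "real^'n \<Rightarrow> real"
  assumes w: "weight w" and A1: "(\<lambda>x. w x powr q) \<in> A1" and q: "1 < q"
  obtains C where "0 < C" "\<And>Q. Q \<in> cubes \<Longrightarrow> AE y in lebesgue. y \<in> Q \<longrightarrow> wmeas w Q \<le> C * measure lebesgue Q * w y"
proof -
  let ?u = "\<lambda>x. w x powr q"
  obtain C where C: "0 < C" and A1C: "\<And>Q. Q \<in> cubes \<Longrightarrow> ereal (average Q ?u) \<le> ereal C * ess_inf Q ?u"
    and wu: "weight ?u" using A1 unfolding A1_def by auto
  have [measurable]: "w \<in> borel_measurable lebesgue" by (rule weight_measurable[OF w])
  show ?thesis
  proof (rule that[of "C + 1"])
    show "0 < C + 1" using C by simp
    fix Q :: "(real^'n) set" assume Q: "Q \<in> cubes"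
    then obtain a l where Ql: "Q = cbox a (a + l *\<^sub>R One)" "0 < l" by (auto simp: cubes_def)
    have [measurable]: "Q \<in> sets lebesgue" using Ql by simp
    have mQ: "0 < measure lebesgue Q" using Ql measure_cube[of l a] by simp
    have "AE y in restrict_space lebesgue Q. - ereal (?u y) \<le> esssup (restrict_space lebesgue Q) (\<lambda>x. - ereal (?u x))"
      by (rule esssup_AE)
    then have "AE y in lebesgue. y \<in> Q \<longrightarrow> - ereal (?u y) \<le> esssup (restrict_space lebesgue Q) (\<lambda>x. - ereal (?u x))"
      by (subst (asm) AE_restrict_space_iff) auto
    moreover have "AE y in lebesgue. 0 < w y" using w by (simp add: weight_def)
    ultimately show "AE y in lebesgue. y \<in> Q \<longrightarrow> wmeas w Q \<le> (C + 1) * measure lebesgue Q * w y"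
    proof eventually_elim
      case (elim y)
      show ?case
      proof
        assume "y \<in> Q"
        with elim have "ess_inf Q ?u \<le> ereal (?u y)" unfolding ess_inf_def by (metis ereal_uminus_le_reorder)
        then have "ereal C * ess_inf Q ?u \<le> ereal C * ereal (?u y)" using C by (intro ereal_mult_left_mono) auto
        then have "average Q ?u \<le> C * ?u y" using A1C[OF Q] order_trans by fastforce
        then have av: "(LINT x:Q|lebesgue. ?u x) \<le> C * ?u y * measure lebesgue Q"
          using mQ by (simp add: average_def field_simps)
        let ?\<tau> = "w y"
        have int: "set_integrable lebesgue Q ?u" "set_integrable lebesgue Q w"
          using wu w compact_cube[OF Q] by (auto simp: weight_def locally_integrable_def)
        have intc: "set_integrable lebesgue Q (\<lambda>x. ?\<tau>)"
          unfolding set_integrable_def using Ql by (intro integrable_scaleR_left impI integrable_real_indicator) (auto simp: emeasure_lborel_cbox_eq)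
        have "wmeas w Q \<le> (LINT x:Q|lebesgue. ?\<tau> powr (1 - q) * ?u x + ?\<tau>)"
          unfolding wmeas_def
        proof (rule set_integral_mono_AE[OF int(2)])
          show "set_integrable lebesgue Q (\<lambda>x. ?\<tau> powr (1 - q) * ?u x + ?\<tau>)"
            using int intc by (intro set_integral_add) auto
          show "AE x\<in>Q in lebesgue. w x \<le> ?\<tau> powr (1 - q) * ?u x + ?\<tau>"
          proof -
            have "AE x in lebesgue. 0 < w x" using w by (simp add: weight_def)
            then show ?thesis by eventually_elim (use elim(2) q in \<open>auto intro!: le_split_powr\<close>)
          qed
        qed
        also have "\<dots> = ?\<tau> powr (1 - q) * (LINT x:Q|lebesgue. ?u x) + measure lebesgue Q * ?\<tau>"
          using int intc by (subst set_integral_add) (auto simp: set_lebesgue_integral_def)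
        also have "\<dots> \<le> ?\<tau> powr (1 - q) * (C * ?u y * measure lebesgue Q) + measure lebesgue Q * ?\<tau>"
          by (intro add_right_mono mult_left_mono av) auto
        also have "?\<tau> powr (1 - q) * (C * ?u y * measure lebesgue Q) = C * measure lebesgue Q * (?\<tau> powr (1 - q) * ?\<tau> powr q)" by simp
        also have "?\<tau> powr (1 - q) * ?\<tau> powr q = ?\<tau>" using elim(2) by (subst powr_add[symmetric]) simp
        finally show "wmeas w Q \<le> (C + 1) * measure lebesgue Q * w y" by (simp add: algebra_simps)
      qed
    qed
  qed
qed

text \<open>The exceptional null set of the \<open>A\<^sub>1\<close> condition depends on the cube. Every ball of radius \<open>r\<close> lies in
  a cube of side at most \<open>7 * r\<close> that belongs to a fixed countable family, so one null set serves all balls.\<close>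

lemma A1_pointwise_cballs:
  fixes w :: "real^'n \<Rightarrow> real"
  assumes w: "weight w" and A1: "(\<lambda>x. w x powr q) \<in> A1" and q: "1 < q"
  obtains A where "0 < A" "AE y in lebesgue. \<forall>x r. 0 < r \<longrightarrow> y \<in> cball x r \<longrightarrow>
     measure (wm w) (cball x r) \<le> A * r ^ CARD('n) * w y"
proof -
  obtain C where C: "0 < C" and avg: "\<And>Q. Q \<in> cubes \<Longrightarrow> AE y in lebesgue. y \<in> Q \<longrightarrow> wmeas w Q \<le> C * measure lebesgue Q * w y"
    using A1_average_le[OF assms] by blast
  obtain S :: "(real^'n) set" where S: "countable S" "\<And>X. open X \<Longrightarrow> X \<noteq> {} \<Longrightarrow> \<exists>d\<in>S. d \<in> X"
    by (rule countable_dense_setE) blast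
  define Qs where "Qs = (\<lambda>(a, l). cbox a (a + l *\<^sub>R One)) ` (S \<times> (\<rat> \<inter> {0<..} :: real set))"
  have "countable Qs" unfolding Qs_def
    by (intro countable_image countable_SIGMA S(1) countable_Int1 countable_rat)
  moreover have "Qs \<subseteq> cubes" by (auto simp: Qs_def cubes_def)
  ultimately have "AE y in lebesgue. \<forall>Q\<in>Qs. y \<in> Q \<longrightarrow> wmeas w Q \<le> C * measure lebesgue Q * w y"
    using avg by (intro AE_ball_countable') auto
  moreover have "AE y in lebesgue. 0 < w y" using w by (simp add: weight_def)
  ultimately have "AE y in lebesgue. \<forall>x r. 0 < r \<longrightarrow> y \<in> cball x r \<longrightarrow>
     measure (wm w) (cball x r) \<le> C * 7 ^ CARD('n) * r ^ CARD('n) * w y"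
  proof eventually_elim
    case (elim y)
    show ?case
    proof (intro allI impI)
      fix x :: "real^'n" and r :: real
      assume r: "0 < r" and y: "y \<in> cball x r"
      \<comment> \<open>a corner within \<open>r\<close> of the point \<open>2 * r\<close> below \<open>x\<close> lies between 3r and r below \<open>x\<close> in each coordinate\<close>
      obtain a where a: "a \<in> S" "a \<in> ball (x - (2 * r) *\<^sub>R One) r" using S(2)[of "ball (x - (2 * r) *\<^sub>R One) r"] r by auto
      obtain l where l: "l \<in> \<rat>" "6 * r < l" "l < 7 * r" using Rats_dense_in_real[of "6 * r" "7 * r"] r by auto
      let ?Q = "cbox a (a + l *\<^sub>R One)"
      have sub: "cball x r \<subseteq> ?Q"
      proof
        fix z assume "z \<in> cball x r"
        then have z: "\<bar>(x - z) $ i\<bar> \<le> r" for i using component_le_norm_cart[of "x - z" i] by (simp add: dist_norm)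
        have "\<bar>(x - (2 * r) *\<^sub>R One - a) $ i\<bar> \<le> r" for i
          using component_le_norm_cart[of "x - (2 * r) *\<^sub>R One - a" i] a(2) by (simp add: dist_norm)
        then have a': "\<bar>x $ i - 2 * r - a $ i\<bar> \<le> r" for i by (simp add: sum_Basis_nth)
        show "z \<in> ?Q" unfolding mem_cube
        proof
          fix i show "a $ i \<le> z $ i \<and> z $ i \<le> a $ i + l"
            using z[of i] a'[of i] l r by (simp add: abs_le_iff)
        qed
      qed
      have "?Q \<in> Qs" unfolding Qs_def using a(1) l r by (intro image_eqI[of _ _ "(a, l)"]) auto
      have "measure (wm w) (cball x r) \<le> measure (wm w) ?Q"
        using emeasure_wm[OF w, of ?Q] by (intro measure_mono_fmeasurable[OF sub]) (auto simp: fmeasurable_def)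
      also have "\<dots> = wmeas w ?Q" by (rule measure_wm[OF w]) simp
      also have "\<dots> \<le> C * measure lebesgue ?Q * w y" using elim(1) \<open>?Q \<in> Qs\<close> sub y by blast
      also have "measure lebesgue ?Q = l ^ CARD('n)" using l r by (intro measure_cube) auto
      also have "C * l ^ CARD('n) * w y \<le> C * (7 * r) ^ CARD('n) * w y"
        using l r C elim(2) by (intro mult_right_mono mult_left_mono power_mono) auto
      finally show "measure (wm w) (cball x r) \<le> C * 7 ^ CARD('n) * r ^ CARD('n) * w y"
        by (simp add: power_mult_distrib mult_ac)
    qed
  qed
  then show ?thesis using that[of "C * 7 ^ CARD('n)"] C by simp
qed

section \<open>The weighted measure is doubling; oscillation of Lipschitz functions on balls\<close>

locale pointwise_A1 =
  fixes w :: "real^'n \<Rightarrow> real" and A :: real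
  assumes weight: "weight w" and A_pos: "0 < A"
    and pointwise: "AE y in lebesgue. \<forall>x r. 0 < r \<longrightarrow> y \<in> cball x r \<longrightarrow>
      measure (wm w) (cball x r) \<le> A * r ^ CARD('n) * w y"
begin

lemma w_measurable[measurable]: "w \<in> borel_measurable lebesgue"
  by (rule weight_measurable[OF weight])

lemma w_pos: "AE x in lebesgue. 0 < w x" using weight by (simp add: weight_def)

lemma emeasure_wm_cball: "emeasure (wm w) (cball x r) = ennreal (measure (wm w) (cball x r))"
  using emeasure_wm[OF weight, of "cball x r"] measure_wm[OF weight, of "cball x r"] by simp

text \<open>Integrating the pointwise condition over \<open>y \<in> E\<close> shows that a part of a ball with a fixed share of its
  volume has a fixed share of its weight. Doubling is the case of a smaller concentric ball, reverse doubling
  that of an annulus.\<close>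

lemma measure_subset_cball_ge:
  assumes E: "E \<in> sets lebesgue" "E \<subseteq> cball x r" and r: "0 < r"
  shows "measure lebesgue E * measure (wm w) (cball x r) \<le> A * r ^ CARD('n) * measure (wm w) E"
proof -
  let ?V = "measure (wm w) (cball x r)"
  have fE: "emeasure lebesgue E \<le> emeasure lebesgue (cball x r)" using E by (intro emeasure_mono) auto
  also have "\<dots> < \<infinity>" using emeasure_lborel_cball_finite[of x r] by (simp add: top.not_eq_extremum)
  finally have 1: "emeasure lebesgue E = ennreal (measure lebesgue E)" by (simp add: emeasure_eq_ennreal_measure)
  have "emeasure (wm w) E \<le> emeasure (wm w) (cball x r)" using E by (intro emeasure_mono) auto
  also have "\<dots> < \<infinity>" by (simp add: emeasure_wm_cball)
  finally have 2: "emeasure (wm w) E = ennreal (measure (wm w) E)" by (simp add: emeasure_eq_ennreal_measure)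
  have "ennreal (measure lebesgue E * ?V) = (\<integral>\<^sup>+y. ennreal ?V * indicator E y \<partial>lebesgue)"
    using E(1) by (subst nn_integral_cmult_indicator) (simp_all only: 1 ennreal_mult measure_nonneg mult.commute)
  also have "\<dots> \<le> (\<integral>\<^sup>+y. ennreal (A * r ^ CARD('n)) * (ennreal (w y) * indicator E y) \<partial>lebesgue)"
  proof (rule nn_integral_mono_AE, use pointwise in eventually_elim)
    case (elim y)
    show ?case
    proof (cases "y \<in> E")
      case True
      then have "?V \<le> A * r ^ CARD('n) * w y" using elim E r by blast
      then have "ennreal ?V \<le> ennreal (A * r ^ CARD('n) * w y)" by (rule ennreal_leI)
      also have "\<dots> = ennreal (A * r ^ CARD('n)) * ennreal (w y)" using A_pos r by (intro ennreal_mult') auto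
      finally show ?thesis using True by simp
    qed simp
  qed
  also have "\<dots> = ennreal (A * r ^ CARD('n)) * emeasure (wm w) E"
    unfolding wm_def using E(1) by (subst nn_integral_cmult) (auto simp: emeasure_density)
  also have "\<dots> = ennreal (A * r ^ CARD('n) * measure (wm w) E)"
    using 2 A_pos r by (simp add: ennreal_mult)
  finally show ?thesis using A_pos r by (subst (asm) ennreal_le_iff) auto
qed

lemma wm_cball_pos: "0 < r \<Longrightarrow> 0 < measure (wm w) (cball x r)"
proof (rule ccontr)
  assume r: "0 < r" and "\<not> ?thesis"
  then have "emeasure (wm w) (cball x r) = 0" by (simp add: emeasure_wm_cball not_less measure_le_0_iff)
  then have zero: "(\<integral>\<^sup>+y. ennreal (w y) * indicator (cball x r) y \<partial>lebesgue) = 0"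
    unfolding wm_def by (subst (asm) emeasure_density) auto
  have [measurable]: "cball x r \<in> sets lebesgue" by simp
  have "AE y in lebesgue. ennreal (w y) * indicator (cball x r) y = 0"
    by (rule nn_integral_0_iff_AE[THEN iffD1, OF _ zero]) measurable
  then have "AE y in lebesgue. y \<notin> cball x r" using w_pos by eventually_elim (auto simp: indicator_def split: if_splits)
  then have "cball x r \<in> null_sets lebesgue" by (subst (asm) AE_iff_null) (auto simp: cball_def)
  then have "measure lebesgue (cball x r) = 0" by (metis measure_eq_0_null_sets)
  then show False using r by simp
qed

lemma wm_cball_scale_le:
  assumes "0 < r" "1 \<le> c"
  shows "measure (wm w) (cball x (c * r)) \<le> A * c ^ CARD('n) / unit_ball_vol (real CARD('n)) * measure (wm w) (cball x r)"
proof -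
  have "cball x r \<subseteq> cball x (c * r)" using assms by (intro subset_cball) auto
  then have "measure lebesgue (cball x r) * measure (wm w) (cball x (c * r)) \<le> A * (c * r) ^ CARD('n) * measure (wm w) (cball x r)"
    using assms by (intro measure_subset_cball_ge) auto
  then have "r ^ CARD('n) * (unit_ball_vol (real CARD('n)) * measure (wm w) (cball x (c * r))) \<le> r ^ CARD('n) * (A * c ^ CARD('n) * measure (wm w) (cball x r))"
    using assms measure_lebesgue_cball[of r x] by (simp add: power_mult_distrib mult_ac)
  then have "unit_ball_vol (real CARD('n)) * measure (wm w) (cball x (c * r)) \<le> A * c ^ CARD('n) * measure (wm w) (cball x r)"
    using assms by (simp add: mult_le_cancel_left_pos)
  then show ?thesis by (simp add: pos_le_divide_eq mult.commute)
qed

lemma wm_reverse_doubling: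
  assumes r: "0 < r"
  shows "measure (wm w) (cball x r) \<le> (1 - unit_ball_vol (real CARD('n)) / (A * 2 ^ CARD('n))) * measure (wm w) (cball x (2 * r))"
proof -
  let ?V = "\<lambda>r. measure (wm w) (cball x r)"
  let ?E = "cball x (2 * r) - cball x r"
  have sub: "cball x r \<subseteq> cball x (2 * r)" using r by (intro subset_cball) auto
  have fm: "cball x r \<in> fmeasurable (wm w)" "cball x (2 * r) \<in> fmeasurable (wm w)" for r
    by (auto simp: fmeasurable_def emeasure_wm_cball)
  have "measure lebesgue ?E = measure lebesgue (cball x (2 * r)) - measure lebesgue (cball x r)"
    using sub by (intro measurable_measure_Diff) auto
  also have "\<dots> = unit_ball_vol (real CARD('n)) * r ^ CARD('n) * (2 ^ CARD('n) - 1)"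
    using r measure_lebesgue_cball[of r x] measure_lebesgue_cball[of "2 * r" x]
    by (simp add: power_mult_distrib algebra_simps)
  also have "\<dots> \<ge> unit_ball_vol (real CARD('n)) * r ^ CARD('n) * 1"
  proof (rule mult_left_mono)
    have "(2::real) ^ 1 \<le> 2 ^ CARD('n)" by (intro power_increasing) (auto simp: Suc_le_eq)
    then show "(1::real) \<le> 2 ^ CARD('n) - 1" by simp
  qed (use r in auto)
  finally have "unit_ball_vol (real CARD('n)) * r ^ CARD('n) * ?V (2 * r) \<le> measure lebesgue ?E * ?V (2 * r)"
    by (intro mult_right_mono) auto
  also have "\<dots> \<le> A * (2 * r) ^ CARD('n) * measure (wm w) ?E"
    using r by (intro measure_subset_cball_ge) auto
  also have "measure (wm w) ?E = ?V (2 * r) - ?V r"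
    by (intro measurable_measure_Diff fm sub) (use fm in auto)
  finally have "r ^ CARD('n) * (unit_ball_vol (real CARD('n)) * ?V (2 * r)) \<le> r ^ CARD('n) * (A * 2 ^ CARD('n) * (?V (2 * r) - ?V r))"
    by (simp add: power_mult_distrib mult_ac)
  then have "unit_ball_vol (real CARD('n)) * ?V (2 * r) \<le> A * 2 ^ CARD('n) * (?V (2 * r) - ?V r)"
    using r by (simp add: mult_le_cancel_left_pos)
  then have "unit_ball_vol (real CARD('n)) * ?V (2 * r) / (A * 2 ^ CARD('n)) \<le> ?V (2 * r) - ?V r"
    using A_pos by (simp add: pos_divide_le_eq mult.commute)
  then show ?thesis by (simp add: algebra_simps)
qed

sublocale doubling_measure "wm w" "A * 2 ^ CARD('n) / unit_ball_vol (real CARD('n))" "1 - unit_ball_vol (real CARD('n)) / (A * 2 ^ CARD('n))"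
proof
  show "0 < 1 - unit_ball_vol (real CARD('n)) / (A * 2 ^ CARD('n))"
  proof (rule zero_less_mult_pos2)
    show "0 < (1 - unit_ball_vol (real CARD('n)) / (A * 2 ^ CARD('n))) * measure (wm w) (cball 0 (2 * 1))"
      by (rule less_le_trans[OF wm_cball_pos wm_reverse_doubling]) auto
    show "0 < measure (wm w) (cball 0 (2 * 1))" by (rule wm_cball_pos) simp
  qed
  show "1 - unit_ball_vol (real CARD('n)) / (A * 2 ^ CARD('n)) < 1" using A_pos by simp
  show "sets (wm w) = sets lebesgue" by simp
  show "emeasure (wm w) (cball x r) < \<infinity>" for x r by (simp add: emeasure_wm_cball)
  fix x r
  assume r: "0 < (r::real)"
  show "0 < measure (wm w) (cball x r)" by (rule wm_cball_pos[OF r])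
  show "measure (wm w) (cball x r) \<le> (1 - unit_ball_vol (real CARD('n)) / (A * 2 ^ CARD('n))) * measure (wm w) (cball x (2 * r))"
    by (rule wm_reverse_doubling[OF r])
  show "measure (wm w) (cball x (2 * r)) \<le> A * 2 ^ CARD('n) / unit_ball_vol (real CARD('n)) * measure (wm w) (cball x r)"
    by (rule wm_cball_scale_le[OF r]) simp
qed

lemma cball_in_cube_measure:
  fixes x :: "real^'n"
  assumes r: "0 < r" and Q: "Q = cbox (x - r *\<^sub>R One) (x - r *\<^sub>R One + (2 * r) *\<^sub>R One)"
  shows "wmeas w Q \<le> A * real CARD('n) ^ CARD('n) / unit_ball_vol (real CARD('n)) * V x r" "V x r \<le> wmeas w Q" "Q \<in> cubes" "cball x r \<subseteq> Q"
proof -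
  show Qc: "Q \<in> cubes" unfolding Q using r by (intro cube_mem_cubes) simp
  show sub: "cball x r \<subseteq> Q" unfolding Q by (rule cball_subset_cube)
  have fm: "S \<in> fmeasurable (wm w)" if "compact S" for S
    using that emeasure_wm[OF weight that] by (auto simp: fmeasurable_def borel_compact)
  have "wmeas w Q = measure (wm w) Q" using compact_cube[OF Qc] by (simp add: measure_wm[OF weight])
  also have "\<dots> \<le> V x (real CARD('n) * r)" unfolding Q
    by (rule measure_mono_fmeasurable[OF cube_subset_cball]) (auto intro: fm)
  also have "\<dots> \<le> A * real CARD('n) ^ CARD('n) / unit_ball_vol (real CARD('n)) * V x r"
    using r by (intro wm_cball_scale_le) (auto simp: Suc_le_eq)
  finally show "wmeas w Q \<le> A * real CARD('n) ^ CARD('n) / unit_ball_vol (real CARD('n)) * V x r" .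
  have "V x r \<le> measure (wm w) Q"
    using compact_cube[OF Qc] by (intro measure_mono_fmeasurable[OF sub]) (auto intro: fm)
  then show "V x r \<le> wmeas w Q" using compact_cube[OF Qc] by (simp add: measure_wm[OF weight])
qed

text \<open>Here \<open>c x r\<close> is the mean of \<open>b\<close> over the cube of half-side \<open>r\<close> about \<open>x\<close>, whose weight is comparable
  with that of the ball of radius \<open>r\<close>.\<close>

lemma Lip_oscillation_cball:
  fixes b :: "real^'n \<Rightarrow> 'b::{banach, second_countable_topology}"
  assumes b: "b \<in> Lip \<beta> w" and \<beta>: "0 < \<beta>"
  obtains L c where "0 < L" "\<And>x r. 0 < r \<Longrightarrow> (\<integral>\<^sup>+y. ennreal (norm (b y - c x r)) * indicator (cball x r) y \<partial>lebesgue)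
      \<le> ennreal (L * V x r powr (1 + \<beta> / CARD('n)))"
proof -
  let ?a = "\<beta> / CARD('n)"
  have bl: "locally_integrable b" and ln: "lip_norm \<beta> w b < \<infinity>" using b by (auto simp: Lip_def)
  have "lip_norm \<beta> w b \<le> ereal (max 1 (real_of_ereal (lip_norm \<beta> w b)))"
    using ln by (cases "lip_norm \<beta> w b") auto
  then obtain l where l: "1 \<le> l" "lip_norm \<beta> w b \<le> ereal l" by (meson max.cobounded1)
  define K where "K = A * real CARD('n) ^ CARD('n) / unit_ball_vol (real CARD('n))"
  define Q where "Q x r = cbox (x - r *\<^sub>R One) (x - r *\<^sub>R One + (2 * r) *\<^sub>R One)" for x :: "real^'n" and r
  have K: "0 < K" using A_pos by (simp add: K_def)
  show ?thesis
  proof (rule that[of "l * K powr (1 + ?a)" "\<lambda>x r. average (Q x r) b"])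
    show "0 < l * K powr (1 + ?a)" using l K by simp
    fix x :: "real^'n" and r :: real
    assume r: "0 < r"
    note facts = cball_in_cube_measure[OF r Q_def[of x r]]
    have V: "0 < V x r" by (rule measure_cball_pos[OF r])
    have wQ: "0 < wmeas w (Q x r)" using facts(2) V by linarith
    let ?f = "\<lambda>y. b y - average (Q x r) b"
    have intb: "set_integrable lebesgue (Q x r) b" using bl compact_cube[OF facts(3)] by (simp add: locally_integrable_def)
    have intc: "set_integrable lebesgue (Q x r) (\<lambda>y. average (Q x r) b)"
      unfolding set_integrable_def Q_def by (intro integrable_scaleR_left impI integrable_real_indicator) (auto simp: emeasure_lborel_cbox_eq)
    have intf: "set_integrable lebesgue (Q x r) (\<lambda>y. norm (?f y))"
      by (intro set_integrable_norm set_integral_diff intb intc)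
    have "ereal (1 / wmeas w (Q x r) powr ?a * (1 / wmeas w (Q x r) * (LINT y:Q x r|lebesgue. norm (?f y)))) \<le> lip_norm \<beta> w b"
      unfolding lip_norm_def using facts(3) by (rule SUP_upper)
    from order_trans[OF this l(2)] have "1 / wmeas w (Q x r) powr ?a * (1 / wmeas w (Q x r) * (LINT y:Q x r|lebesgue. norm (?f y))) \<le> l"
      by simp
    then have "(LINT y:Q x r|lebesgue. norm (?f y)) \<le> l * (wmeas w (Q x r) powr ?a * wmeas w (Q x r))"
      using wQ by (simp add: field_simps)
    also have "wmeas w (Q x r) powr ?a * wmeas w (Q x r) = wmeas w (Q x r) powr (1 + ?a)"
      using wQ by (simp add: powr_add)
    also have "l * wmeas w (Q x r) powr (1 + ?a) \<le> l * (K * V x r) powr (1 + ?a)"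
      using facts(1) wQ l \<beta> unfolding K_def by (intro mult_left_mono powr_mono2) auto
    also have "\<dots> = l * K powr (1 + ?a) * V x r powr (1 + ?a)" by (simp add: powr_mult)
    finally have "(LINT y:Q x r|lebesgue. norm (?f y)) \<le> l * K powr (1 + ?a) * V x r powr (1 + ?a)" .
    have "(\<integral>\<^sup>+y. ennreal (norm (?f y)) * indicator (cball x r) y \<partial>lebesgue) \<le> (\<integral>\<^sup>+y. ennreal (norm (?f y)) * indicator (Q x r) y \<partial>lebesgue)"
      using facts(4) by (intro nn_integral_mono) (auto simp: indicator_def)
    also have "\<dots> = ennreal (LINT y:Q x r|lebesgue. norm (?f y))"
      using intf by (rule nn_integral_set_integral) simp
    also have "\<dots> \<le> ennreal (l * K powr (1 + ?a) * V x r powr (1 + ?a))" by (rule ennreal_leI) fact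
    finally show "(\<integral>\<^sup>+y. ennreal (norm (?f y)) * indicator (cball x r) y \<partial>lebesgue) \<le> ennreal (l * K powr (1 + ?a) * V x r powr (1 + ?a))" .
  qed
qed

end

section \<open>Weighted Lipschitz functions pointwise\<close>

text \<open>The numbers \<open>c x r\<close> stand for means of \<open>b\<close> over sets comparable with the ball of radius \<open>r\<close>
  about \<open>x\<close>.\<close>

locale lipschitz_oscillation = pointwise_A1 w A for w :: "real^'n \<Rightarrow> real" and A +
  fixes b :: "real^'n \<Rightarrow> 'b::{banach, second_countable_topology}"
    and c :: "real^'n \<Rightarrow> real \<Rightarrow> 'b" and L \<alpha> :: real
  assumes b_measurable[measurable]: "b \<in> borel_measurable lebesgue"
    and L: "0 < L" and \<alpha>: "0 < \<alpha>"
    and oscillation: "0 < r \<Longrightarrow> (\<integral>\<^sup>+y. ennreal (norm (b y - c x r)) * indicator (cball x r) y \<partial>lebesgue)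
      \<le> ennreal (L * V x r powr (1 + \<alpha>))"
begin

definition good :: "real^'n \<Rightarrow> bool" where
  "good y \<longleftrightarrow> 0 < w y \<and> (\<forall>x r. 0 < r \<longrightarrow> y \<in> cball x r \<longrightarrow> V x r \<le> A * r ^ CARD('n) * w y)"

text \<open>The constants of the bounds \<open>center_diff\<close> and \<open>center_dyadic\<close>; \<open>\<theta>\<close> is the reverse doubling
  constant of \<open>wm w\<close>.\<close>

definition "K1 = 2 * L * A * 4 ^ CARD('n) / unit_ball_vol (real CARD('n))"
definition "\<theta> = 1 - unit_ball_vol (real CARD('n)) / (A * 2 ^ CARD('n))"
definition "K2 = K1 / (1 - \<theta> powr \<alpha>)"

lemma theta_bounds: "0 < \<theta>" "\<theta> < 1" "\<theta> powr \<alpha> < 1"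
  using theta theta_powr[OF \<alpha>] by (auto simp: \<theta>_def)

lemma K_pos: "0 < K1" "0 < K2"
  using L A_pos theta_bounds by (auto simp: K1_def K2_def)

lemma AE_good: "AE x in lebesgue. good x"
  using pointwise w_pos by eventually_elim (simp add: good_def)

lemma good_powr_bound:
  assumes "good z" "0 < r" "z \<in> cball x r"
  shows "V x r powr (1 + \<alpha>) \<le> A * r ^ CARD('n) * w z * V x r powr \<alpha>"
proof -
  have "V x r powr (1 + \<alpha>) = V x r * V x r powr \<alpha>"
    using measure_cball_pos[OF assms(2), of x] by (simp add: powr_add)
  also have "\<dots> \<le> A * r ^ CARD('n) * w z * V x r powr \<alpha>"
    using assms by (intro mult_right_mono) (auto simp: good_def)
  finally show ?thesis .
qed

text \<open>The average over the smaller ball of the distance between the two centres is at most the sum of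
  two oscillations. One factor \<open>V x r\<close> of the bound for these is exchanged for a multiple of
  \<open>t\<^sup>n * w z\<close> by the \<open>A\<^sub>1\<close> condition at \<open>z\<close>, and \<open>t\<^sup>n\<close> cancels.\<close>

lemma center_diff:
  assumes r: "0 < r" "0 < t" "r \<le> 4 * t" and sub: "cball y t \<subseteq> cball x r"
    and z: "good z" "z \<in> cball x r"
  shows "norm (c x r - c y t) \<le> K1 * w z * V x r powr \<alpha>"
proof -
  let ?\<Delta> = "norm (c x r - c y t)"
  have t: "emeasure lebesgue (cball y t) = ennreal (unit_ball_vol (real CARD('n)) * t ^ CARD('n))"
    using Ball_Volume.emeasure_cball[of t y] r by simp
  have "ennreal (?\<Delta> * (unit_ball_vol (real CARD('n)) * t ^ CARD('n))) = (\<integral>\<^sup>+u. ennreal ?\<Delta> * indicator (cball y t) u \<partial>lebesgue)"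
    using t by (subst nn_integral_cmult_indicator) (auto simp: ennreal_mult')
  also have "\<dots> \<le> (\<integral>\<^sup>+u. ennreal (norm (b u - c x r)) * indicator (cball x r) u + ennreal (norm (b u - c y t)) * indicator (cball y t) u \<partial>lebesgue)"
  proof (rule nn_integral_mono)
    fix u
    have "?\<Delta> \<le> norm (b u - c x r) + norm (b u - c y t)"
      using norm_triangle_ineq4[of "b u - c y t" "b u - c x r"] by (simp add: algebra_simps)
    then have "ennreal ?\<Delta> \<le> ennreal (norm (b u - c x r)) + ennreal (norm (b u - c y t))"
      by (subst ennreal_plus[symmetric]) (auto intro: ennreal_leI simp del: ennreal_plus)
    then show "ennreal ?\<Delta> * indicator (cball y t) u \<le> ennreal (norm (b u - c x r)) * indicator (cball x r) u + ennreal (norm (b u - c y t)) * indicator (cball y t) u"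
      using sub by (auto simp: indicator_def)
  qed
  also have "\<dots> = (\<integral>\<^sup>+u. ennreal (norm (b u - c x r)) * indicator (cball x r) u \<partial>lebesgue) + (\<integral>\<^sup>+u. ennreal (norm (b u - c y t)) * indicator (cball y t) u \<partial>lebesgue)"
  proof (rule nn_integral_add)
    have [measurable]: "cball z r \<in> sets lebesgue" for z :: "real^'n" and r by simp
    show "(\<lambda>u. ennreal (norm (b u - c x r)) * indicator (cball x r) u) \<in> borel_measurable lebesgue"
      "(\<lambda>u. ennreal (norm (b u - c y t)) * indicator (cball y t) u) \<in> borel_measurable lebesgue"
      by measurable
  qed
  also have "\<dots> \<le> ennreal (L * V x r powr (1 + \<alpha>)) + ennreal (L * V y t powr (1 + \<alpha>))"
    by (intro add_mono oscillation r)
  also have "\<dots> \<le> ennreal (L * V x r powr (1 + \<alpha>)) + ennreal (L * V x r powr (1 + \<alpha>))"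
    using V_mono[OF sub] L \<alpha> by (intro add_left_mono ennreal_leI mult_left_mono powr_mono2) auto
  also have "\<dots> = ennreal (2 * L * V x r powr (1 + \<alpha>))"
    using L by (subst ennreal_plus[symmetric]) auto
  also have "\<dots> \<le> ennreal (2 * L * (A * r ^ CARD('n) * w z * V x r powr \<alpha>))"
    using L good_powr_bound[OF z(1) r(1) z(2)] by (intro ennreal_leI mult_left_mono) auto
  also have "\<dots> \<le> ennreal (2 * L * (A * (4 * t) ^ CARD('n) * w z * V x r powr \<alpha>))"
    using L A_pos r z by (intro ennreal_leI mult_left_mono mult_right_mono power_mono) (auto simp: good_def)
  finally have "?\<Delta> * (unit_ball_vol (real CARD('n)) * t ^ CARD('n)) \<le> 2 * L * (A * (4 * t) ^ CARD('n) * w z * V x r powr \<alpha>)"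
    using L A_pos r z by (subst (asm) ennreal_le_iff) (auto simp: good_def)
  then have "t ^ CARD('n) * (?\<Delta> * unit_ball_vol (real CARD('n))) \<le> t ^ CARD('n) * (2 * L * A * 4 ^ CARD('n) * w z * V x r powr \<alpha>)"
    by (simp add: power_mult_distrib mult_ac)
  then have "?\<Delta> * unit_ball_vol (real CARD('n)) \<le> 2 * L * A * 4 ^ CARD('n) * w z * V x r powr \<alpha>"
    using r by (simp add: mult_le_cancel_left_pos)
  then have "?\<Delta> \<le> 2 * L * A * 4 ^ CARD('n) * w z * V x r powr \<alpha> / unit_ball_vol (real CARD('n))"
    by (simp add: pos_le_divide_eq)
  then show ?thesis by (simp add: K1_def)
qed

lemma V_powr_step: "V x (2 powi (m - 1)) powr \<alpha> \<le> \<theta> powr \<alpha> * V x (2 powi m) powr \<alpha>"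
proof -
  have "V x (2 powi (m - 1)) \<le> \<theta> * V x (2 powi m)" using V_dyadic_grow[of x "m - 1"] by (simp add: \<theta>_def)
  then have "V x (2 powi (m - 1)) powr \<alpha> \<le> (\<theta> * V x (2 powi m)) powr \<alpha>" using \<alpha> by (intro powr_mono2) auto
  then show ?thesis by (simp add: powr_mult)
qed

lemma V_powr_decay: "V x (2 powi (m - int j)) powr \<alpha> \<le> (\<theta> powr \<alpha>) ^ j * V x (2 powi m) powr \<alpha>"
proof (induction j arbitrary: m)
  case (Suc j)
  have "V x (2 powi (m - int (Suc j))) powr \<alpha> = V x (2 powi ((m - 1) - int j)) powr \<alpha>" by (simp add: algebra_simps)
  also have "\<dots> \<le> (\<theta> powr \<alpha>) ^ j * V x (2 powi (m - 1)) powr \<alpha>" by (rule Suc)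
  also have "\<dots> \<le> (\<theta> powr \<alpha>) ^ j * (\<theta> powr \<alpha> * V x (2 powi m) powr \<alpha>)"
    by (intro mult_left_mono V_powr_step) auto
  finally show ?case by (simp add: mult_ac)
qed simp

text \<open>The differences between consecutive dyadic scales form a geometric series. The constant \<open>K2\<close> is its sum and
  satisfies \<open>K2 * \<theta> powr \<alpha> + K1 = K2\<close>, which is what the induction step needs.\<close>

lemma center_dyadic:
  assumes x: "good x"
  shows "norm (c x (2 powi (m - int j)) - c x (2 powi m)) \<le> K2 * w x * V x (2 powi m) powr \<alpha>"
proof (induction j arbitrary: m)
  case 0
  show ?case using K_pos x by (simp add: good_def)
next
  case (Suc j)
  have wx: "0 \<le> w x" using x by (simp add: good_def)
  have e: "m - int (Suc j) = (m - 1) - int j" by simp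
  have two: "2 powi m = 2 * (2::real) powi (m - 1)" using power_int_add[of "2::real" "m - 1" 1] by simp
  have "norm (c x (2 powi (m - int (Suc j))) - c x (2 powi m))
     \<le> norm (c x (2 powi ((m - 1) - int j)) - c x (2 powi (m - 1))) + norm (c x (2 powi m) - c x (2 powi (m - 1)))"
    unfolding e using norm_triangle_ineq4[of "c x (2 powi ((m - 1) - int j)) - c x (2 powi (m - 1))" "c x (2 powi m) - c x (2 powi (m - 1))"]
    by simp
  also have "\<dots> \<le> K2 * w x * V x (2 powi (m - 1)) powr \<alpha> + K1 * w x * V x (2 powi m) powr \<alpha>"
    using x two by (intro add_mono Suc center_diff subset_cball) auto
  also have "\<dots> \<le> K2 * w x * (\<theta> powr \<alpha> * V x (2 powi m) powr \<alpha>) + K1 * w x * V x (2 powi m) powr \<alpha>"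
    using K_pos wx by (intro add_right_mono mult_left_mono V_powr_step) auto
  also have "\<dots> = (K2 * \<theta> powr \<alpha> + K1) * w x * V x (2 powi m) powr \<alpha>" by (simp add: algebra_simps)
  also have "K2 * \<theta> powr \<alpha> + K1 = K2"
  proof -
    have "K2 * (1 - \<theta> powr \<alpha>) = K1" using theta_bounds \<alpha> by (simp add: K2_def)
    then show ?thesis by (simp add: algebra_simps)
  qed
  finally show ?case .
qed

text \<open>A replacement for Lebesgue's differentiation theorem. At a point \<open>x\<close> of this set the centres \<open>c x t\<close> with
  small \<open>t\<close> stay at distance more than \<open>2 * \<delta>\<close> from \<open>d\<close>, whereas \<open>b\<close> is within \<open>\<delta>\<close> of \<open>d\<close> on the
  set. So \<open>\<delta>\<close> times the measure of the part of the set in the ball of radius \<open>t\<close> is at most the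
  oscillation there, and this is \<open>o(t\<^sup>n)\<close> at a good point. A set with density zero at each of its own
  points is negligible.\<close>

lemma negligible_far_from_centers:
  assumes \<delta>: "0 < \<delta>"
  shows "negligible {x. good x \<and> norm (b x - d) < \<delta> \<and> K2 * w x * V x (2 powi m) powr \<alpha> + 3 * \<delta> < norm (b x - c x (2 powi m))}"
    (is "negligible ?S")
  unfolding negligible_eq_zero_density
proof (intro ballI allI impI)
  fix x r e
  assume x: "x \<in> ?S" and r: "0 < (r::real)" and e: "0 < (e::real)"
  let ?vol = "unit_ball_vol (real CARD('n))"
  have gx: "good x" using x by simp
  then have wx: "0 < w x" by (simp add: good_def)
  have "(\<lambda>j. 2 powi m * (1/2::real) ^ j) \<longlonglongrightarrow> 2 powi m * 0" by (intro tendsto_mult tendsto_const LIMSEQ_power_zero) simp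
  then have 1: "\<forall>\<^sub>F j in sequentially. 2 powi m * (1/2::real) ^ j < r" using r by (intro order_tendstoD) auto
  have "(\<lambda>j. L * A * w x * ((\<theta> powr \<alpha>) ^ j * V x (2 powi m) powr \<alpha>)) \<longlonglongrightarrow> L * A * w x * (0 * V x (2 powi m) powr \<alpha>)"
    using theta_bounds by (intro tendsto_mult tendsto_const LIMSEQ_power_zero) auto
  then have 2: "\<forall>\<^sub>F j in sequentially. L * A * w x * ((\<theta> powr \<alpha>) ^ j * V x (2 powi m) powr \<alpha>) < e * \<delta> * ?vol"
    using e \<delta> by (intro order_tendstoD) auto
  \<comment> \<open>a scale that fits into the given radius and at which the oscillation is small against \<open>e * \<delta>\<close>\<close>
  obtain j where j: "2 powi m * (1/2::real) ^ j < r" "L * A * w x * ((\<theta> powr \<alpha>) ^ j * V x (2 powi m) powr \<alpha>) < e * \<delta> * ?vol"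
    using eventually_happens[OF eventually_conj[OF 1 2]] by auto
  define t where "t = (2::real) powi (m - int j)"
  have t: "0 < t" "t < r" using j(1) by (auto simp: t_def power_int_diff power_one_over divide_simps)
  define U where "U = {y \<in> cball x t. norm (b y - d) < \<delta>}"
  have U[measurable]: "U \<in> sets lebesgue"
  proof -
    have [measurable]: "cball x t \<in> sets lebesgue" by simp
    have "{y \<in> space lebesgue. y \<in> cball x t \<and> norm (b y - d) < \<delta>} \<in> sets lebesgue" by measurable
    also have "{y \<in> space lebesgue. y \<in> cball x t \<and> norm (b y - d) < \<delta>} = U" by (auto simp: U_def)
    finally show ?thesis .
  qed
  have Ulm: "U \<in> lmeasurable" by (rule fmeasurableI2[of "cball x t", OF _ _ U]) (auto simp: U_def)
  have "norm (b x - c x (2 powi m)) \<le> norm (b x - d) + norm (d - c x t) + norm (c x t - c x (2 powi m))"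
    using norm_triangle_ineq[of "b x - d" "d - c x t"] norm_triangle_ineq[of "b x - c x t" "c x t - c x (2 powi m)"] by simp
  moreover have "norm (c x t - c x (2 powi m)) \<le> K2 * w x * V x (2 powi m) powr \<alpha>"
    unfolding t_def by (rule center_dyadic[OF gx])
  ultimately have far: "2 * \<delta> < norm (d - c x t)" using x by simp
  have "ennreal (\<delta> * measure lebesgue U) = (\<integral>\<^sup>+y. ennreal \<delta> * indicator U y \<partial>lebesgue)"
    using Ulm U \<delta> by (subst nn_integral_cmult_indicator) (auto simp: ennreal_mult' emeasure_eq_measure2)
  also have "\<dots> \<le> (\<integral>\<^sup>+y. ennreal (norm (b y - c x t)) * indicator (cball x t) y \<partial>lebesgue)"
  proof (rule nn_integral_mono)
    fix y
    show "ennreal \<delta> * indicator U y \<le> ennreal (norm (b y - c x t)) * indicator (cball x t) y"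
    proof (cases "y \<in> U")
      case True
      then have "norm (b y - d) < \<delta>" "y \<in> cball x t" by (auto simp: U_def)
      moreover have "norm (d - c x t) \<le> norm (b y - c x t) + norm (b y - d)"
        using norm_triangle_ineq4[of "b y - c x t" "b y - d"] by simp
      ultimately show ?thesis using far True by (auto intro: ennreal_leI)
    qed simp
  qed
  also have "\<dots> \<le> ennreal (L * V x t powr (1 + \<alpha>))" by (rule oscillation[OF t(1)])
  also have "\<dots> \<le> ennreal (L * (A * t ^ CARD('n) * w x * V x t powr \<alpha>))"
    using L t by (intro ennreal_leI mult_left_mono good_powr_bound[OF gx]) auto
  finally have "\<delta> * measure lebesgue U \<le> L * (A * t ^ CARD('n) * w x * V x t powr \<alpha>)"
    using L A_pos t wx by (subst (asm) ennreal_le_iff) auto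
  also have "\<dots> = t ^ CARD('n) * (L * A * w x * V x t powr \<alpha>)" by simp
  also have "\<dots> \<le> t ^ CARD('n) * (L * A * w x * ((\<theta> powr \<alpha>) ^ j * V x (2 powi m) powr \<alpha>))"
    unfolding t_def using L A_pos wx by (intro mult_left_mono V_powr_decay) auto
  also have "\<dots> < t ^ CARD('n) * (e * \<delta> * ?vol)" using t by (intro mult_strict_left_mono j) auto
  also have "\<dots> = \<delta> * (e * measure lebesgue (ball x t))" using t content_ball[of t x] by simp
  finally have "measure lebesgue U < e * measure lebesgue (ball x t)" using \<delta> by simp
  moreover have "?S \<inter> ball x t \<subseteq> U" by (auto simp: U_def)
  ultimately show "\<exists>t>0. t \<le> r \<and> (\<exists>U. ?S \<inter> ball x t \<subseteq> U \<and> U \<in> lmeasurable \<and> measure lebesgue U < e * measure lebesgue (ball x t))"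
    using t Ulm by (intro exI[of _ t]) auto
qed

text \<open>If the bound fails at a point with some excess, then for a \<open>\<delta>\<close> below a third of the excess and a
  \<open>d\<close> within \<open>\<delta>\<close> of the value of \<open>b\<close> the point lies in one of the negligible sets above; countably many
  choices of \<open>d\<close> and \<open>\<delta>\<close> suffice.\<close>

lemma AE_center_dyadic:
  "AE x in lebesgue. \<forall>m. norm (b x - c x (2 powi m)) \<le> K2 * w x * V x (2 powi m) powr \<alpha>"
proof -
  obtain S :: "'b set" where S: "countable S" "\<And>X. open X \<Longrightarrow> X \<noteq> {} \<Longrightarrow> \<exists>d\<in>S. d \<in> X"
    by (rule countable_dense_setE) blast
  define bad where "bad m d k = {x. good x \<and> norm (b x - d) < 1 / real (Suc k) \<and> K2 * w x * V x (2 powi m) powr \<alpha> + 3 * (1 / real (Suc k)) < norm (b x - c x (2 powi m))}"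
    for m :: int and d k
  have "AE x in lebesgue. x \<notin> bad m d k" for m d k
  proof (rule AE_not_in)
    show "bad m d k \<in> null_sets lebesgue"
      unfolding bad_def negligible_iff_null_sets[symmetric] by (rule negligible_far_from_centers) simp
  qed
  then have "AE x in lebesgue. \<forall>d\<in>S. x \<notin> bad m d k" for m k by (intro AE_ball_countable' S(1))
  then have "AE x in lebesgue. \<forall>m k. \<forall>d\<in>S. x \<notin> bad m d k" unfolding AE_all_countable by blast
  with AE_good show ?thesis
  proof eventually_elim
    case (elim x)
    show ?case
    proof (rule allI, rule ccontr)
      fix m :: int
      let ?e = "norm (b x - c x (2 powi m)) - K2 * w x * V x (2 powi m) powr \<alpha>"
      assume "\<not> norm (b x - c x (2 powi m)) \<le> K2 * w x * V x (2 powi m) powr \<alpha>"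
      then have "0 < ?e / 3" by simp
      then obtain k where k: "1 / real (Suc k) < ?e / 3" using reals_Archimedean[of "?e / 3"] by (auto simp: inverse_eq_divide)
      obtain d where d: "d \<in> S" "d \<in> ball (b x) (1 / real (Suc k))" using S(2)[of "ball (b x) (1 / real (Suc k))"] by auto
      then have "x \<in> bad m d k" using k elim(1) by (simp add: bad_def dist_norm)
      then show False using elim(2) d(1) by blast
    qed
  qed
qed

text \<open>Both values are compared with a centre: \<open>b x\<close> with that of the ball of radius \<open>2 powi (k + 1)\<close> about
  \<open>x\<close>, and \<open>b y\<close> with that of the ball of radius \<open>2 powi k\<close> about \<open>y\<close>, which lies inside the former.
  The predicate \<open>P\<close> describes the complement of one null set, so that later arguments can fix a point \<open>x\<close> and
  use the bound for all \<open>y\<close> satisfying \<open>P\<close>.\<close>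

lemma pointwise_lipschitz:
  obtains K P where "0 < K" "AE x in lebesgue. P x" "\<And>x. P x \<Longrightarrow> good x"
    "\<And>x y k. P x \<Longrightarrow> P y \<Longrightarrow> dist x y \<le> 2 powi k \<Longrightarrow> norm (b x - b y) \<le> K * (w x + w y) * V x (2 powi k) powr \<alpha>"
proof -
  define D where "D = A * 2 ^ CARD('n) / unit_ball_vol (real CARD('n))"
  define P where "P x \<longleftrightarrow> good x \<and> (\<forall>m. norm (b x - c x (2 powi m)) \<le> K2 * w x * V x (2 powi m) powr \<alpha>)" for x
  have D0: "0 < D" using A_pos by (simp add: D_def)
  show ?thesis
  proof (rule that[of "(K1 + K2) * D powr \<alpha>" P])
    show "0 < (K1 + K2) * D powr \<alpha>" using K_pos D0 by simp
    show "AE x in lebesgue. P x" using AE_good AE_center_dyadic by eventually_elim (simp add: P_def)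
    show "good x" if "P x" for x using that by (simp add: P_def)
    fix x y and k :: int
    assume P: "P x" "P y" and d: "dist x y \<le> 2 powi k"
    have w0: "0 < w x" "0 < w y" using P by (auto simp: P_def good_def)
    have two: "2 powi (k + 1) = 2 * (2::real) powi k" by (simp add: power_int_add)
    have sub: "cball y (2 powi k) \<subseteq> cball x (2 powi (k + 1))"
    proof
      fix z assume "z \<in> cball y (2 powi k)"
      then show "z \<in> cball x (2 powi (k + 1))" using d dist_triangle[of x z y] two by simp
    qed
    let ?v = "V x (2 powi (k + 1)) powr \<alpha>"
    have "norm (b x - b y) \<le> norm (b x - c x (2 powi (k + 1))) + norm (c x (2 powi (k + 1)) - c y (2 powi k)) + norm (b y - c y (2 powi k))"
      using norm_triangle_ineq[of "b x - c x (2 powi (k + 1))" "c x (2 powi (k + 1)) - c y (2 powi k)"]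
        norm_triangle_ineq4[of "b x - c y (2 powi k)" "b y - c y (2 powi k)"] by simp
    also have "\<dots> \<le> K2 * w x * ?v + K1 * w x * ?v + K2 * w y * ?v"
    proof (intro add_mono)
      show "norm (b x - c x (2 powi (k + 1))) \<le> K2 * w x * ?v" using P(1) unfolding P_def by blast
      show "norm (c x (2 powi (k + 1)) - c y (2 powi k)) \<le> K1 * w x * ?v"
        using P(1) two by (intro center_diff sub) (auto simp: P_def)
      have "norm (b y - c y (2 powi k)) \<le> K2 * w y * V y (2 powi k) powr \<alpha>" using P(2) unfolding P_def by blast
      also have "\<dots> \<le> K2 * w y * ?v"
        using K_pos w0 V_mono[OF sub] \<alpha> by (intro mult_left_mono powr_mono2) auto
      finally show "norm (b y - c y (2 powi k)) \<le> K2 * w y * ?v" .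
    qed
    also have "\<dots> \<le> (K1 + K2) * (w x + w y) * ?v"
      using K_pos w0 by (simp add: algebra_simps add_increasing)
    also have "\<dots> \<le> (K1 + K2) * (w x + w y) * (D * V x (2 powi k)) powr \<alpha>"
      using K_pos w0 \<alpha> V_dyadic_doubling[of x k] unfolding D_def by (intro mult_left_mono powr_mono2) auto
    also have "\<dots> = (K1 + K2) * D powr \<alpha> * (w x + w y) * V x (2 powi k) powr \<alpha>"
      by (simp add: powr_mult)
    finally show "norm (b x - b y) \<le> (K1 + K2) * D powr \<alpha> * (w x + w y) * V x (2 powi k) powr \<alpha>" .
  qed
qed

end

section \<open>The commutator kernel\<close>

lemma measurable_AE_eq_lebesgue:
  fixes f :: "'a::euclidean_space \<Rightarrow> 'b::topological_space"
  assumes g: "g \<in> borel_measurable lebesgue" and eq: "AE x in lebesgue. f x = g x"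
  shows "f \<in> borel_measurable lebesgue"
proof (rule measurableI)
  fix X :: "'b set" assume X: "X \<in> sets borel"
  obtain N where N: "N \<in> null_sets lebesgue" "{x \<in> space lebesgue. f x \<noteq> g x} \<subseteq> N"
    using eq unfolding eventually_ae_filter by auto
  have "f -` X \<inter> space lebesgue = (g -` X \<inter> space lebesgue - N) \<union> (N \<inter> f -` X)" using N(2) by auto
  moreover have "g -` X \<inter> space lebesgue \<in> sets lebesgue" by (rule measurable_sets[OF g X])
  moreover have "N \<inter> f -` X \<in> sets lebesgue"
    using N(1) by (meson Int_lower1 completion.complete2 null_setsD2)
  ultimately show "f -` X \<inter> space lebesgue \<in> sets lebesgue"
    using null_setsD2[OF N(1)] by (metis sets.Diff sets.Un)
qed simp

lemma sigma_finite_lebesgue: "sigma_finite_measure (lebesgue :: 'a::euclidean_space measure)"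
proof
  show "\<exists>A. countable A \<and> A \<subseteq> sets lebesgue \<and> \<Union> A = space lebesgue \<and> (\<forall>a\<in>A. emeasure (lebesgue :: 'a measure) a \<noteq> \<infinity>)"
  proof (intro exI[of _ "range (\<lambda>n::nat. cball 0 (real n))"] conjI ballI)
    show "\<Union> (range (\<lambda>n::nat. cball (0::'a) (real n))) = space lebesgue"
      by (auto intro: real_arch_simple)
    show "emeasure lebesgue a \<noteq> \<infinity>" if "a \<in> range (\<lambda>n::nat. cball (0::'a) (real n))" for a
      using that by (auto simp: emeasure_cball)
  qed auto
qed

text \<open>The smoothness condition makes \<open>K\<close> continuous away from the origin.\<close>

lemma kernel_measurable:
  fixes K :: "real^'n \<Rightarrow> 'b::real_normed_vector"
  assumes "\<And>x y. 0 < norm y \<Longrightarrow> 2 * norm y \<le> norm x \<Longrightarrow> norm (K (x - y) - K x) \<le> C * norm y / norm x ^ (CARD('n) + 1)"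
  shows "K \<in> borel_measurable borel"
proof -
  have "isCont K x" if x: "x \<noteq> 0" for x
  proof -
    let ?M = "C / norm x ^ (CARD('n) + 1)"
    have "((\<lambda>z. K z - K x) \<longlongrightarrow> 0) (at x)"
    proof (rule Lim_null_comparison)
      have "\<forall>\<^sub>F z in at x. dist z x < norm x / 2" using x by (auto simp: eventually_at intro!: exI[of _ "norm x / 2"])
      moreover have "\<forall>\<^sub>F z in at x. z \<noteq> x" by (simp add: eventually_at_filter)
      ultimately show "\<forall>\<^sub>F z in at x. norm (K z - K x) \<le> ?M * norm (x - z)"
      proof eventually_elim
        case (elim z)
        then show ?case using assms[of "x - z" x] by (simp add: dist_norm norm_minus_commute)
      qed
      have "((\<lambda>z. ?M * norm (x - z)) \<longlongrightarrow> ?M * norm (x - x)) (at x)" by (intro tendsto_intros)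
      then show "((\<lambda>z. ?M * norm (x - z)) \<longlongrightarrow> 0) (at x)" by simp
    qed
    then show ?thesis by (simp add: isCont_def LIM_zero_iff)
  qed
  then have "continuous_on (- {0}) K" by (simp add: continuous_at_imp_continuous_on)
  then have "(\<lambda>x. if x \<in> - {0} then K x else K 0) \<in> borel_measurable borel"
    by (intro borel_measurable_continuous_on_if) auto
  moreover have "(\<lambda>x. if x \<in> - {0} then K x else K 0) = K" by auto
  ultimately show ?thesis by simp
qed

locale lipschitz_kernel = lipschitz_oscillation w A b c L \<alpha>
  for w :: "real^'n \<Rightarrow> real" and A
    and b :: "real^'n \<Rightarrow> 'b::{real_normed_field, banach, second_countable_topology}" and c L \<alpha> +
  fixes K :: "real^'n \<Rightarrow> 'b" and CK CL :: real and P :: "real^'n \<Rightarrow> bool"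
  assumes K_measurable[measurable]: "K \<in> borel_measurable borel"
    and CK: "0 < CK" and CL: "0 < CL"
    and K_size: "x \<noteq> 0 \<Longrightarrow> norm (K x) \<le> CK / norm x ^ CARD('n)"
    and AE_P: "AE x in lebesgue. P x" and P_good: "P x \<Longrightarrow> good x"
    and b_lipschitz: "P x \<Longrightarrow> P y \<Longrightarrow> dist x y \<le> 2 powi k \<Longrightarrow>
       norm (b x - b y) \<le> CL * (w x + w y) * V x (2 powi k) powr \<alpha>"
begin

text \<open>The constants of the bounds for \<open>K\<close> and for the commutator kernel in \<open>kernel_bounds\<close>.\<close>

definition "M1 = CK * 2 ^ CARD('n) * A"
definition "M2 = 2 * CL * M1"

lemma M_pos: "0 < M1" "0 < M2" using CK CL A_pos by (auto simp: M1_def M2_def)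

text \<open>For \<open>z\<close> equal to \<open>x\<close> or \<open>y\<close>, the \<open>A\<^sub>1\<close> condition at \<open>z\<close> bounds \<open>(2 powi k) powr (- n)\<close> by
  \<open>A * w z / V x (2 powi k)\<close>. In the product of the Lipschitz bound with the size of \<open>K\<close> this is used with
  \<open>z = y\<close> for the summand containing \<open>w x\<close> and with \<open>z = x\<close> for the one containing \<open>w y\<close>, so that both become
  multiples of \<open>w x * w y\<close>.\<close>

lemma kernel_bounds:
  assumes x: "P x" and y: "P y" and xy: "x \<noteq> y"
  obtains k :: int where "dist x y \<le> 2 powi k"
    "norm (K (x - y)) \<le> M1 * w y / V x (2 powi k)"
    "norm ((b x - b y) * K (x - y)) \<le> M2 * w x * (V x (2 powi k) powr (\<alpha> - 1) * w y)"
proof -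
  obtain k where k: "dist x y \<le> 2 powi k" "2 powi k < 2 * dist x y" using dyadic_radius[of "dist x y"] xy by auto
  let ?v = "V x (2 powi k)" and ?n = "CARD('n)"
  have v: "0 < ?v" by (rule V_dyadic_pos)
  have w0: "0 < w x" "0 < w y" using P_good x y by (auto simp: good_def)
  have "norm (K (x - y)) \<le> CK / dist x y ^ ?n" using K_size[of "x - y"] xy by (simp add: dist_norm)
  also have "\<dots> \<le> CK / (2 powi k / 2) ^ ?n"
    using CK k by (intro divide_left_mono power_mono mult_pos_pos) (use xy in auto)
  finally have K: "norm (K (x - y)) \<le> CK * 2 ^ ?n / (2 powi k) ^ ?n" by (simp add: power_divide)
  have inv: "1 / (2 powi k) ^ ?n \<le> A * w z / ?v" if "good z" "z \<in> cball x (2 powi k)" for z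
  proof -
    have "?v \<le> A * (2 powi k) ^ ?n * w z" using that unfolding good_def by simp
    then show ?thesis using v by (simp add: field_simps)
  qed
  have Kz: "norm (K (x - y)) \<le> M1 * w z / ?v" if "good z" "z \<in> cball x (2 powi k)" for z
  proof -
    have "norm (K (x - y)) \<le> CK * 2 ^ ?n * (1 / (2 powi k) ^ ?n)" using K by simp
    also have "\<dots> \<le> CK * 2 ^ ?n * (A * w z / ?v)" using CK by (intro mult_left_mono inv that) auto
    finally show ?thesis by (simp add: M1_def)
  qed
  have Ky: "norm (K (x - y)) \<le> M1 * w y / ?v" using k P_good y by (intro Kz) auto
  have Kx: "norm (K (x - y)) \<le> M1 * w x / ?v" using k P_good x by (intro Kz) auto
  have "norm ((b x - b y) * K (x - y)) \<le> (CL * (w x + w y) * ?v powr \<alpha>) * norm (K (x - y))"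
    unfolding norm_mult by (intro mult_right_mono b_lipschitz x y k) auto
  also have "\<dots> = CL * ?v powr \<alpha> * (w x * norm (K (x - y)) + w y * norm (K (x - y)))" by (simp add: algebra_simps)
  also have "\<dots> \<le> CL * ?v powr \<alpha> * (w x * (M1 * w y / ?v) + w y * (M1 * w x / ?v))"
    using CL w0 by (intro mult_left_mono add_mono Kx Ky) auto
  also have "\<dots> = M2 * w x * (?v powr (\<alpha> - 1) * w y)"
    using v by (simp add: M2_def powr_diff field_simps)
  finally show ?thesis using that k Ky by blast
qed

text \<open>One term of the dyadic sum that defines the fractional integral is enough at each point \<open>y\<close>.\<close>

lemma nn_integral_le_fractional:
  assumes g[measurable]: "g \<in> borel_measurable lebesgue" and g0: "\<And>y. 0 \<le> g y"
    and M: "0 \<le> M"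
    and F: "AE y in lebesgue. \<exists>k. dist x y \<le> 2 powi k \<and> F y \<le> ennreal (M * (V x (2 powi k) powr (\<alpha> - 1) * w y) * g y)"
  shows "(\<integral>\<^sup>+y. F y \<partial>lebesgue) \<le> ennreal M * fractional \<alpha> g x"
proof -
  let ?t = "\<lambda>k y. ennreal (M * V x (2 powi k) powr (\<alpha> - 1)) * (ennreal (w y) * (ennreal (g y) * indicator (cball x (2 powi k)) y))"
  have [measurable]: "cball z r \<in> sets lebesgue" for z :: "real^'n" and r by simp
  have "(\<integral>\<^sup>+y. F y \<partial>lebesgue) \<le> (\<integral>\<^sup>+y. \<integral>\<^sup>+k. ?t k y \<partial>count_space (UNIV::int set) \<partial>lebesgue)"
  proof (rule nn_integral_mono_AE, use F w_pos in eventually_elim)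
    case (elim y)
    then obtain k where k: "dist x y \<le> 2 powi k" "F y \<le> ennreal (M * (V x (2 powi k) powr (\<alpha> - 1) * w y) * g y)" by blast
    have "M * (V x (2 powi k) powr (\<alpha> - 1) * w y) * g y = M * V x (2 powi k) powr (\<alpha> - 1) * (w y * g y)" by simp
    also have "ennreal \<dots> = ennreal (M * V x (2 powi k) powr (\<alpha> - 1)) * ennreal (w y * g y)" using M by (intro ennreal_mult') auto
    also have "ennreal (w y * g y) = ennreal (w y) * ennreal (g y)" using elim by (intro ennreal_mult') auto
    also have "ennreal (M * V x (2 powi k) powr (\<alpha> - 1)) * (ennreal (w y) * ennreal (g y)) = ?t k y" using k by (simp add: indicator_def)
    also have "\<dots> \<le> (\<integral>\<^sup>+k. ?t k y \<partial>count_space (UNIV::int set))" by (rule nn_integral_ge_point) simp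
    finally show ?case using k(2) by (rule order_trans[rotated])
  qed
  also have "\<dots> = (\<integral>\<^sup>+k. \<integral>\<^sup>+y. ?t k y \<partial>lebesgue \<partial>count_space (UNIV::int set))"
    by (rule nn_integral_count_space_nn_integral) auto
  also have "\<dots> = (\<integral>\<^sup>+k. ennreal M * (ennreal (V x (2 powi k) powr (\<alpha> - 1)) * (\<integral>\<^sup>+y. ennreal (g y) * indicator (cball x (2 powi k)) y \<partial>wm w)) \<partial>count_space (UNIV::int set))"
  proof (rule nn_integral_cong)
    fix k :: int
    have "(\<integral>\<^sup>+y. ?t k y \<partial>lebesgue) = ennreal (M * V x (2 powi k) powr (\<alpha> - 1)) * (\<integral>\<^sup>+y. ennreal (w y) * (ennreal (g y) * indicator (cball x (2 powi k)) y) \<partial>lebesgue)"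
      by (rule nn_integral_cmult) measurable
    also have "(\<integral>\<^sup>+y. ennreal (w y) * (ennreal (g y) * indicator (cball x (2 powi k)) y) \<partial>lebesgue) = (\<integral>\<^sup>+y. ennreal (g y) * indicator (cball x (2 powi k)) y \<partial>wm w)"
      by (rule nn_integral_wm[symmetric]) measurable
    finally show "(\<integral>\<^sup>+y. ?t k y \<partial>lebesgue) = ennreal M * (ennreal (V x (2 powi k) powr (\<alpha> - 1)) * (\<integral>\<^sup>+y. ennreal (g y) * indicator (cball x (2 powi k)) y \<partial>wm w))"
      using M by (simp add: ennreal_mult' mult.assoc)
  qed
  also have "\<dots> = ennreal M * fractional \<alpha> g x" unfolding fractional_def by (rule nn_integral_cmult) simp
  finally show ?thesis .
qed

lemma AE_neq: "AE y in lebesgue. y \<noteq> x" for x :: "real^'n"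
  by (rule AE_I'[of "{x}"]) (auto simp flip: negligible_iff_null_sets)

lemma commutator_kernel_integral_le:
  assumes f[measurable]: "f \<in> borel_measurable lebesgue" and x: "P x"
  shows "(\<integral>\<^sup>+y. ennreal (norm ((b x - b y) * (K (x - y) * f y))) \<partial>lebesgue) \<le> ennreal (M2 * w x) * fractional \<alpha> (\<lambda>y. norm (f y)) x"
proof (rule nn_integral_le_fractional)
  show "0 \<le> M2 * w x" using M_pos P_good[OF x] by (simp add: good_def)
  show "AE y in lebesgue. \<exists>k. dist x y \<le> 2 powi k \<and> ennreal (norm ((b x - b y) * (K (x - y) * f y)))
      \<le> ennreal (M2 * w x * (V x (2 powi k) powr (\<alpha> - 1) * w y) * norm (f y))"
    using AE_P AE_neq[of x]
  proof eventually_elim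
    case (elim y)
    obtain k where k: "dist x y \<le> 2 powi k" "norm ((b x - b y) * K (x - y)) \<le> M2 * w x * (V x (2 powi k) powr (\<alpha> - 1) * w y)"
      using kernel_bounds[OF x elim(1)] elim(2) by metis
    have "norm ((b x - b y) * (K (x - y) * f y)) = norm ((b x - b y) * K (x - y)) * norm (f y)" by (simp add: norm_mult)
    also have "\<dots> \<le> M2 * w x * (V x (2 powi k) powr (\<alpha> - 1) * w y) * norm (f y)" by (intro mult_right_mono k) simp
    finally show ?case using k(1) by (auto intro: ennreal_leI)
  qed
qed auto

text \<open>Off the ball of radius \<open>\<epsilon>\<close> the kernel \<open>w y / V\<close> is at most \<open>V x \<epsilon> powr (- \<alpha>)\<close> times
  \<open>V powr (\<alpha> - 1) * w y\<close>, so the truncated integrals of \<open>f\<close> are controlled by the same fractional integral as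
  the commutator.\<close>

lemma truncated_kernel_integral_le:
  assumes f[measurable]: "f \<in> borel_measurable lebesgue" and x: "P x" and \<epsilon>: "0 < \<epsilon>"
  shows "(\<integral>\<^sup>+y. ennreal (norm (K (x - y) * f y)) * indicator {y. \<epsilon> < norm (x - y)} y \<partial>lebesgue)
    \<le> ennreal (M1 * V x \<epsilon> powr (- \<alpha>)) * fractional \<alpha> (\<lambda>y. norm (f y)) x"
proof (rule nn_integral_le_fractional)
  show "0 \<le> M1 * V x \<epsilon> powr (- \<alpha>)" using M_pos by simp
  show "AE y in lebesgue. \<exists>k. dist x y \<le> 2 powi k \<and> ennreal (norm (K (x - y) * f y)) * indicator {y. \<epsilon> < norm (x - y)} y
      \<le> ennreal (M1 * V x \<epsilon> powr (- \<alpha>) * (V x (2 powi k) powr (\<alpha> - 1) * w y) * norm (f y))"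
    using AE_P AE_neq[of x]
  proof eventually_elim
    case (elim y)
    have wy: "0 < w y" using P_good[OF elim(1)] by (simp add: good_def)
    obtain k where k: "dist x y \<le> 2 powi k" "norm (K (x - y)) \<le> M1 * w y / V x (2 powi k)"
      using kernel_bounds[OF x elim(1)] elim(2) by metis
    let ?v = "V x (2 powi k)"
    have v: "0 < ?v" by (rule V_dyadic_pos)
    have "ennreal (norm (K (x - y) * f y)) \<le> ennreal (M1 * V x \<epsilon> powr (- \<alpha>) * (?v powr (\<alpha> - 1) * w y) * norm (f y))" if far: "\<epsilon> < norm (x - y)"
    proof (rule ennreal_leI)
      have "V x \<epsilon> \<le> ?v" using far k(1) by (intro V_mono subset_cball) (auto simp: dist_norm)
      then have "?v powr (- \<alpha>) \<le> V x \<epsilon> powr (- \<alpha>)" using measure_cball_pos[OF \<epsilon>] \<alpha> by (intro powr_mono2') auto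
      moreover have "1 / ?v = ?v powr (- \<alpha>) * ?v powr (\<alpha> - 1)" using v by (subst powr_add[symmetric]) (simp add: powr_minus_divide)
      ultimately have le: "1 / ?v \<le> V x \<epsilon> powr (- \<alpha>) * ?v powr (\<alpha> - 1)" by (simp add: mult_right_mono)
      have "norm (K (x - y) * f y) = norm (K (x - y)) * norm (f y)" by (rule norm_mult)
      also have "\<dots> \<le> (M1 * w y * (1 / ?v)) * norm (f y)" using k(2) by (intro mult_right_mono) auto
      also have "\<dots> \<le> (M1 * w y * (V x \<epsilon> powr (- \<alpha>) * ?v powr (\<alpha> - 1))) * norm (f y)"
        using M_pos wy by (intro mult_right_mono mult_left_mono le) auto
      finally show "norm (K (x - y) * f y) \<le> M1 * V x \<epsilon> powr (- \<alpha>) * (?v powr (\<alpha> - 1) * w y) * norm (f y)" by (simp add: mult_ac)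
    qed
    then show ?case using k(1) by (intro exI[of _ k]) (auto simp: indicator_def)
  qed
qed auto

lemma kernel_translate_measurable[measurable]: "(\<lambda>y. K (x - y)) \<in> borel_measurable lebesgue"
  by (rule measurable_completion) simp

lemma truncation_sets[measurable]: "{y. \<epsilon> < norm (x - y)} \<in> sets lebesgue" for x :: "real^'n"
proof -
  have "open {y. \<epsilon> < norm (x - y)}" by (intro open_Collect_less continuous_intros)
  then show ?thesis by simp
qed

lemma truncated_integrable:
  assumes f[measurable]: "f \<in> borel_measurable lebesgue" and x: "P x" and \<epsilon>: "0 < \<epsilon>"
    and fin: "fractional \<alpha> (\<lambda>y. norm (f y)) x < \<infinity>"
  shows "set_integrable lebesgue {y. \<epsilon> < norm (x - y)} (\<lambda>y. K (x - y) * f y)"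
    and "set_integrable lebesgue {y. \<epsilon> < norm (x - y)} (\<lambda>y. (b x - b y) * (K (x - y) * f y))"
    and "set_integrable lebesgue {y. \<epsilon> < norm (x - y)} (\<lambda>y. K (x - y) * (b y * f y))"
proof -
  let ?U = "{y. \<epsilon> < norm (x - y)}"
  show 1: "set_integrable lebesgue ?U (\<lambda>y. K (x - y) * f y)"
    unfolding set_integrable_def
  proof (rule integrableI_bounded)
    have "(\<integral>\<^sup>+y. ennreal (norm (indicat_real ?U y *\<^sub>R (K (x - y) * f y))) \<partial>lebesgue) = (\<integral>\<^sup>+y. ennreal (norm (K (x - y) * f y)) * indicator ?U y \<partial>lebesgue)"
      by (intro nn_integral_cong) (auto simp: indicator_def)
    also have "\<dots> < \<infinity>" using fin by (intro le_less_trans[OF truncated_kernel_integral_le[OF f x \<epsilon>]]) (simp add: ennreal_mult_less_top)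
    finally show "(\<integral>\<^sup>+y. ennreal (norm (indicat_real ?U y *\<^sub>R (K (x - y) * f y))) \<partial>lebesgue) < \<infinity>" .
  qed measurable
  show 2: "set_integrable lebesgue ?U (\<lambda>y. (b x - b y) * (K (x - y) * f y))"
    unfolding set_integrable_def
  proof (rule integrableI_bounded)
    have "(\<integral>\<^sup>+y. ennreal (norm (indicat_real ?U y *\<^sub>R ((b x - b y) * (K (x - y) * f y)))) \<partial>lebesgue) \<le> (\<integral>\<^sup>+y. ennreal (norm ((b x - b y) * (K (x - y) * f y))) \<partial>lebesgue)"
      by (intro nn_integral_mono) (auto simp: indicator_def)
    also have "\<dots> < \<infinity>" using fin by (intro le_less_trans[OF commutator_kernel_integral_le[OF f x]]) (simp add: ennreal_mult_less_top)
    finally show "(\<integral>\<^sup>+y. ennreal (norm (indicat_real ?U y *\<^sub>R ((b x - b y) * (K (x - y) * f y)))) \<partial>lebesgue) < \<infinity>" .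
  qed measurable
  have "set_integrable lebesgue ?U (\<lambda>y. b x * (K (x - y) * f y) - (b x - b y) * (K (x - y) * f y))"
    using 1 2 by (intro set_integral_diff) auto
  moreover have "b x * (K (x - y) * f y) - (b x - b y) * (K (x - y) * f y) = K (x - y) * (b y * f y)" for y
    by (simp add: algebra_simps)
  ultimately show "set_integrable lebesgue ?U (\<lambda>y. K (x - y) * (b y * f y))" by simp
qed

lemma truncated_measurable:
  assumes f[measurable]: "f \<in> borel_measurable lebesgue"
  shows "(\<lambda>x. LINT y:{y. \<epsilon> < norm (x - y)}|lebesgue. K (x - y) * f y) \<in> borel_measurable lebesgue"
proof -
  interpret L: sigma_finite_measure "lebesgue :: (real^'n) measure" by (rule sigma_finite_lebesgue)
  have [measurable]: "fst \<in> borel_measurable (lebesgue \<Otimes>\<^sub>M (lebesgue :: (real^'n) measure))" "snd \<in> borel_measurable ((lebesgue :: (real^'n) measure) \<Otimes>\<^sub>M lebesgue)"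
    using measurable_compose[OF measurable_fst measurable_completion[OF measurable_ident_sets[OF sets_lborel]], of lebesgue]
      measurable_compose[OF measurable_snd measurable_completion[OF measurable_ident_sets[OF sets_lborel]], of lebesgue] by simp_all
  have [measurable]: "(\<lambda>z. f (snd z)) \<in> borel_measurable (lebesgue \<Otimes>\<^sub>M lebesgue)" by (rule measurable_compose[OF measurable_snd f])
  have "(\<lambda>z. (if \<epsilon> < norm (fst z - snd z) then 1 else (0::real)) *\<^sub>R (K (fst z - snd z) * f (snd z))) \<in> borel_measurable (lebesgue \<Otimes>\<^sub>M lebesgue)"
    by measurable
  then have "(\<lambda>x. \<integral>y. (if \<epsilon> < norm (x - y) then 1 else (0::real)) *\<^sub>R (K (x - y) * f y) \<partial>lebesgue) \<in> borel_measurable lebesgue"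
    by (intro L.borel_measurable_lebesgue_integral) (simp add: case_prod_beta')
  moreover have "(\<lambda>x. LINT y:{y. \<epsilon> < norm (x - y)}|lebesgue. K (x - y) * f y) = (\<lambda>x. \<integral>y. (if \<epsilon> < norm (x - y) then 1 else (0::real)) *\<^sub>R (K (x - y) * f y) \<partial>lebesgue)"
    unfolding set_lebesgue_integral_def by (intro ext Bochner_Integration.integral_cong) (auto simp: indicator_def)
  ultimately show ?thesis by simp
qed

end

section \<open>Principal values and the pointwise bound for the commutator\<close>

context pointwise_A1
begin

lemma cube_in_cball:
  assumes Q: "Q \<in> cubes"
  obtains x0 m where "Q \<subseteq> cball x0 (2 powi m)" "0 < wmeas w Q"
    "V x0 (2 powi m) \<le> A * (2 * real CARD('n)) ^ CARD('n) / unit_ball_vol (real CARD('n)) * wmeas w Q"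
proof -
  obtain a l where al: "Q = cbox a (a + l *\<^sub>R One)" "0 < l" using Q by (auto simp: cubes_def)
  define r where "r = l / 2"
  define x0 where "x0 = a + r *\<^sub>R One"
  have r: "0 < r" using al by (simp add: r_def)
  have Qe: "Q = cbox (x0 - r *\<^sub>R One) (x0 - r *\<^sub>R One + (2 * r) *\<^sub>R One)" using al by (simp add: x0_def r_def)
  note facts = cball_in_cube_measure[OF r Qe]
  obtain m where m: "real CARD('n) * r \<le> 2 powi m" "2 powi m < 2 * (real CARD('n) * r)"
    using dyadic_radius[of "real CARD('n) * r"] r by auto
  show ?thesis
  proof (rule that)
    have "Q \<subseteq> cball x0 (real CARD('n) * r)" unfolding Qe by (rule cube_subset_cball)
    also have "\<dots> \<subseteq> cball x0 (2 powi m)" using m by (intro subset_cball)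
    finally show "Q \<subseteq> cball x0 (2 powi m)" .
    show "0 < wmeas w Q" using facts(2) measure_cball_pos[OF r, of x0] by linarith
    have "V x0 (2 powi m) \<le> V x0 (2 * real CARD('n) * r)" using m by (intro V_mono subset_cball) auto
    also have "\<dots> \<le> A * (2 * real CARD('n)) ^ CARD('n) / unit_ball_vol (real CARD('n)) * V x0 r"
    proof (intro wm_cball_scale_le r)
      have "1 \<le> real CARD('n)" by (simp add: Suc_le_eq)
      then show "1 \<le> 2 * real CARD('n)" by linarith
    qed
    also have "\<dots> \<le> A * (2 * real CARD('n)) ^ CARD('n) / unit_ball_vol (real CARD('n)) * wmeas w Q"
      using A_pos facts(2) by (intro mult_left_mono) auto
    finally show "V x0 (2 powi m) \<le> A * (2 * real CARD('n)) ^ CARD('n) / unit_ball_vol (real CARD('n)) * wmeas w Q" .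
  qed
qed

lemma morrey_cball:
  fixes f :: "real^'n \<Rightarrow> 'b::{banach, second_countable_topology}"
  assumes f: "f \<in> morrey p \<kappa> w w" and N: "morrey_norm p \<kappa> w w f \<le> ereal N" "0 \<le> N" and p: "0 < p" and \<kappa>: "0 < \<kappa>" and r: "0 < r"
  shows "(\<integral>\<^sup>+y. ennreal (norm (f y) powr p) * indicator (cball x r) y \<partial>wm w)
    \<le> ennreal (N powr p * (A * real CARD('n) ^ CARD('n) / unit_ball_vol (real CARD('n)) * V x r) powr \<kappa>)"
proof -
  define Q where "Q = cbox (x - r *\<^sub>R One) (x - r *\<^sub>R One + (2 * r) *\<^sub>R One)"
  note facts = cball_in_cube_measure[OF r Q_def]
  have W: "0 < wmeas w Q" using facts(2) measure_cball_pos[OF r, of x] by linarith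
  have f_meas[measurable]: "f \<in> borel_measurable lebesgue" and fl: "locally_integrable (\<lambda>x. norm (f x) powr p * w x)"
    using f by (auto simp: morrey_def Lp_loc_def)
  have Qs[measurable]: "Q \<in> sets lebesgue" unfolding Q_def by simp
  define I where "I = (LINT x:Q|lebesgue. norm (f x) powr p * w x)"
  have int: "set_integrable lebesgue Q (\<lambda>x. norm (f x) powr p * w x)"
    using fl compact_cube[OF facts(3)] by (simp add: locally_integrable_def)
  have I0: "0 \<le> I" unfolding I_def set_lebesgue_integral_def
    using w_pos by (intro integral_nonneg_AE) (auto elim!: AE_mp)
  have "ereal ((1 / wmeas w Q powr \<kappa> * I) powr (1 / p)) \<le> morrey_norm p \<kappa> w w f"
    unfolding morrey_norm_def I_def using facts(3) by (rule SUP_upper)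
  from order_trans[OF this N(1)] have le: "(1 / wmeas w Q powr \<kappa> * I) powr (1 / p) \<le> N" by simp
  have "1 / wmeas w Q powr \<kappa> * I = ((1 / wmeas w Q powr \<kappa> * I) powr (1 / p)) powr p"
    using I0 p by (simp add: powr_powr)
  also have "\<dots> \<le> N powr p" using le p by (intro powr_mono2) auto
  finally have "I \<le> N powr p * wmeas w Q powr \<kappa>" using W by (simp add: field_simps)
  also have "\<dots> \<le> N powr p * (A * real CARD('n) ^ CARD('n) / unit_ball_vol (real CARD('n)) * V x r) powr \<kappa>"
    using facts(1) W \<kappa> by (intro mult_left_mono powr_mono2) auto
  finally have Ile: "I \<le> N powr p * (A * real CARD('n) ^ CARD('n) / unit_ball_vol (real CARD('n)) * V x r) powr \<kappa>" .
  have "(\<integral>\<^sup>+y. ennreal (norm (f y) powr p) * indicator (cball x r) y \<partial>wm w) \<le> (\<integral>\<^sup>+y. ennreal (norm (f y) powr p) * indicator Q y \<partial>wm w)"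
    using facts(4) by (intro nn_integral_mono) (auto simp: indicator_def)
  also have "\<dots> = (\<integral>\<^sup>+y. ennreal (w y) * (ennreal (norm (f y) powr p) * indicator Q y) \<partial>lebesgue)"
    by (rule nn_integral_wm) measurable
  also have "\<dots> = (\<integral>\<^sup>+y. ennreal (norm (f y) powr p * w y) * indicator Q y \<partial>lebesgue)"
    by (rule nn_integral_cong) (simp add: ennreal_mult'' mult_ac)
  also have "\<dots> = ennreal I" unfolding I_def
    by (rule nn_integral_set_integral[OF int]) (use w_pos in eventually_elim, simp)
  finally show ?thesis using Ile by (meson ennreal_leI order_trans)
qed

end

context lipschitz_kernel
begin

lemma obtain_P: obtains x0 where "P x0"
proof (rule ccontr)
  assume "\<not> thesis"
  then have "\<not> P x" for x using that by blast
  then have "AE x in (lebesgue :: (real^'n) measure). False" using AE_P by simp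
  then have "UNIV \<in> null_sets (lebesgue :: (real^'n) measure)" by (simp add: AE_iff_null)
  then have "emeasure (lebesgue :: (real^'n) measure) UNIV = 0" by (rule null_setsD1)
  then show False by simp
qed

lemma set_integrable_of_weighted_bound:
  fixes h :: "real^'n \<Rightarrow> 'c::{banach, second_countable_topology}"
  assumes h[measurable]: "h \<in> borel_measurable lebesgue" and g[measurable]: "g \<in> borel_measurable lebesgue"
    and S: "S \<in> sets lebesgue" "S \<subseteq> B" and B[measurable]: "B \<in> sets lebesgue" and M: "0 \<le> M"
    and fin: "(\<integral>\<^sup>+y. ennreal (g y) * indicator B y \<partial>wm w) < \<infinity>"
    and le: "AE y in lebesgue. y \<in> B \<longrightarrow> norm (h y) \<le> M * w y * g y"
  shows "set_integrable lebesgue S h"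
  unfolding set_integrable_def
proof (rule integrableI_bounded)
  note S(1)[measurable]
  show "(\<lambda>x. indicat_real S x *\<^sub>R h x) \<in> borel_measurable lebesgue" by measurable
  have "(\<integral>\<^sup>+y. ennreal (norm (indicat_real S y *\<^sub>R h y)) \<partial>lebesgue) \<le> (\<integral>\<^sup>+y. ennreal M * (ennreal (w y) * (ennreal (g y) * indicator B y)) \<partial>lebesgue)"
  proof (rule nn_integral_mono_AE, use le w_pos in eventually_elim)
    case (elim y)
    show ?case
    proof (cases "y \<in> S")
      case True
      then have "ennreal (norm (h y)) \<le> ennreal (M * (w y * g y))" using elim S by (intro ennreal_leI) (auto simp: mult.assoc)
      also have "\<dots> = ennreal M * (ennreal (w y) * ennreal (g y))" using M elim by (simp add: ennreal_mult')
      finally show ?thesis using True S by (auto simp: indicator_def)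
    qed simp
  qed
  also have "\<dots> = ennreal M * (\<integral>\<^sup>+y. ennreal (w y) * (ennreal (g y) * indicator B y) \<partial>lebesgue)" by (rule nn_integral_cmult) measurable
  also have "(\<integral>\<^sup>+y. ennreal (w y) * (ennreal (g y) * indicator B y) \<partial>lebesgue) = (\<integral>\<^sup>+y. ennreal (g y) * indicator B y \<partial>wm w)"
    by (rule nn_integral_wm[symmetric]) measurable
  also have "ennreal M * \<dots> < \<infinity>" using fin by (simp add: ennreal_mult_less_top)
  finally show "(\<integral>\<^sup>+y. ennreal (norm (indicat_real S y *\<^sub>R h y)) \<partial>lebesgue) < \<infinity>" .
qed

text \<open>On a ball about a point \<open>x0\<close> that satisfies \<open>P\<close>, the \<open>A\<^sub>1\<close> condition bounds \<open>w\<close> below by a positive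
  constant, so constants are dominated by multiples of \<open>w\<close>. The Lipschitz bound relative to \<open>x0\<close> then shows that
  \<open>b\<close> is dominated by a multiple of \<open>w\<close>, too.\<close>

lemma locally_integrable_products:
  assumes f[measurable]: "f \<in> borel_measurable lebesgue"
    and fin: "\<And>x k. (\<integral>\<^sup>+y. ennreal (norm (f y)) * indicator (cball x (2 powi k)) y \<partial>wm w) < \<infinity>"
  shows "locally_integrable f" "locally_integrable (\<lambda>y. b y * f y)"
proof -
  have "set_integrable lebesgue S f \<and> set_integrable lebesgue S (\<lambda>y. b y * f y)" if S: "compact S" for S
  proof -
    obtain x0 where x0: "P x0" by (rule obtain_P)
    have "bounded S" using S by (rule compact_imp_bounded)
    then obtain R where R: "0 < R" "S \<subseteq> cball x0 R"
      using bounded_subset_ballD[of S x0] ball_subset_cball by blast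
    obtain m where m: "R \<le> 2 powi m" using dyadic_radius[OF R(1)] by blast
    define B where "B = cball x0 (2 powi m)"
    have SB: "S \<subseteq> B" using R m unfolding B_def by auto
    have Bs: "B \<in> sets lebesgue" by (simp add: B_def)
    have Ss: "S \<in> sets lebesgue" using S by (simp add: borel_compact)
    define v where "v = V x0 (2 powi m)"
    have v: "0 < v" unfolding v_def by (rule V_dyadic_pos)
    define M where "M = A * (2 powi m) ^ CARD('n) / v"
    have M: "0 \<le> M" using A_pos v by (simp add: M_def)
    have w0: "0 < w x0" using P_good[OF x0] by (simp add: good_def)
    define M' where "M' = norm (b x0) * M + CL * v powr \<alpha> * (w x0 * M + 1)"
    have M': "0 \<le> M'" using M w0 CL by (simp add: M'_def)
    have Mw: "1 \<le> M * w y" if "P y" "y \<in> B" for y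
    proof -
      have "v \<le> A * (2 powi m) ^ CARD('n) * w y" using P_good[OF that(1)] that(2) unfolding good_def v_def B_def by simp
      then show ?thesis using v by (simp add: M_def pos_le_divide_eq)
    qed
    have 1: "AE y in lebesgue. y \<in> B \<longrightarrow> norm (f y) \<le> M * w y * norm (f y)"
      using AE_P
    proof eventually_elim
      case (elim y)
      show ?case using mult_right_mono[OF Mw[OF elim], of "norm (f y)"] by auto
    qed
    have 2: "AE y in lebesgue. y \<in> B \<longrightarrow> norm (b y * f y) \<le> M' * w y * norm (f y)"
      using AE_P
    proof eventually_elim
      case (elim y)
      show ?case
      proof
        assume y: "y \<in> B"
        note 1 = Mw[OF elim y]
        have lip: "norm (b x0 - b y) \<le> CL * (w x0 + w y) * v powr \<alpha>"
          unfolding v_def using y by (intro b_lipschitz x0 elim) (simp add: B_def)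
        have "norm (b y) \<le> norm (b x0) + norm (b x0 - b y)" using norm_triangle_ineq4[of "b x0" "b x0 - b y"] by simp
        also have "\<dots> \<le> norm (b x0) + CL * (w x0 + w y) * v powr \<alpha>" using lip by simp
        also have "\<dots> = norm (b x0) * 1 + CL * v powr \<alpha> * (w x0 * 1 + w y)" by (simp add: algebra_simps)
        also have "\<dots> \<le> norm (b x0) * (M * w y) + CL * v powr \<alpha> * (w x0 * (M * w y) + w y)"
          using 1 w0 CL by (intro add_mono mult_left_mono add_right_mono) auto
        also have "\<dots> = M' * w y" by (simp add: M'_def algebra_simps)
        finally show "norm (b y * f y) \<le> M' * w y * norm (f y)" unfolding norm_mult by (intro mult_right_mono norm_ge_zero)
      qed
    qed
    have finB: "(\<integral>\<^sup>+y. ennreal (norm (f y)) * indicator B y \<partial>wm w) < \<infinity>" unfolding B_def by (rule fin)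
    show ?thesis
      using set_integrable_of_weighted_bound[OF f _ Ss SB Bs M finB 1] set_integrable_of_weighted_bound[OF _ _ Ss SB Bs M' finB 2] by simp
  qed
  then show "locally_integrable f" "locally_integrable (\<lambda>y. b y * f y)" by (auto simp: locally_integrable_def)
qed

text \<open>For each \<open>\<epsilon>\<close> the truncated integrals combine to one with the factor \<open>b x - b y\<close>, whose norm has a
  bound independent of \<open>\<epsilon>\<close>.\<close>

lemma commutator_pointwise:
  assumes f[measurable]: "f \<in> borel_measurable lebesgue" and x: "P x"
    and fin: "fractional \<alpha> (\<lambda>y. norm (f y)) x < \<infinity>"
    and pv: "has_pv K f x t1" "has_pv K (\<lambda>y. b y * f y) x t2"
  shows "ennreal (norm (b x * t1 - t2)) \<le> ennreal (M2 * w x) * fractional \<alpha> (\<lambda>y. norm (f y)) x"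
proof -
  let ?bd = "ennreal (M2 * w x) * fractional \<alpha> (\<lambda>y. norm (f y)) x"
  define F where "F \<epsilon> = b x * (LINT y:{y. \<epsilon> < norm (x - y)}|lebesgue. K (x - y) * f y)
      - (LINT y:{y. \<epsilon> < norm (x - y)}|lebesgue. K (x - y) * (b y * f y))" for \<epsilon>
  have lim: "(F \<longlongrightarrow> b x * t1 - t2) (at_right 0)"
    unfolding F_def[abs_def] using pv unfolding has_pv_def by (intro tendsto_intros)
  have "?bd < \<infinity>" using fin by (simp add: ennreal_mult_less_top)
  then obtain B where B: "?bd = ennreal B" "0 \<le> B" by (cases ?bd) auto
  have "norm (F \<epsilon>) \<le> B" if \<epsilon>: "0 < \<epsilon>" for \<epsilon>
  proof -
    let ?U = "{y. \<epsilon> < norm (x - y)}" and ?h = "\<lambda>y. (b x - b y) * (K (x - y) * f y)"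
    note ints = truncated_integrable[OF f x \<epsilon> fin]
    have "F \<epsilon> = (LINT y:?U|lebesgue. b x * (K (x - y) * f y)) - (LINT y:?U|lebesgue. K (x - y) * (b y * f y))"
      unfolding F_def by simp
    also have "\<dots> = (LINT y:?U|lebesgue. b x * (K (x - y) * f y) - K (x - y) * (b y * f y))"
      using ints by (intro set_integral_diff(2)[symmetric]) auto
    also have "\<dots> = (LINT y:?U|lebesgue. ?h y)"
      unfolding set_lebesgue_integral_def by (intro Bochner_Integration.integral_cong) (auto simp: algebra_simps)
    finally have "ennreal (norm (F \<epsilon>)) \<le> (\<integral>\<^sup>+y. ennreal (norm (indicat_real ?U y *\<^sub>R ?h y)) \<partial>lebesgue)"
      using ints(2) unfolding set_lebesgue_integral_def set_integrable_def by (simp add: integral_norm_bound_ennreal del: norm_scaleR)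
    also have "\<dots> \<le> (\<integral>\<^sup>+y. ennreal (norm (?h y)) \<partial>lebesgue)"
      by (intro nn_integral_mono) (auto simp: indicator_def)
    also have "\<dots> \<le> ?bd" by (rule commutator_kernel_integral_le[OF f x])
    finally show ?thesis using B by simp
  qed
  then have "\<forall>\<^sub>F \<epsilon> in at_right 0. norm (F \<epsilon>) \<le> B" by (auto simp: eventually_at_right_field intro!: exI[of _ 1])
  then have "norm (b x * t1 - t2) \<le> B"
    by (rule tendsto_upperbound[OF tendsto_norm[OF lim]]) simp
  then show ?thesis unfolding B(1) by (rule ennreal_leI)
qed

text \<open>Along \<open>\<epsilon> = 1 / (n + 1)\<close> the principal values exhibit the commutator as an almost everywhere limit of
  measurable functions.\<close>

lemma commutator_measurable:
  assumes f[measurable]: "f \<in> borel_measurable lebesgue"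
    and pv: "AE x in lebesgue. has_pv K f x (t1 x)" "AE x in lebesgue. has_pv K (\<lambda>y. b y * f y) x (t2 x)"
  shows "(\<lambda>x. b x * t1 x - t2 x) \<in> borel_measurable lebesgue"
proof -
  define F where "F n x = b x * (LINT y:{y. inverse (real (Suc n)) < norm (x - y)}|lebesgue. K (x - y) * f y)
      - (LINT y:{y. inverse (real (Suc n)) < norm (x - y)}|lebesgue. K (x - y) * (b y * f y))" for n x
  have [measurable]: "(\<lambda>x. LINT y:{y. \<epsilon> < norm (x - y)}|lebesgue. K (x - y) * f y) \<in> borel_measurable lebesgue"
    "(\<lambda>x. LINT y:{y. \<epsilon> < norm (x - y)}|lebesgue. K (x - y) * (b y * f y)) \<in> borel_measurable lebesgue" for \<epsilon>
    by (rule truncated_measurable, measurable)+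
  have [measurable]: "F n \<in> borel_measurable lebesgue" for n unfolding F_def[abs_def] by measurable
  have eps: "filterlim (\<lambda>n. inverse (real (Suc n))) (at_right 0) sequentially"
    by (intro filterlim_at_withinI LIMSEQ_inverse_real_of_nat) auto
  show ?thesis
  proof (rule measurable_AE_eq_lebesgue)
    show "(\<lambda>x. lim (\<lambda>n. F n x)) \<in> borel_measurable lebesgue" by measurable
    show "AE x in lebesgue. b x * t1 x - t2 x = lim (\<lambda>n. F n x)"
      using pv
    proof eventually_elim
      case (elim x)
      have "(\<lambda>n. F n x) \<longlonglongrightarrow> b x * t1 x - t2 x"
        unfolding F_def using elim unfolding has_pv_def
        by (intro tendsto_intros filterlim_compose[OF _ eps])
      then show ?case by (rule limI[symmetric])
    qed
  qed
qed

end

section \<open>The estimate on cubes\<close>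

context lipschitz_kernel
begin

lemma AE_fractional_finite:
  assumes G: "\<And>m::int. \<exists>G :: real^'n \<Rightarrow> real. AE x in wm w. x \<in> cball 0 (2 powi m) \<longrightarrow> fractional \<alpha> g x \<le> ennreal (G x)"
  shows "AE x in lebesgue. fractional \<alpha> g x < \<infinity>"
proof -
  have "AE x in lebesgue. x \<in> cball 0 (2 powi m) \<longrightarrow> fractional \<alpha> g x < \<infinity>" for m :: int
  proof -
    obtain G where "AE x in wm w. x \<in> cball 0 (2 powi m) \<longrightarrow> fractional \<alpha> g x \<le> ennreal (G x)" using G by blast
    then have "AE x in lebesgue. x \<in> cball 0 (2 powi m) \<longrightarrow> fractional \<alpha> g x \<le> ennreal (G x)"
      by (simp only: AE_wm_iff[OF weight])
    then show ?thesis by eventually_elim (auto intro: le_less_trans)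
  qed
  then have "AE x in lebesgue. \<forall>m::int. x \<in> cball 0 (2 powi m) \<longrightarrow> fractional \<alpha> g x < \<infinity>"
    unfolding AE_all_countable by blast
  then show ?thesis
  proof eventually_elim
    case (elim x)
    obtain m where "norm x + 1 \<le> 2 powi m" using dyadic_radius[of "norm x + 1"] norm_ge_zero[of x] by (metis add_nonneg_pos zero_less_one)
    then have "x \<in> cball 0 (2 powi m)" by simp
    then show ?case using elim by blast
  qed
qed

text \<open>The identity \<open>w powr s * w powr (1 - s) = w\<close> turns the pointwise bound with the factor \<open>w x\<close> into an
  integral for the measure \<open>w dx\<close>.\<close>

lemma set_integral_cube_le:
  fixes S :: "real^'n \<Rightarrow> 'b" and G :: "real^'n \<Rightarrow> real"
  assumes S[measurable]: "S \<in> borel_measurable lebesgue" and G[measurable]: "G \<in> borel_measurable lebesgue" and G0: "\<And>x. 0 \<le> G x"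
    and s: "0 < s" and Q: "Q \<in> cubes" "Q \<subseteq> B" and B[measurable]: "B \<in> sets lebesgue"
    and SG: "AE x in lebesgue. x \<in> B \<longrightarrow> norm (S x) \<le> M2 * w x * G x"
    and GI: "(\<integral>\<^sup>+x. ennreal (G x powr s) * indicator B x \<partial>wm w) \<le> ennreal I" and I: "0 \<le> I"
  shows "set_integrable lebesgue Q (\<lambda>x. norm (S x) powr s * w x powr (1 - s))"
    "(LINT x:Q|lebesgue. norm (S x) powr s * w x powr (1 - s)) \<le> M2 powr s * I"
proof -
  have [measurable]: "Q \<in> sets lebesgue" using compact_cube[OF Q(1)] by (simp add: borel_compact)
  let ?F = "\<lambda>x. norm (S x) powr s * w x powr (1 - s)"
  have "(\<integral>\<^sup>+x. ennreal (?F x) * indicator Q x \<partial>lebesgue) \<le> (\<integral>\<^sup>+x. ennreal (M2 powr s) * (ennreal (w x) * (ennreal (G x powr s) * indicator B x)) \<partial>lebesgue)"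
  proof (rule nn_integral_mono_AE, use SG w_pos in eventually_elim)
    case (elim x)
    show ?case
    proof (cases "x \<in> Q")
      case True
      then have x: "x \<in> B" using Q by blast
      have "norm (S x) powr s \<le> (M2 * w x * G x) powr s" using elim x s by (intro powr_mono2) auto
      also have "\<dots> = M2 powr s * w x powr s * G x powr s" by (simp add: powr_mult)
      finally have "?F x \<le> M2 powr s * w x powr s * G x powr s * w x powr (1 - s)" by (rule mult_right_mono) simp
      also have "\<dots> = M2 powr s * (w x powr s * w x powr (1 - s)) * G x powr s" by simp
      also have "w x powr s * w x powr (1 - s) = w x" using elim by (subst powr_add[symmetric]) simp
      finally have "ennreal (?F x) \<le> ennreal (M2 powr s * w x * G x powr s)" by (rule ennreal_leI)
      also have "\<dots> = ennreal (M2 powr s) * (ennreal (w x) * ennreal (G x powr s))" using elim by (simp add: ennreal_mult' mult.assoc)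
      finally show ?thesis using True x by simp
    qed simp
  qed
  also have "\<dots> = ennreal (M2 powr s) * (\<integral>\<^sup>+x. ennreal (w x) * (ennreal (G x powr s) * indicator B x) \<partial>lebesgue)"
    by (rule nn_integral_cmult) measurable
  also have "(\<integral>\<^sup>+x. ennreal (w x) * (ennreal (G x powr s) * indicator B x) \<partial>lebesgue) = (\<integral>\<^sup>+x. ennreal (G x powr s) * indicator B x \<partial>wm w)"
    by (rule nn_integral_wm[symmetric]) measurable
  also have "ennreal (M2 powr s) * \<dots> \<le> ennreal (M2 powr s) * ennreal I" by (rule mult_left_mono[OF GI]) simp
  also have "\<dots> = ennreal (M2 powr s * I)" by (rule ennreal_mult'[symmetric]) simp
  finally have le: "(\<integral>\<^sup>+x. ennreal (?F x) * indicator Q x \<partial>lebesgue) \<le> ennreal (M2 powr s * I)" .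
  show int: "set_integrable lebesgue Q ?F"
    unfolding set_integrable_def
  proof (rule integrableI_bounded)
    have "(\<integral>\<^sup>+x. ennreal (norm (indicat_real Q x *\<^sub>R ?F x)) \<partial>lebesgue) = (\<integral>\<^sup>+x. ennreal (?F x) * indicator Q x \<partial>lebesgue)"
      by (rule nn_integral_cong) (auto simp: indicator_def)
    also have "\<dots> < \<infinity>" by (rule le_less_trans[OF le]) simp
    finally show "(\<integral>\<^sup>+x. ennreal (norm (indicat_real Q x *\<^sub>R ?F x)) \<partial>lebesgue) < \<infinity>" .
  qed measurable
  have "ennreal (LINT x:Q|lebesgue. ?F x) \<le> ennreal (M2 powr s * I)"
    using le nn_integral_set_integral[OF int] by simp
  then show "(LINT x:Q|lebesgue. ?F x) \<le> M2 powr s * I" using I by (subst (asm) ennreal_le_iff) auto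
qed

text \<open>Here \<open>N\<close> is any positive bound for the Morrey norm, not the norm itself, so that functions of norm
  zero need no separate treatment: Hoelder's inequality and Hedberg's inequality were proved for positive
  bounds.\<close>

lemma commutator_morrey_estimate:
  fixes T :: "(real^'n \<Rightarrow> 'b) \<Rightarrow> real^'n \<Rightarrow> 'b"
  assumes p: "1 < p" and s: "0 < s" "1/s = 1/p - \<alpha>" and \<kappa>: "0 < \<kappa>" "\<kappa> < p/s"
    and T: "\<And>f. f \<in> pv_domain K \<Longrightarrow> AE x in lebesgue. has_pv K f x (T f x)"
  obtains C where "0 \<le> C" "\<And>f N. f \<in> morrey p \<kappa> w w \<Longrightarrow> 0 < N \<Longrightarrow> morrey_norm p \<kappa> w w f \<le> ereal N \<Longrightarrow>
     commutator b T f \<in> Lp_loc s (\<lambda>x. w x powr (1 - s)) \<and>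
     morrey_norm s (\<kappa> * s / p) (\<lambda>x. w x powr (1 - s)) w (commutator b T f) \<le> ereal (C * N)"
proof -
  define \<mu> where "\<mu> = \<kappa> * s / p"
  have \<mu>: "0 < \<mu>" using \<kappa> s p by (simp add: \<mu>_def)
  define K3 where "K3 = A * real CARD('n) ^ CARD('n) / unit_ball_vol (real CARD('n))"
  define K4 where "K4 = A * (2 * real CARD('n)) ^ CARD('n) / unit_ball_vol (real CARD('n))"
  have K34: "0 < K3" "0 < K4" using A_pos by (auto simp: K3_def K4_def)
  show ?thesis
  proof (rule fractional_morrey[OF p \<alpha> s \<kappa>])
    fix Cf :: real
    assume Cf: "0 \<le> Cf" and frac:
      "\<And>g N x0 m. g \<in> borel_measurable (wm w) \<Longrightarrow> (\<And>x. 0 \<le> g x) \<Longrightarrow> 0 < N \<Longrightarrow>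
         (\<And>x k. (\<integral>\<^sup>+y. ennreal (g y powr p) * indicator (cball x (2 powi k)) y \<partial>wm w)
            \<le> ennreal (N powr p * V x (2 powi k) powr \<kappa>)) \<Longrightarrow>
         \<exists>G. G \<in> borel_measurable (wm w) \<and> (\<forall>x. 0 \<le> G x) \<and>
           (AE x in wm w. x \<in> cball x0 (2 powi m) \<longrightarrow> fractional \<alpha> g x \<le> ennreal (G x)) \<and>
           (\<integral>\<^sup>+x. ennreal (G x powr s) * indicator (cball x0 (2 powi m)) x \<partial>wm w)
             \<le> ennreal (Cf * N powr s * V x0 (2 powi m) powr (\<kappa> * s / p))"
    define C1 where "C1 = M2 powr s * (Cf * (K3 powr (\<kappa> / p)) powr s * K4 powr \<mu>)"
    have C1: "0 \<le> C1" using Cf by (simp add: C1_def)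
    show ?thesis
    proof (rule that[of "C1 powr (1 / s)"])
      show "0 \<le> C1 powr (1 / s)" by simp
      fix f :: "real^'n \<Rightarrow> 'b" and N :: real
      assume f: "f \<in> morrey p \<kappa> w w" and N: "0 < N" and fN: "morrey_norm p \<kappa> w w f \<le> ereal N"
      have fm[measurable]: "f \<in> borel_measurable lebesgue" using f by (simp add: morrey_def Lp_loc_def)
      let ?g = "\<lambda>y. norm (f y)" and ?S = "commutator b T f"
      define N' where "N' = N * K3 powr (\<kappa> / p)"
      have N': "0 < N'" using N K34 by (simp add: N'_def)
      have ball: "(\<integral>\<^sup>+y. ennreal (?g y powr p) * indicator (cball x r) y \<partial>wm w) \<le> ennreal (N' powr p * V x r powr \<kappa>)" if r: "0 < r" for x r
      proof -
        have "N powr p * (K3 * V x r) powr \<kappa> = N' powr p * V x r powr \<kappa>"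
          using p by (simp add: N'_def powr_mult powr_powr)
        then show ?thesis using morrey_cball[OF f fN _ _ \<kappa>(1) r, of x] N p unfolding K3_def[symmetric] by simp
      qed
      have gm: "?g \<in> borel_measurable (wm w)" by simp
      have fr: "\<exists>G. G \<in> borel_measurable lebesgue \<and> (\<forall>x. 0 \<le> G x) \<and>
           (AE x in lebesgue. x \<in> cball x0 (2 powi m) \<longrightarrow> fractional \<alpha> ?g x \<le> ennreal (G x)) \<and>
           (\<integral>\<^sup>+x. ennreal (G x powr s) * indicator (cball x0 (2 powi m)) x \<partial>wm w)
             \<le> ennreal (Cf * N' powr s * V x0 (2 powi m) powr \<mu>)" for x0 m
        using frac[OF gm norm_ge_zero N' ball, of x0 m] by (simp add: AE_wm_iff[OF weight] \<mu>_def)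
      have finite: "AE x in lebesgue. fractional \<alpha> ?g x < \<infinity>"
      proof (rule AE_fractional_finite)
        fix m :: int
        show "\<exists>G :: real^'n \<Rightarrow> real. AE x in wm w. x \<in> cball 0 (2 powi m) \<longrightarrow> fractional \<alpha> ?g x \<le> ennreal (G x)"
          using fr[of 0 m] unfolding AE_wm_iff[OF weight] by blast
      qed
      have locfin: "(\<integral>\<^sup>+y. ennreal (?g y) * indicator (cball x (2 powi k)) y \<partial>wm w) < \<infinity>" for x k
      proof (rule le_less_trans[OF hoelder_cball[OF gm norm_ge_zero p]])
        let ?X = "N' * V x (2 powi k) powr (\<kappa> / p)"
        show "0 < ?X" using N' V_dyadic_pos[of x k] by simp
        show "(\<integral>\<^sup>+y. ennreal (?g y powr p) * indicator (cball x (2 powi k)) y \<partial>wm w) \<le> ennreal (?X powr p)"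
          using ball[of "2 powi k" x] p by (simp add: powr_mult powr_powr)
      qed auto
      note locint = locally_integrable_products[OF fm locfin]
      have bfm: "(\<lambda>y. b y * f y) \<in> borel_measurable lebesgue" by measurable
      have pvd: "f \<in> pv_domain K"
        unfolding pv_domain_def
      proof (intro CollectI conjI locint)
        show "AE x in lebesgue. \<forall>\<epsilon>>0. set_integrable lebesgue {y. \<epsilon> < norm (x - y)} (\<lambda>y. K (x - y) * f y)"
          using AE_P finite by eventually_elim (auto intro: truncated_integrable[OF fm])
      qed
      have pvbd: "(\<lambda>y. b y * f y) \<in> pv_domain K"
        unfolding pv_domain_def
      proof (intro CollectI conjI locint)
        show "AE x in lebesgue. \<forall>\<epsilon>>0. set_integrable lebesgue {y. \<epsilon> < norm (x - y)} (\<lambda>y. K (x - y) * (b y * f y))"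
          using AE_P finite by eventually_elim (auto intro: truncated_integrable[OF fm])
      qed
      note pv = T[OF pvd] T[OF pvbd]
      have Sm: "?S \<in> borel_measurable lebesgue"
        unfolding commutator_def by (rule commutator_measurable[OF fm pv])
      have Sbound: "AE x in lebesgue. ennreal (norm (?S x)) \<le> ennreal (M2 * w x) * fractional \<alpha> ?g x"
        using AE_P finite pv
      proof eventually_elim
        case (elim x)
        then show ?case unfolding commutator_def by (intro commutator_pointwise fm)
      qed
      let ?F = "\<lambda>x. norm (?S x) powr s * w x powr (1 - s)"
      have cube: "set_integrable lebesgue Q ?F \<and> 0 < wmeas w Q \<and> (LINT x:Q|lebesgue. ?F x) \<le> C1 * N powr s * wmeas w Q powr \<mu>"
        if Q: "Q \<in> cubes" for Q
      proof -
        obtain x0 m where x0: "Q \<subseteq> cball x0 (2 powi m)" "0 < wmeas w Q" "V x0 (2 powi m) \<le> K4 * wmeas w Q"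
          using cube_in_cball[OF Q] unfolding K4_def by metis
        let ?B = "cball x0 (2 powi m)"
        obtain G where G: "G \<in> borel_measurable lebesgue" "\<And>x. 0 \<le> G x"
          and JG: "AE x in lebesgue. x \<in> ?B \<longrightarrow> fractional \<alpha> ?g x \<le> ennreal (G x)"
          and GI: "(\<integral>\<^sup>+x. ennreal (G x powr s) * indicator ?B x \<partial>wm w) \<le> ennreal (Cf * N' powr s * V x0 (2 powi m) powr \<mu>)"
          using fr by blast
        have SG: "AE x in lebesgue. x \<in> ?B \<longrightarrow> norm (?S x) \<le> M2 * w x * G x"
          using Sbound JG w_pos
        proof eventually_elim
          case (elim x)
          show ?case
          proof
            assume "x \<in> ?B"
            then have "ennreal (M2 * w x) * fractional \<alpha> ?g x \<le> ennreal (M2 * w x) * ennreal (G x)"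
              using elim by (intro mult_left_mono) auto
            also have "\<dots> = ennreal (M2 * w x * G x)" using elim M_pos by (intro ennreal_mult'[symmetric]) auto
            finally have "ennreal (norm (?S x)) \<le> ennreal (M2 * w x * G x)" using elim by (meson order_trans)
            then show "norm (?S x) \<le> M2 * w x * G x" using elim M_pos G(2)[of x] by (subst (asm) ennreal_le_iff) auto
          qed
        qed
        have I0: "0 \<le> Cf * N' powr s * V x0 (2 powi m) powr \<mu>" using Cf by simp
        have Bs: "?B \<in> sets lebesgue" by simp
        note est = set_integral_cube_le[OF Sm G s(1) Q x0(1) Bs SG GI I0]
        have "V x0 (2 powi m) powr \<mu> \<le> (K4 * wmeas w Q) powr \<mu>" using x0 \<mu> by (intro powr_mono2) auto
        also have "\<dots> = K4 powr \<mu> * wmeas w Q powr \<mu>" by (rule powr_mult)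
        finally have "M2 powr s * (Cf * N' powr s * V x0 (2 powi m) powr \<mu>) \<le> M2 powr s * (Cf * N' powr s * (K4 powr \<mu> * wmeas w Q powr \<mu>))"
          using Cf by (intro mult_left_mono) auto
        also have "\<dots> = C1 * N powr s * wmeas w Q powr \<mu>" by (simp add: C1_def N'_def powr_mult)
        finally show ?thesis by (intro conjI est(1) x0(2) order_trans[OF est(2)])
      qed
      show "?S \<in> Lp_loc s (\<lambda>x. w x powr (1 - s)) \<and> morrey_norm s (\<kappa> * s / p) (\<lambda>x. w x powr (1 - s)) w ?S \<le> ereal (C1 powr (1 / s) * N)"
      proof
        have "locally_integrable ?F"
          unfolding locally_integrable_def
        proof (intro allI impI)
          fix Z :: "(real^'n) set" assume Z: "compact Z"
          then obtain R where R: "0 < R" "Z \<subseteq> cball 0 R"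
            using bounded_subset_ballD[OF compact_imp_bounded[OF Z], of 0] ball_subset_cball by blast
          define Q where "Q = cbox ((0::real^'n) - R *\<^sub>R One) (0 - R *\<^sub>R One + (2 * R) *\<^sub>R One)"
          have "Z \<subseteq> Q" using R(2) cball_subset_cube[of 0 R] unfolding Q_def by (rule order_trans)
          moreover have "Q \<in> cubes" unfolding Q_def using R by (intro cube_mem_cubes) simp
          ultimately show "set_integrable lebesgue Z ?F"
            using cube[of Q] Z by (intro set_integrable_subset[where A = Q and B = Z]) (simp_all add: borel_compact)
        qed
        then show "?S \<in> Lp_loc s (\<lambda>x. w x powr (1 - s))" using Sm by (simp add: Lp_loc_def)
        show "morrey_norm s (\<kappa> * s / p) (\<lambda>x. w x powr (1 - s)) w ?S \<le> ereal (C1 powr (1 / s) * N)"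
          unfolding morrey_norm_def
        proof (rule SUP_least)
          fix Q :: "(real^'n) set" assume Q: "Q \<in> cubes"
          let ?I = "LINT x:Q|lebesgue. ?F x" and ?W = "wmeas w Q"
          note c = cube[OF Q]
          have W: "0 < ?W powr \<mu>" using c by simp
          have I0: "0 \<le> ?I" unfolding set_lebesgue_integral_def by (intro integral_nonneg_AE) auto
          have "1 / ?W powr \<mu> * ?I \<le> C1 * N powr s" using c W by (simp add: pos_divide_le_eq)
          then have "(1 / ?W powr \<mu> * ?I) powr (1 / s) \<le> (C1 * N powr s) powr (1 / s)"
            using I0 s(1) by (intro powr_mono2) auto
          also have "\<dots> = C1 powr (1 / s) * N" using s(1) N by (simp add: powr_mult powr_powr)
          finally show "ereal ((1 / ?W powr (\<kappa> * s / p) * ?I) powr (1 / s)) \<le> ereal (C1 powr (1 / s) * N)"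
            by (simp add: \<mu>_def)
        qed
      qed
    qed
  qed
qed

end

lemma morrey_norm_nonneg: "0 \<le> morrey_norm p \<kappa> u v (f :: real^'n \<Rightarrow> 'b::{banach, second_countable_topology})"
proof -
  have "cbox (0::real^'n) (0 + 1 *\<^sub>R One) \<in> cubes" by (rule cube_mem_cubes) simp
  then show ?thesis unfolding morrey_norm_def by (rule SUP_upper2) simp
qed

theorem theorem1p3:
  fixes \<beta> p s \<kappa> :: real
    and w :: "real^'n \<Rightarrow> real"
    and T :: "(real^'n \<Rightarrow> 'b::{real_normed_field, banach, second_countable_topology}) \<Rightarrow> real^'n \<Rightarrow> 'b"
    and b :: "real^'n \<Rightarrow> 'b"
  assumes "0 < \<beta>" and "\<beta> < 1"
    and "1 < p" and "p < CARD('n) / \<beta>"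
    and "1 / s = 1 / p - \<beta> / CARD('n)"
    and "0 < \<kappa>" and "\<kappa> < p / s"
    and "weight w"
    and "(\<lambda>x. w x powr (s / p)) \<in> A1"
    and "calderon_zygmund T"
    and "b \<in> Lip \<beta> w"
    and "critical_index w > ereal ((1 - \<kappa>) / (p / s - \<kappa>))"
  shows "morrey_bounded p \<kappa> w w s (\<kappa> * s / p) (\<lambda>x. w x powr (1 - s)) w (commutator b T)"
proof -
  have "\<beta> / CARD('n) < 1 / p" using assms(1,3,4) by (simp add: field_simps)
  then have s0: "0 < 1 / s" using assms(5) by simp
  have s: "0 < s" using s0 by (simp add: zero_less_divide_1_iff)
  have "1 / s < 1 / p" using assms(1,5) by simp
  then have sp: "1 < s / p" using s assms(3) by (simp add: field_simps)
  obtain A where A: "0 < A" "AE y in lebesgue. \<forall>x r. 0 < r \<longrightarrow> y \<in> cball x r \<longrightarrow>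
     measure (wm w) (cball x r) \<le> A * r ^ CARD('n) * w y"
    using A1_pointwise_cballs[OF assms(8,9) sp] by blast
  interpret pointwise_A1 w A using assms(8) A by unfold_locales auto
  obtain L c where L: "0 < L" and osc: "\<And>x r. 0 < r \<Longrightarrow> (\<integral>\<^sup>+y. ennreal (norm (b y - c x r)) * indicator (cball x r) y \<partial>lebesgue)
      \<le> ennreal (L * V x r powr (1 + \<beta> / CARD('n)))"
    using Lip_oscillation_cball[OF assms(11,1)] by blast
  have b_loc: "locally_integrable b" using assms(11) by (simp add: Lip_def)
  interpret lipschitz_oscillation w A b c L "\<beta> / CARD('n)"
    using locally_integrable_measurable[OF b_loc] L osc assms(1) by unfold_locales auto
  obtain K C0 C1 where T: "\<And>f. f \<in> pv_domain K \<Longrightarrow> AE x in lebesgue. has_pv K f x (T f x)"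
    and size: "\<And>x. x \<noteq> 0 \<Longrightarrow> norm (K x) \<le> C0 / norm x ^ CARD('n)"
    and reg: "\<And>x y. 0 < norm y \<Longrightarrow> 2 * norm y \<le> norm x \<Longrightarrow> norm (K (x - y) - K x) \<le> C1 * norm y / norm x ^ (CARD('n) + 1)"
    using assms(10) unfolding calderon_zygmund_def by blast
  obtain CL P where P: "0 < CL" "AE x in lebesgue. P x" "\<And>x. P x \<Longrightarrow> good x"
    "\<And>x y k. P x \<Longrightarrow> P y \<Longrightarrow> dist x y \<le> 2 powi k \<Longrightarrow> norm (b x - b y) \<le> CL * (w x + w y) * V x (2 powi k) powr (\<beta> / CARD('n))"
    using pointwise_lipschitz by metis
  have size': "norm (K x) \<le> max 1 C0 / norm x ^ CARD('n)" if "x \<noteq> 0" for x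
    by (rule order_trans[OF size[OF that]]) (auto intro: divide_right_mono)
  interpret lipschitz_kernel w A b c L "\<beta> / CARD('n)" K "max 1 C0" CL P
    using kernel_measurable[OF reg] P size' by unfold_locales auto
  obtain C where C: "0 \<le> C" and est: "\<And>f N. f \<in> morrey p \<kappa> w w \<Longrightarrow> 0 < N \<Longrightarrow> morrey_norm p \<kappa> w w f \<le> ereal N \<Longrightarrow>
     commutator b T f \<in> Lp_loc s (\<lambda>x. w x powr (1 - s)) \<and>
     morrey_norm s (\<kappa> * s / p) (\<lambda>x. w x powr (1 - s)) w (commutator b T f) \<le> ereal (C * N)"
    using commutator_morrey_estimate[OF assms(3) s assms(5,6,7) T] by metis
  show ?thesis
    unfolding morrey_bounded_def
  proof (intro exI[of _ C] ballI)
    fix f :: "real^'n \<Rightarrow> 'b" assume f: "f \<in> morrey p \<kappa> w w"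
    let ?S = "commutator b T f"
    let ?MS = "morrey_norm s (\<kappa> * s / p) (\<lambda>x. w x powr (1 - s)) w ?S"
    have "morrey_norm p \<kappa> w w f < \<infinity>" using f by (simp add: morrey_def)
    then obtain N0 where N0: "morrey_norm p \<kappa> w w f = ereal N0" "0 \<le> N0"
      using morrey_norm_nonneg[of p \<kappa> w w f] by (cases "morrey_norm p \<kappa> w w f") auto
    \<comment> \<open>the bound \<open>N0 + e\<close> is positive even if the norm \<open>N0\<close> vanishes\<close>
    have e: "?S \<in> Lp_loc s (\<lambda>x. w x powr (1 - s)) \<and> ?MS \<le> ereal (C * (N0 + e))" if "0 < e" for e
      using N0 that by (intro est f) auto
    have le: "?MS \<le> ereal (C * N0)"
    proof (rule ereal_le_epsilon2)
      fix e :: real assume e0: "0 < e"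
      have "C * (e / (C + 1)) \<le> e" using C e0 by (simp add: field_simps)
      then have "ereal (C * (N0 + e / (C + 1))) \<le> ereal (C * N0) + ereal e" by (simp add: distrib_left)
      moreover have "?MS \<le> ereal (C * (N0 + e / (C + 1)))" using e[of "e / (C + 1)"] C e0 by simp
      ultimately show "?MS \<le> ereal (C * N0) + ereal e" by (rule order_trans[rotated])
    qed
    then have "?MS < \<infinity>" using less_ereal.simps(4) order_le_less_trans by blast
    then show "?S \<in> morrey s (\<kappa> * s / p) (\<lambda>x. w x powr (1 - s)) w \<and> ?MS \<le> ereal C * morrey_norm p \<kappa> w w f"
      using e[of 1] le N0 by (simp add: morrey_def)
  qed
qed

end
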